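(* For any fixed positive integer $p$ and fixed integer $(r,s)\times t$ bimatrix $A$, there is an algorithm that, given a positive integer $n$, vectors $b\in\mathbb{Z}^{r+ns}$ and $l,u\in\mathbb{Z}^{nt}$, and a separable convex $p$-piecewise affine function $f:\mathbb{R}^{nt}\to\mathbb{R}$, solves in time $O(n^3L)$, where $L:=\langle f,b,l,u\rangle$, the program $$\min\left\{f(x)\ :\ A^{(n)}x=b,\ l\leq x\leq u,\ x\in\mathbb{Z}^{nt}\right\}.$$
   Context: An $(r,s)\times t$ bimatrix $A$ is an $(r+s)\times t$ matrix viewed as consisting of two blocks: $A_1$, its $r\times t$ submatrix of the first $r$ rows, and $A_2$, its $s\times t$ submatrix of the last $s$ rows. Its $n$-fold product is the $(r+ns)\times nt$ matrix $$A^{(n)}:=\begin{pmatrix} A_1&A_1&\cdots&A_1\\ A_2&0&\cdots&0\\ 0&A_2&\cdots&0\\ \vdots&\vdots&\ddots&\vdots\\ 0&0&\cdots&A_2\end{pmatrix}.$$ Vectors in $\mathbb{R}^{nt}$ are written as $x=(x^1,\dots,x^n)$ with bricks $x^i\in\mathbb{R}^t$. The function $f$ is separable convex $p$-piecewise affine if $f(x)=\sum_{i=1}^n\sum_{j=1}^t f^i_j(x^i_j)$ with each $f^i_j:\mathbb{R}\to\mathbb{R}$ univariate convex and $p$-piecewise affine, that is, the interval between the lower bound $l^i_j$ and the upper bound $u^i_j$ is partitioned into at most $p$ intervals with integer end-points, and the restriction of $f^i_j$ to each interval $k$ is an affine function $w^i_{j,k}x^i_j+a^i_{j,k}$ with all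 $w^i_{j,k},a^i_{j,k}$ integers. Such $f$ is given by its interval end-points and the integers $w^i_{j,k},a^i_{j,k}$, and $\langle f\rangle$ denotes the sum of the binary lengths of all of these. The binary length of an integer is the number of bits in its binary encoding, that of an integer vector is the sum of the binary lengths of its entries, and $\langle f,b,l,u\rangle$ is the sum of the binary lengths of $f,b,l,u$. "Solves" means that the algorithm either finds an optimal solution or asserts that there is no feasible point. "Time" is the number of arithmetic operations (additions, multiplications, divisions, comparisons). The constant hidden in $O(\cdot)$ depends only on $p$ and the fixed bimatrix $A$. *)

theory Defs
  imports "HOL-Analysis.Convex" "HOL-Library.Log_Nat" "Jordan_Normal_Form.Matrix"
begin

section \<open>The computational model\<close>

text \<open>
  Algorithms are programs of a fixed imperative language over arrays of integers, that is, an
  arithmetic random access machine.  A store maps an array name and an index to an integer; a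
  scalar is cell 0 of an array.  A program is a finite piece of syntax, so an algorithm is
  uniform in its input.
\<close>

type_synonym store = "string \<Rightarrow> int \<Rightarrow> int"

datatype aexp =
    Const int
  | Read string aexp
  | Add aexp aexp
  | Sub aexp aexp
  | Mul aexp aexp
  | Div aexp aexp

datatype bexp =
    Less aexp aexp
  | Equal aexp aexp
  | Not bexp
  | And bexp bexp

datatype com =
    Skip
  | Assign string aexp aexp
  | Seq com com
  | Cond bexp com com
  | While bexp com

text \<open>Division is floor division, and division by zero yields zero.\<close>

primrec aval :: "aexp \<Rightarrow> store \<Rightarrow> int" where
  "aval (Const c) \<sigma> = c"
| "aval (Read X e) \<sigma> = \<sigma> X (aval e \<sigma>)"
| "aval (Add e e') \<sigma> = aval e \<sigma> + aval e' \<sigma>"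
| "aval (Sub e e') \<sigma> = aval e \<sigma> - aval e' \<sigma>"
| "aval (Mul e e') \<sigma> = aval e \<sigma> * aval e' \<sigma>"
| "aval (Div e e') \<sigma> = aval e \<sigma> div aval e' \<sigma>"

primrec bval :: "bexp \<Rightarrow> store \<Rightarrow> bool" where
  "bval (Less e e') \<sigma> \<longleftrightarrow> aval e \<sigma> < aval e' \<sigma>"
| "bval (Equal e e') \<sigma> \<longleftrightarrow> aval e \<sigma> = aval e' \<sigma>"
| "bval (Not B) \<sigma> \<longleftrightarrow> \<not> bval B \<sigma>"
| "bval (And B B') \<sigma> \<longleftrightarrow> bval B \<sigma> \<and> bval B' \<sigma>"

text \<open>
  Time is the number of arithmetic operations and comparisons performed.  Every Boolean
  expression contains a comparison, so each evaluation of a loop test is charged at least one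
  unit; hence all uncharged steps (reads, writes, control flow) together exceed the charged ones
  by at most a factor and an additive term that depend on the program only.
\<close>

primrec acost :: "aexp \<Rightarrow> nat" where
  "acost (Const c) = 0"
| "acost (Read X e) = acost e"
| "acost (Add e e') = acost e + acost e' + 1"
| "acost (Sub e e') = acost e + acost e' + 1"
| "acost (Mul e e') = acost e + acost e' + 1"
| "acost (Div e e') = acost e + acost e' + 1"

primrec bcost :: "bexp \<Rightarrow> nat" where
  "bcost (Less e e') = acost e + acost e' + 1"
| "bcost (Equal e e') = acost e + acost e' + 1"
| "bcost (Not B) = bcost B"
| "bcost (And B B') = bcost B + bcost B'"

text \<open>
  \<open>exec c \<sigma> \<tau> \<sigma>'\<close>: started in store \<open>\<sigma>\<close>, the program \<open>c\<close> terminates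
  in store \<open>\<sigma>'\<close> after time \<open>\<tau>\<close>.
\<close>

inductive exec :: "com \<Rightarrow> store \<Rightarrow> nat \<Rightarrow> store \<Rightarrow> bool" where
  exec_Skip: "exec Skip \<sigma> 0 \<sigma>"
| exec_Assign:
    "exec (Assign X e e') \<sigma> (acost e + acost e') (\<sigma>(X := (\<sigma> X)(aval e \<sigma> := aval e' \<sigma>)))"
| exec_Seq:
    "exec c \<sigma> \<tau> \<sigma>' \<Longrightarrow> exec c' \<sigma>' \<tau>' \<sigma>'' \<Longrightarrow> exec (Seq c c') \<sigma> (\<tau> + \<tau>') \<sigma>''"
| exec_CondTrue:
    "bval B \<sigma> \<Longrightarrow> exec c \<sigma> \<tau> \<sigma>' \<Longrightarrow> exec (Cond B c c') \<sigma> (bcost B + \<tau>) \<sigma>'"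
| exec_CondFalse:
    "\<not> bval B \<sigma> \<Longrightarrow> exec c' \<sigma> \<tau> \<sigma>' \<Longrightarrow> exec (Cond B c c') \<sigma> (bcost B + \<tau>) \<sigma>'"
| exec_WhileFalse:
    "\<not> bval B \<sigma> \<Longrightarrow> exec (While B c) \<sigma> (bcost B) \<sigma>"
| exec_WhileTrue:
    "bval B \<sigma> \<Longrightarrow> exec c \<sigma> \<tau> \<sigma>' \<Longrightarrow> exec (While B c) \<sigma>' \<tau>' \<sigma>''
      \<Longrightarrow> exec (While B c) \<sigma> (bcost B + \<tau> + \<tau>') \<sigma>''"

inductive_cases exec_SkipE: "exec Skip \<sigma> \<tau> \<sigma>'"
inductive_cases exec_AssignE: "exec (Assign X e e') \<sigma> \<tau> \<sigma>'"
inductive_cases exec_SeqE: "exec (Seq c c') \<sigma> \<tau> \<sigma>'"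
inductive_cases exec_CondE: "exec (Cond B c c') \<sigma> \<tau> \<sigma>'"
inductive_cases exec_WhileE: "exec (While B c) \<sigma> \<tau> \<sigma>'"

lemma exec_deterministic:
  "exec c \<sigma> \<tau>\<^sub>1 \<sigma>\<^sub>1 \<Longrightarrow> exec c \<sigma> \<tau>\<^sub>2 \<sigma>\<^sub>2 \<Longrightarrow> \<tau>\<^sub>1 = \<tau>\<^sub>2 \<and> \<sigma>\<^sub>1 = \<sigma>\<^sub>2"
proof (induction arbitrary: \<tau>\<^sub>2 \<sigma>\<^sub>2 rule: exec.induct)
  case (exec_Seq c \<sigma> \<tau> \<sigma>' c' \<tau>' \<sigma>'')
  from exec_Seq.prems show ?case by (rule exec_SeqE) (use exec_Seq.IH in blast)
next
  case (exec_WhileTrue B \<sigma> c \<tau> \<sigma>' \<tau>' \<sigma>'')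
  from exec_WhileTrue.prems show ?case
    by (rule exec_WhileE) (use exec_WhileTrue in blast)+
qed (blast elim: exec_SkipE exec_AssignE exec_CondE exec_WhileE)+


section \<open>\<open>n\<close>-fold products\<close>

text \<open>
  A bimatrix with \<open>r\<close> rows in its upper and \<open>s\<close> rows in its lower block and with \<open>t\<close> columns is a
  matrix in \<open>carrier_mat (r + s) t\<close>.  All indices count from 0, so entry \<open>j\<close> of brick \<open>i\<close> of
  a vector of dimension \<open>n * t\<close> is its entry \<open>i * t + j\<close>.
\<close>

definition upper_block :: "nat \<Rightarrow> nat \<Rightarrow> 'a mat \<Rightarrow> 'a mat" where
  "upper_block r t A = mat r t (\<lambda>(i, j). A $$ (i, j))"

definition lower_block :: "nat \<Rightarrow> nat \<Rightarrow> nat \<Rightarrow> 'a mat \<Rightarrow> 'a mat" where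
  "lower_block r s t A = mat s t (\<lambda>(i, j). A $$ (r + i, j))"

definition nfold_product :: "nat \<Rightarrow> nat \<Rightarrow> nat \<Rightarrow> 'a::zero mat \<Rightarrow> nat \<Rightarrow> 'a mat" where
  "nfold_product r s t A n = mat (r + n * s) (n * t) (\<lambda>(i, j).
     if i < r then upper_block r t A $$ (i, j mod t)
     else if (i - r) div s = j div t then lower_block r s t A $$ ((i - r) mod s, j mod t)
     else 0)"

definition feasible_set ::
  "nat \<Rightarrow> nat \<Rightarrow> nat \<Rightarrow> int mat \<Rightarrow> nat \<Rightarrow> int vec \<Rightarrow> int vec \<Rightarrow> int vec \<Rightarrow> int vec set" where
  "feasible_set r s t A n b l u =
     {x \<in> carrier_vec (n * t). nfold_product r s t A n *\<^sub>v x = b \<and>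
        (\<forall>k<n * t. l $ k \<le> x $ k \<and> x $ k \<le> u $ k)}"


section \<open>Separable convex piecewise affine functions\<close>

text \<open>
  The description of a univariate function: the end-points \<open>c\<^sub>0 \<le> \<dots> \<le> c\<^sub>m\<close> of
  consecutive intervals and, for each interval, the pair of the slope \<open>w\<close> and the constant
  term \<open>a\<close>.
\<close>

record pwa =
  endpoints :: "int list"
  pieces :: "(int \<times> int) list"

text \<open>
  If \<open>lo > hi\<close> there is no interval to be partitioned, and the integers in the description
  are arbitrary.  A single interval may be degenerate, as it has to be if \<open>lo = hi\<close>.
\<close>

definition piecewise_affine :: "nat \<Rightarrow> int \<Rightarrow> int \<Rightarrow> (real \<Rightarrow> real) \<Rightarrow> pwa \<Rightarrow> bool" where
  "piecewise_affine p lo hi g d \<longleftrightarrow>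
     length (pieces d) \<le> p \<and> length (endpoints d) = length (pieces d) + 1 \<and>
     (lo \<le> hi \<longrightarrow>
        pieces d \<noteq> [] \<and> sorted (endpoints d) \<and> hd (endpoints d) = lo \<and> last (endpoints d) = hi \<and>
        (\<forall>k<length (pieces d).
           \<forall>y\<in>{real_of_int (endpoints d ! k)..real_of_int (endpoints d ! Suc k)}.
             g y = real_of_int (fst (pieces d ! k)) * y + real_of_int (snd (pieces d ! k))))"

definition separable_convex_piecewise_affine ::
  "nat \<Rightarrow> nat \<Rightarrow> nat \<Rightarrow> int vec \<Rightarrow> int vec \<Rightarrow> (real vec \<Rightarrow> real) \<Rightarrow> (nat \<Rightarrow> nat \<Rightarrow> pwa) \<Rightarrow> bool"
where
  "separable_convex_piecewise_affine p t n l u f F \<longleftrightarrow>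
     (\<exists>g :: nat \<Rightarrow> nat \<Rightarrow> real \<Rightarrow> real.
        (\<forall>x\<in>carrier_vec (n * t). f x = (\<Sum>i<n. \<Sum>j<t. g i j (x $ (i * t + j)))) \<and>
        (\<forall>i<n. \<forall>j<t. convex_on UNIV (g i j) \<and>
           piecewise_affine p (l $ (i * t + j)) (u $ (i * t + j)) (g i j) (F i j)))"


section \<open>Binary length\<close>

text \<open>
  The additional bit is the sign.  The length is \<open>1 + \<lceil>log\<^sub>2 (\<bar>z\<bar> + 1)\<rceil>\<close>; in
  particular, 0 has length 1.
\<close>

definition binary_length :: "int \<Rightarrow> nat" where
  "binary_length z = 1 + floorlog 2 (nat \<bar>z\<bar>)"

definition binary_length_vec :: "int vec \<Rightarrow> nat" where
  "binary_length_vec v = (\<Sum>k<dim_vec v. binary_length (v $ k))"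

definition binary_length_pwa :: "pwa \<Rightarrow> nat" where
  "binary_length_pwa d =
     (\<Sum>c\<leftarrow>endpoints d. binary_length c) +
     (\<Sum>(w, a)\<leftarrow>pieces d. binary_length w + binary_length a)"

definition input_length ::
  "nat \<Rightarrow> nat \<Rightarrow> (nat \<Rightarrow> nat \<Rightarrow> pwa) \<Rightarrow> int vec \<Rightarrow> int vec \<Rightarrow> int vec \<Rightarrow> nat" where
  "input_length t n F b l u =
     (\<Sum>i<n. \<Sum>j<t. binary_length_pwa (F i j)) +
     binary_length_vec b + binary_length_vec l + binary_length_vec u"


section \<open>Input and output\<close>

definition array :: "int list \<Rightarrow> int \<Rightarrow> int" where
  "array xs k = (if 0 \<le> k \<and> k < int (length xs) then xs ! nat k else 0)"

text \<open>
  The arrays \<open>b\<close>, \<open>l\<close>, \<open>u\<close> hold the vectors.  For the coordinate \<open>q = i * t + j\<close>,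
  cell \<open>q\<close> of \<open>m\<close> holds the number of intervals of the function \<open>f\<^sup>i\<^sub>j\<close>, the cells of
  \<open>c\<close> from \<open>q * (p + 1)\<close> on hold its end-points, and the cells of \<open>w\<close> and of
  \<open>a\<close> from \<open>q * p\<close> on hold its slopes and its constant terms.  All cells that are not
  part of the input are 0.
\<close>

definition block_array :: "nat \<Rightarrow> nat \<Rightarrow> (nat \<Rightarrow> int list) \<Rightarrow> int \<Rightarrow> int" where
  "block_array width N xs k =
     (if 0 \<le> k \<and> k < int (N * width) then array (xs (nat k div width)) (k mod int width) else 0)"

definition input_store ::
  "nat \<Rightarrow> nat \<Rightarrow> nat \<Rightarrow> (nat \<Rightarrow> nat \<Rightarrow> pwa) \<Rightarrow> int vec \<Rightarrow> int vec \<Rightarrow> int vec \<Rightarrow> store" where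
  "input_store p t n F b l u =
     (let d = (\<lambda>q. F (q div t) (q mod t)); N = n * t in
      (\<lambda>_ _. 0)
        (''n'' := array [int n],
         ''b'' := array (list_of_vec b),
         ''l'' := array (list_of_vec l),
         ''u'' := array (list_of_vec u),
         ''m'' := block_array 1 N (\<lambda>q. [int (length (pieces (d q)))]),
         ''c'' := block_array (p + 1) N (\<lambda>q. endpoints (d q)),
         ''w'' := block_array p N (\<lambda>q. map fst (pieces (d q))),
         ''a'' := block_array p N (\<lambda>q. map snd (pieces (d q)))))"

text \<open>
  The final store is the answer to the problem: either the scalar \<open>feasible\<close> is 0 and there is no
  feasible point, or it is 1 and the first \<open>N\<close> cells of \<open>x\<close> form an optimal solution.
\<close>

definition output_vec :: "nat \<Rightarrow> store \<Rightarrow> int vec" where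
  "output_vec N \<sigma> = vec N (\<lambda>k. \<sigma> ''x'' (int k))"

definition is_optimal :: "int vec set \<Rightarrow> (real vec \<Rightarrow> real) \<Rightarrow> int vec \<Rightarrow> bool" where
  "is_optimal S f x \<longleftrightarrow>
     x \<in> S \<and> (\<forall>y\<in>S. f (map_vec real_of_int x) \<le> f (map_vec real_of_int y))"

definition solves :: "nat \<Rightarrow> int vec set \<Rightarrow> (real vec \<Rightarrow> real) \<Rightarrow> store \<Rightarrow> bool" where
  "solves N S f \<sigma> \<longleftrightarrow>
     \<sigma> ''feasible'' 0 = 0 \<and> S = {} \<or>
     \<sigma> ''feasible'' 0 = 1 \<and> is_optimal S f (output_vec N \<sigma>)"

end

theory Submission
  imports Defs "HOL-Library.Multiset" "HOL-Library.Countable"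
begin

text \<open>
  Scaling over a chain of lattices.  For a step length \<open>\<lambda>\<close>, a power of two, and \<open>k \<le> N = n * T\<close>, call a
  point \<open>x\<close> optimal at stage \<open>(\<lambda>, k)\<close> if no feasible \<open>x + \<lambda> h\<close> is better, where \<open>h\<close> ranges over the
  integer kernel vectors of the n-fold product that are even in all coordinates from \<open>k\<close> on.  For \<open>\<lambda>\<close>
  larger than the box every point is optimal at stage \<open>(\<lambda>, 0)\<close>; stage \<open>(2\<lambda>, N)\<close> is stage
  \<open>(\<lambda>, 0)\<close>; and stage \<open>(1, N)\<close> is the optimality wanted.

  Passing from \<open>k\<close> to \<open>k + 1\<close> replaces the lattice by one in which it has index at most two.  If a
  better point is reached by \<open>h\<close> and \<open>h\<close> splits conformally into two lattice vectors, then one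
  of them, or \<open>h\<close> itself, lies in the coarser lattice and can be discarded by separable convexity.
  So a conformally indecomposable \<open>h\<close> suffices.  By Dickson's lemma, applied first to single bricks
  and then to multisets of bricks, these have norm at most a constant that does not depend on \<open>n\<close>.
  All their partial row sums are bounded as well, and a dynamic program with a constant number of
  states finds the best such step in time \<open>O(n)\<close>.  There are \<open>O(L)\<close> step lengths and \<open>O(n)\<close> stages for
  each: in total, \<open>O(n\<^sup>2 L)\<close>.
\<close>

section \<open>Dickson's lemma\<close>

text \<open>Repeated best augmentation would take a number of steps governed by the range of the
  objective. Along the chain of lattices a single step restores optimality at each stage, so the
  number of stages is governed by the widths of the box alone; this is what permits a penalty far
  larger than the original costs. Index two is essential to the single step: of two integers and
  their sum one is always even, whereas modulo three the residues 1, 1, 2 contain no zero. The norm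
  bound \<open>K\<close> becomes part of the program text, so it has to be uniform in
  \<open>n\<close> and in the set of coordinates required to be even, a set that changes with every
  stage. Its mere existence is enough. Slack columns provide a feasible start. From then on all
  moves are kernel vectors, so the equations are never looked at again. Slopes and constant terms
  are integers, so costs at integer points of the box are integers, and the program computes with
  integers throughout.\<close>

lemma nat_seq_mono_subseq:
  fixes g :: "nat \<Rightarrow> nat"
  shows "\<exists>\<phi> :: nat \<Rightarrow> nat. strict_mono \<phi> \<and> mono (g \<circ> \<phi>)"
proof -
  obtain \<phi> :: "nat \<Rightarrow> nat" where \<phi>: "strict_mono \<phi>" "monoseq (\<lambda>k. g (\<phi> k))"
    using seq_monosub[of g] by (auto simp: o_def)
  show ?thesis
  proof (cases "mono (g \<circ> \<phi>)")
    case True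
    with \<phi> show ?thesis by blast
  next
    case False
    with \<phi>(2) have dec: "g (\<phi> j) \<le> g (\<phi> i)" if "i \<le> j" for i j
      using that by (auto simp: monoseq_def mono_def)
    \<comment> \<open>Values along \<open>\<phi>\<close> are nonincreasing naturals, so they are
      constant from a place where the least one is attained; shifting to that place gives the
      subsequence.\<close>
    obtain k where k: "\<And>j. g (\<phi> k) \<le> g (\<phi> j)"
      using ex_has_least_nat[of "\<lambda>_. True" 0 "\<lambda>j. g (\<phi> j)"] by auto
    have "g (\<phi> (k + j)) = g (\<phi> k)" for j
      using dec[of k "k + j"] k[of "k + j"] by simp
    then have "mono (g \<circ> (\<lambda>j. \<phi> (k + j)))" by (simp add: mono_def)
    moreover have "strict_mono (\<lambda>j. \<phi> (k + j))"
      using \<phi>(1) by (simp add: strict_mono_def)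
    ultimately show ?thesis by blast
  qed
qed

text \<open>One thinning per element of \<open>G\<close>: a monotone sequence stays monotone along a
  subsequence, so the elements treated before are not spoiled.\<close>

lemma dickson_subseq:
  fixes f :: "nat \<Rightarrow> 'a \<Rightarrow> nat"
  assumes "finite G"
  shows "\<exists>\<phi> :: nat \<Rightarrow> nat. strict_mono \<phi> \<and> (\<forall>x\<in>G. mono (\<lambda>k. f (\<phi> k) x))"
  using assms
proof (induction G)
  case empty
  show ?case by (auto intro: exI[of _ id] simp: strict_mono_def)
next
  case (insert y G)
  then obtain \<phi> :: "nat \<Rightarrow> nat" where \<phi>: "strict_mono \<phi>" "\<forall>x\<in>G. mono (\<lambda>k. f (\<phi> k) x)" by blast
  obtain \<psi> :: "nat \<Rightarrow> nat" where \<psi>: "strict_mono \<psi>" "mono ((\<lambda>k. f (\<phi> k) y) \<circ> \<psi>)"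
    using nat_seq_mono_subseq by blast
  have "strict_mono (\<phi> \<circ> \<psi>)" using \<phi>(1) \<psi>(1) by (simp add: strict_mono_def)
  moreover have "mono (\<lambda>k. f ((\<phi> \<circ> \<psi>) k) x)" if "x \<in> G" for x
  proof (rule monoI)
    fix i j :: nat assume "i \<le> j"
    then have "\<psi> i \<le> \<psi> j" using \<psi>(1) by (simp add: strict_mono_less_eq)
    then show "f ((\<phi> \<circ> \<psi>) i) x \<le> f ((\<phi> \<circ> \<psi>) j) x"
      using \<phi>(2) that by (auto simp: mono_def)
  qed
  ultimately show ?case using \<psi>(2) by (intro exI[of _ "\<phi> \<circ> \<psi>"]) (auto simp: o_def)
qed

text \<open>Otherwise each bound \<open>K\<close> has an element of \<open>X\<close> below which
  only sizes above \<open>K\<close> occur. Using the size of one such element as the next bound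
  gives a sequence of increasing sizes, in which two elements comparable in all counts are
  contradictory. The bound concerns an arbitrary \<open>sz\<close>, so \<open>cnt\<close> may forget
  part of an element.\<close>

lemma dickson_bound:
  fixes cnt :: "'b \<Rightarrow> 'a \<Rightarrow> nat" and sz :: "'b \<Rightarrow> nat"
  assumes "finite G"
  shows "\<exists>K. \<forall>x\<in>X. \<exists>y\<in>X. (\<forall>g\<in>G. cnt y g \<le> cnt x g) \<and> sz y \<le> K"
proof (rule ccontr)
  define bad where "bad = (\<lambda>K x. x \<in> X \<and> (\<forall>y\<in>X. (\<forall>g\<in>G. cnt y g \<le> cnt x g) \<longrightarrow> K < sz y))"
  assume neg: "\<not> ?thesis"
  have ex: "\<exists>x. bad K x" for K
  proof -
    from neg obtain x where "x \<in> X"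
      "\<And>y. y \<in> X \<Longrightarrow> (\<forall>g\<in>G. cnt y g \<le> cnt x g) \<Longrightarrow> \<not> sz y \<le> K" by blast
    then have "bad K x" unfolding bad_def by (auto simp: not_le)
    then show ?thesis ..
  qed
  define pick where "pick K = (SOME x. bad K x)" for K
  have pick: "bad K (pick K)" for K unfolding pick_def using ex by (rule someI_ex)
  define f where "f = rec_nat (pick 0) (\<lambda>_ x. pick (sz x))"
  have f_Suc: "f (Suc k) = pick (sz (f k))" for k by (simp add: f_def)
  have fX: "f k \<in> X" for k
    using pick by (cases k) (auto simp: f_def bad_def)
  have "sz (f k) < sz (f (Suc k))" for k
    using pick[of "sz (f k)"] unfolding f_Suc[symmetric] bad_def by blast
  then have sz_mono: "mono (\<lambda>k. sz (f k))" by (simp add: mono_iff_le_Suc less_imp_le)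
  obtain \<phi> :: "nat \<Rightarrow> nat" where \<phi>: "strict_mono \<phi>" "\<forall>g\<in>G. mono (\<lambda>k. cnt (f (\<phi> k)) g)"
    using dickson_subseq[OF assms, of "\<lambda>k. cnt (f k)"] by blast
  have "\<phi> 0 < \<phi> 1" using \<phi>(1) by (simp add: strict_mono_def)
  \<comment> \<open>\<open>f (Suc j)\<close> was picked against the bound \<open>sz (f j)\<close>,
    yet \<open>f (\<phi> 0)\<close> lies below it and has at most this size.\<close>
  then obtain j where j: "\<phi> 1 = Suc j" and "\<phi> 0 \<le> j" by (cases "\<phi> 1") auto
  then have "sz (f (\<phi> 0)) \<le> sz (f j)" using sz_mono by (simp add: mono_def)
  moreover have "\<forall>g\<in>G. cnt (f (\<phi> 0)) g \<le> cnt (f (Suc j)) g"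

  proof
    fix g assume "g \<in> G"
    then have "mono (\<lambda>k. cnt (f (\<phi> k)) g)" using \<phi>(2) by blast
    from monoD[OF this, of 0 1] show "cnt (f (\<phi> 0)) g \<le> cnt (f (Suc j)) g" by (simp add: j del: One_nat_def)
  qed
  ultimately show False
    using pick[of "sz (f j)"] fX[of "\<phi> 0"] unfolding f_Suc[symmetric] bad_def by (meson leD)
qed

lemma sum_bricks: "(\<Sum>q<n * T. f q) = (\<Sum>i<n. \<Sum>j<T. f (i * T + j))"
  for f :: "nat \<Rightarrow> 'a :: comm_monoid_add"
proof -
  have "(\<Sum>q<n * T. f q) = (\<Sum>i<n. \<Sum>q=i * T..<i * T + T. f q)"
    by (rule sum.nat_group[symmetric])
  also have "\<dots> = (\<Sum>i<n. \<Sum>j<T. f (i * T + j))"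
  proof (rule sum.cong[OF refl])
    fix i show "(\<Sum>q=i * T..<i * T + T. f q) = (\<Sum>j<T. f (i * T + j))"
      by (rule sum.reindex_bij_witness[of _ "\<lambda>j. i * T + j" "\<lambda>q. q - i * T"]) auto
  qed
  finally show ?thesis .
qed

lemma brick_index: "i < n \<Longrightarrow> j < (T::nat) \<Longrightarrow> i * T + j < n * T"
proof -
  assume "i < n" "j < T"
  then have "Suc i * T \<le> n * T" by (intro mult_le_mono1) simp
  then show ?thesis using \<open>j < T\<close> by simp
qed

lemma brick_div_mod:
  assumes "j < (T :: nat)"
  shows "(i * T + j) div T = i" "(i * T + j) mod T = j"
  using assms by auto

section \<open>Conformal decompositions in the kernel of an n-fold product\<close>

definition conformal :: "(nat \<Rightarrow> int) \<Rightarrow> (nat \<Rightarrow> int) \<Rightarrow> bool" where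
  "conformal g h \<longleftrightarrow> (\<forall>q. 0 \<le> g q \<and> g q \<le> h q \<or> h q \<le> g q \<and> g q \<le> 0)"

text \<open>Splitting entries into positive and negative parts turns the conformal order into a
  product order on naturals, the form that Dickson's lemma needs.\<close>

lemma conformal_nat_iff:
  "conformal g h \<longleftrightarrow> (\<forall>q. nat (g q) \<le> nat (h q) \<and> nat (- g q) \<le> nat (- h q))"
  unfolding conformal_def by (rule all_cong1) arith

lemma conformal_abs_diff: "conformal g h \<Longrightarrow> \<bar>h q - g q\<bar> = \<bar>h q\<bar> - \<bar>g q\<bar>"
  unfolding conformal_def by (drule spec[of _ q]) arith

lemma conformal_minus: "conformal g h \<Longrightarrow> conformal (\<lambda>q. h q - g q) h"
  unfolding conformal_def by (rule allI) (drule_tac x = q in spec, arith)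

definition in_box :: "nat \<Rightarrow> (nat \<Rightarrow> int) \<Rightarrow> (nat \<Rightarrow> int) \<Rightarrow> (nat \<Rightarrow> int) \<Rightarrow> bool" where
  "in_box N lo up x \<longleftrightarrow> (\<forall>q<N. lo q \<le> x q \<and> x q \<le> up q)"

definition obj :: "nat \<Rightarrow> (nat \<Rightarrow> int \<Rightarrow> int) \<Rightarrow> (nat \<Rightarrow> int) \<Rightarrow> int" where
  "obj N cost x = (\<Sum>q<N. cost q (x q))"

text \<open>Increments of equal sign cost at least as much together as separately. Only
  \<open>x\<close> and \<open>x + a + b\<close> are required to lie in the interval, since
  \<open>x + a\<close> and \<open>x + b\<close> lie between them; outside it the costs carry no
  information.\<close>

definition discretely_convex :: "int \<Rightarrow> int \<Rightarrow> (int \<Rightarrow> int) \<Rightarrow> bool" where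
  "discretely_convex lo up \<phi> \<longleftrightarrow> (\<forall>x a b. lo \<le> x \<longrightarrow> x \<le> up \<longrightarrow> lo \<le> x + a + b \<longrightarrow> x + a + b \<le> up \<longrightarrow>
     0 \<le> a * b \<longrightarrow> \<phi> (x + a) + \<phi> (x + b) \<le> \<phi> x + \<phi> (x + a + b))"

abbreviation move :: "(nat \<Rightarrow> int) \<Rightarrow> int \<Rightarrow> (nat \<Rightarrow> int) \<Rightarrow> nat \<Rightarrow> int" where
  "move x lam h \<equiv> (\<lambda>q. x q + lam * h q)"

text \<open>
  Vectors are functions on the flat index \<open>q = i * T + j\<close>.  \<open>lattice n P\<close> is the lattice of integer
  vectors in the kernel of the n-fold product that are even on \<open>P\<close>.
\<close>

locale nfold_lattice =
  fixes T r R :: nat and E :: "nat \<Rightarrow> nat \<Rightarrow> int"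
  assumes T_pos: "0 < T"
begin

definition row :: "nat \<Rightarrow> (nat \<Rightarrow> int) \<Rightarrow> int" where
  "row \<rho> v = (\<Sum>j<T. E \<rho> j * v j)"

definition brick :: "(nat \<Rightarrow> int) \<Rightarrow> nat \<Rightarrow> nat \<Rightarrow> int" where
  "brick h i j = (if j < T then h (i * T + j) else 0)"

definition place :: "nat \<Rightarrow> (nat \<Rightarrow> int) \<Rightarrow> nat \<Rightarrow> int" where
  "place i v q = (if q div T = i then v (q mod T) else 0)"

definition l1 :: "nat \<Rightarrow> (nat \<Rightarrow> int) \<Rightarrow> nat" where
  "l1 N h = (\<Sum>q<N. nat \<bar>h q\<bar>)"

text \<open>Parities and lower equations concern each brick alone and survive cutting into bricks;
  the upper equations, added in \<open>lattice\<close>, couple the bricks. Zeros from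
  \<open>n * T\<close> on make equality of functions coincide with equality of vectors.\<close>

definition low_lattice :: "nat \<Rightarrow> nat set \<Rightarrow> (nat \<Rightarrow> int) set" where
  "low_lattice n P = {h. (\<forall>q\<ge>n * T. h q = 0) \<and> (\<forall>q\<in>P. even (h q)) \<and>
     (\<forall>i<n. \<forall>\<rho>\<in>{r..<R}. row \<rho> (brick h i) = 0)}"

definition lattice :: "nat \<Rightarrow> nat set \<Rightarrow> (nat \<Rightarrow> int) set" where
  "lattice n P = {h \<in> low_lattice n P. \<forall>\<rho><r. (\<Sum>i<n. row \<rho> (brick h i)) = 0}"

lemma row_add: "row \<rho> (\<lambda>j. v j + w j) = row \<rho> v + row \<rho> w"
  by (simp add: row_def distrib_left sum.distrib)

lemma row_diff: "row \<rho> (\<lambda>j. v j - w j) = row \<rho> v - row \<rho> w"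
  by (simp add: row_def right_diff_distrib sum_subtractf)

lemma row_zero [simp]: "row \<rho> (\<lambda>j. 0) = 0"
  by (simp add: row_def)

lemma brick_add: "brick (\<lambda>q. g q + h q) i = (\<lambda>j. brick g i j + brick h i j)"
  by (auto simp: brick_def)

lemma brick_diff: "brick (\<lambda>q. g q - h q) i = (\<lambda>j. brick g i j - brick h i j)"
  by (auto simp: brick_def)

lemma brick_place:
  assumes "\<forall>j\<ge>T. v j = 0"
  shows "brick (place i v) i' = (if i' = i then v else (\<lambda>j. 0))"
  using assms T_pos by (auto simp: brick_def place_def fun_eq_iff not_less)

lemma l1_diff:
  assumes "conformal g h"
  shows "l1 N g + l1 N (\<lambda>q. h q - g q) = l1 N h"
  unfolding l1_def sum.distrib[symmetric]
proof (rule sum.cong[OF refl])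
  fix q show "nat \<bar>g q\<bar> + nat \<bar>h q - g q\<bar> = nat \<bar>h q\<bar>"
    using conformal_abs_diff[OF assms, of q] by linarith
qed

lemma lattice_diff: "g \<in> lattice n P \<Longrightarrow> h \<in> lattice n P \<Longrightarrow> (\<lambda>q. h q - g q) \<in> lattice n P"
  by (simp add: lattice_def low_lattice_def brick_diff row_diff sum_subtractf)

lemma lattice_add: "g \<in> lattice n P \<Longrightarrow> h \<in> lattice n P \<Longrightarrow> (\<lambda>q. g q + h q) \<in> lattice n P"
  by (simp add: lattice_def low_lattice_def brick_add row_add sum.distrib)

lemma lattice_zero: "(\<lambda>_. 0) \<in> lattice n P"
  by (simp add: lattice_def low_lattice_def brick_def[abs_def])

lemma l1_eq_0_iff: "\<forall>q\<ge>N. h q = 0 \<Longrightarrow> l1 N h = 0 \<longleftrightarrow> h = (\<lambda>_. 0)"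
  unfolding l1_def by (auto simp: fun_eq_iff) (metis lessThan_iff not_le)

section \<open>Small conformal parts of lattice vectors\<close>

definition brick_lattice :: "nat set \<Rightarrow> (nat \<Rightarrow> int) set" where
  "brick_lattice P = {v. (\<forall>j\<ge>T. v j = 0) \<and> (\<forall>j\<in>P. even (v j)) \<and> (\<forall>\<rho>\<in>{r..<R}. row \<rho> v = 0)}"

text \<open>
  The third family of coordinates in Dickson's lemma makes the parity pattern part of the order, so
  that one bound serves all patterns.
\<close>

lemma small_brick:
  "\<exists>K. \<forall>P v. v \<in> brick_lattice P \<longrightarrow> v \<noteq> (\<lambda>_. 0) \<longrightarrow>
     (\<exists>v'\<in>brick_lattice P. v' \<noteq> (\<lambda>_. 0) \<and> conformal v' v \<and> l1 T v' \<le> K)"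
proof -
  define X where "X = {(P, v). v \<in> brick_lattice P \<and> v \<noteq> (\<lambda>_. 0)}"
  define cnt :: "nat set \<times> (nat \<Rightarrow> int) \<Rightarrow> nat \<times> nat \<Rightarrow> nat" where
    "cnt = (\<lambda>(P, v) (j, m). if m = 0 then nat (v j) else if m = 1 then nat (- v j) else
       of_bool (j \<notin> P))"
  have fin: "finite ({..<T} \<times> {..<3::nat})" by simp
  obtain K where K: "\<forall>x\<in>X. \<exists>y\<in>X. (\<forall>g\<in>{..<T} \<times> {..<3::nat}. cnt y g \<le> cnt x g) \<and>
      l1 T (snd y) \<le> K"
    using dickson_bound[OF fin, where sz = "\<lambda>y. l1 T (snd y)"] by blast
  show ?thesis
  proof (intro exI allI impI)
    fix P v assume v: "v \<in> brick_lattice P" "v \<noteq> (\<lambda>_. 0)"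
    then have "(P, v) \<in> X" by (simp add: X_def)
    with K obtain P' v' where y: "(P', v') \<in> X" "l1 T v' \<le> K"
      "\<forall>g\<in>{..<T} \<times> {..<3::nat}. cnt (P', v') g \<le> cnt (P, v) g" by fastforce
    have z: "v j = 0" "v' j = 0" if "\<not> j < T" for j
      using v y(1) that by (auto simp: X_def brick_lattice_def)
    have "nat (v' j) \<le> nat (v j) \<and> nat (- v' j) \<le> nat (- v j)" for j
    proof (cases "j < T")
      case True
      then show ?thesis using y(3)[rule_format, of "(j, 0)"] y(3)[rule_format, of "(j, 1)"]
        by (simp add: cnt_def)
    qed (simp add: z)
    then have "conformal v' v" by (simp add: conformal_nat_iff)
    moreover have "even (v' j)" if "j \<in> P" for j
    proof (cases "j < T")
      case True
      then have "j \<in> P'" using y(3)[rule_format, of "(j, 2)"] that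
        by (auto simp: cnt_def split: if_splits)
      then show ?thesis using y(1) by (auto simp: X_def brick_lattice_def)
    qed (simp add: z)
    ultimately show "\<exists>v'\<in>brick_lattice P. v' \<noteq> (\<lambda>_. 0) \<and> conformal v' v \<and> l1 T v' \<le> K"
      using y(1,2) by (intro bexI[of _ v']) (auto simp: X_def brick_lattice_def)
  qed
qed

text \<open>A brick is kept with its position because the parity pattern differs from brick to
  brick. Forgetting positions by \<open>image_mset snd\<close> leaves the upper row sums
  unchanged.\<close>

definition assemble :: "(nat \<times> (nat \<Rightarrow> int)) multiset \<Rightarrow> nat \<Rightarrow> int" where
  "assemble M q = (\<Sum>(i, v)\<in>#M. place i v q)"

definition small_bricks :: "nat \<Rightarrow> nat \<Rightarrow> nat set \<Rightarrow> (nat \<times> (nat \<Rightarrow> int)) set" where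
  "small_bricks K n P = {(i, v). i < n \<and> v \<in> brick_lattice {j. i * T + j \<in> P} \<and>
     v \<noteq> (\<lambda>_. 0) \<and> l1 T v \<le> K}"

text \<open>A nonzero brick of \<open>h\<close> has a small nonzero conformal part with the parities
  of its position. Subtracting it lowers the norm and leaves a vector conformal to \<open>h\<close>,
  so all later pieces are conformal to \<open>h\<close> as well.\<close>

lemma decompose:
  assumes K: "\<And>P v. v \<in> brick_lattice P \<Longrightarrow> v \<noteq> (\<lambda>_. 0) \<Longrightarrow>
     \<exists>v'\<in>brick_lattice P. v' \<noteq> (\<lambda>_. 0) \<and> conformal v' v \<and> l1 T v' \<le> K"
    and "h \<in> low_lattice n P"
  shows "\<exists>M. set_mset M \<subseteq> small_bricks K n P \<and> assemble M = h \<and>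
    (\<forall>(i, v)\<in>#M. conformal (place i v) h)"
  using assms(2)
proof (induction "l1 (n * T) h" arbitrary: h rule: less_induct)
  case less
  show ?case
  proof (cases "h = (\<lambda>_. 0)")
    case True
    then show ?thesis by (intro exI[of _ "{#}"]) (auto simp: assemble_def[abs_def])
  next
    case False
    then obtain q where q: "h q \<noteq> 0" by auto
    with less.prems have qN: "q < n * T" by (auto simp: low_lattice_def) (meson not_le)
    define i where "i = q div T"
    have i: "i < n" using qN T_pos by (simp add: i_def less_mult_imp_div_less)
    let ?P = "{j. i * T + j \<in> P}"
    have "brick h i \<in> brick_lattice ?P"
      using less.prems i by (auto simp: brick_lattice_def low_lattice_def brick_def)
    moreover have "brick h i (q mod T) = h q" using T_pos by (simp add: brick_def i_def)
    then have "brick h i \<noteq> (\<lambda>_. 0)" using q by auto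
    ultimately obtain v where v: "v \<in> brick_lattice ?P" "v \<noteq> (\<lambda>_. 0)"
      "conformal v (brick h i)" "l1 T v \<le> K" using K by blast
    have vT: "\<forall>j\<ge>T. v j = 0" using v(1) by (simp add: brick_lattice_def)
    have conf: "conformal (place i v) h" unfolding conformal_def
    proof
      fix q' :: nat
      have "brick h (q' div T) (q' mod T) = h q'" using T_pos by (simp add: brick_def)
      then show "0 \<le> place i v q' \<and> place i v q' \<le> h q' \<or> h q' \<le> place i v q' \<and> place i v q' \<le> 0"
        using v(3)[unfolded conformal_def, rule_format, of "q' mod T"]
        by (auto simp: place_def)
    qed
    let ?h = "\<lambda>q. h q - place i v q"
    have pz: "place i v q = 0" if "q \<ge> n * T" for q
      using i that T_pos by (auto simp: place_def) (metis div_le_mono leD nonzero_mult_div_cancel_right not_gr_zero)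
    have pe: "even (place i v q)" if "q \<in> P" for q
      using v(1) that by (auto simp: place_def brick_lattice_def)
    have rows: "row \<rho> (brick ?h i') = 0" if "i' < n" "\<rho> \<in> {r..<R}" for i' \<rho>
      using less.prems v(1) that
      by (auto simp: brick_diff row_diff brick_place[OF vT] low_lattice_def brick_lattice_def)
    have mem: "?h \<in> low_lattice n P"
      using less.prems pz pe rows by (auto simp: low_lattice_def)
    obtain j where j: "v j \<noteq> 0" using v(2) by auto
    then have jT: "j < T" using vT by (meson not_le)
    have "place i v (i * T + j) \<noteq> 0" using jT j by (simp add: place_def)
    then have "l1 (n * T) (place i v) \<noteq> 0" using pz by (subst l1_eq_0_iff) auto
    then have "l1 (n * T) ?h < l1 (n * T) h" using l1_diff[OF conf, of "n * T"] by simp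
    then obtain M where M: "set_mset M \<subseteq> small_bricks K n P" "assemble M = ?h"
      "\<forall>(i, v)\<in>#M. conformal (place i v) ?h" using less.hyps mem by blast
    have "assemble (add_mset (i, v) M) = h"
      using M(2) by (auto simp: assemble_def fun_eq_iff)
    moreover have "conformal (place i' v') h" if "(i', v') \<in># M" for i' v'
      using M(3) that conformal_minus[OF conf] unfolding conformal_def
      by (smt (verit) case_prodD)
    moreover have "(i, v) \<in> small_bricks K n P" using v i by (simp add: small_bricks_def)
    ultimately show ?thesis using M(1) conf
      by (intro exI[of _ "add_mset (i, v) M"]) auto
  qed
qed

lemma finite_bounded_bricks: "finite {v :: nat \<Rightarrow> int. (\<forall>j\<ge>T. v j = 0) \<and> l1 T v \<le> K}"
proof (rule finite_subset)
  show "{v. (\<forall>j\<ge>T. v j = 0) \<and> l1 T v \<le> K} \<subseteq>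
    {v. \<forall>j. (j \<in> {..<T} \<longrightarrow> v j \<in> {- int K..int K}) \<and> (j \<notin> {..<T} \<longrightarrow> v j = 0)}"
  proof
    fix v :: "nat \<Rightarrow> int" assume v: "v \<in> {v. (\<forall>j\<ge>T. v j = 0) \<and> l1 T v \<le> K}"
    have "v j \<in> {- int K..int K}" if "j < T" for j
    proof -
      have "nat \<bar>v j\<bar> \<le> K"
        using v that member_le_sum[of j "{..<T}" "\<lambda>q. nat \<bar>v q\<bar>"] by (simp add: l1_def)
      then show ?thesis by auto
    qed
    then show "v \<in> {v. \<forall>j. (j \<in> {..<T} \<longrightarrow> v j \<in> {- int K..int K}) \<and>
        (j \<notin> {..<T} \<longrightarrow> v j = 0)}" using v by (auto simp: not_less)
  qed
  show "finite {v. \<forall>j. (j \<in> {..<T} \<longrightarrow> v j \<in> {- int K..int K}) \<and> (j \<notin> {..<T} \<longrightarrow> v j = (0::int))}"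
    by (rule finite_set_of_finite_funs) auto
qed

lemma assemble_add: "assemble (M + M') q = assemble M q + assemble M' q"
  by (simp add: assemble_def)

lemma row_sum_mset: "row \<rho> (\<lambda>j. \<Sum>x\<in>#M. f x j) = (\<Sum>x\<in>#M. row \<rho> (f x))"
  by (induction M) (simp_all add: row_add)

lemma sum_sum_mset: "(\<Sum>i\<in>I. \<Sum>x\<in>#M. f x i) = (\<Sum>x\<in>#M. \<Sum>i\<in>I. (f x i :: 'c :: comm_monoid_add))"
  by (induction M) (simp_all add: sum.distrib)

lemma brick_assemble: "brick (assemble M) i = (\<lambda>j. \<Sum>x\<in>#M. brick (place (fst x) (snd x)) i j)"
  by (rule ext) (simp add: brick_def assemble_def case_prod_beta')

text \<open>
  Cutting \<open>h\<close> into small bricks leaves a multiset over a finite set, subject only to the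
  equations of the upper block, whatever \<open>n\<close> is; Dickson's lemma applies once more.
\<close>

theorem small_element:
  "\<exists>K. \<forall>n P h. h \<in> lattice n P \<longrightarrow> h \<noteq> (\<lambda>_. 0) \<longrightarrow>
     (\<exists>h'\<in>lattice n P. h' \<noteq> (\<lambda>_. 0) \<and> conformal h' h \<and> l1 (n * T) h' \<le> K)"
proof -
  obtain K where K: "\<And>P v. v \<in> brick_lattice P \<Longrightarrow> v \<noteq> (\<lambda>_. 0) \<Longrightarrow>
     \<exists>v'\<in>brick_lattice P. v' \<noteq> (\<lambda>_. 0) \<and> conformal v' v \<and> l1 T v' \<le> K"
    using small_brick by blast
  define G where "G = {v :: nat \<Rightarrow> int. (\<forall>j\<ge>T. v j = 0) \<and> l1 T v \<le> K}"
  define X where "X = {N. set_mset N \<subseteq> G \<and> N \<noteq> {#} \<and> (\<forall>\<rho><r. (\<Sum>v\<in>#N. row \<rho> v) = 0)}"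
  have "finite G" unfolding G_def by (rule finite_bounded_bricks)
  then obtain K0 where K0: "\<forall>N\<in>X. \<exists>N'\<in>X. (\<forall>v\<in>G. count N' v \<le> count N v) \<and> size N' \<le> K0"
    using dickson_bound[where cnt = count and sz = size] by blast
  show ?thesis
  proof (intro exI allI impI)
    fix n P h assume h: "h \<in> lattice n P" and h0: "h \<noteq> (\<lambda>_. 0)"
    then obtain M where M: "set_mset M \<subseteq> small_bricks K n P" "assemble M = h"
      "\<forall>(i, v)\<in>#M. conformal (place i v) h"
      using decompose[OF K, of h n P] by (auto simp: lattice_def)
    have upper: "(\<Sum>i<n. row \<rho> (brick (assemble M') i)) = (\<Sum>v\<in>#image_mset snd M'. row \<rho> v)"
      if "set_mset M' \<subseteq> small_bricks K n P" for M' \<rho>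
    proof -
      have "(\<Sum>i<n. row \<rho> (brick (place (fst x) (snd x)) i)) = row \<rho> (snd x)" if "x \<in># M'" for x
      proof -
        have "fst x < n" "\<forall>j\<ge>T. snd x j = 0"
          using that \<open>set_mset M' \<subseteq> _\<close> by (auto simp: small_bricks_def brick_lattice_def)
        then show ?thesis by (simp add: brick_place if_distrib[of "row \<rho>"] sum.delta cong: if_cong)
      qed
      then show ?thesis
        by (simp add: brick_assemble row_sum_mset sum_sum_mset multiset.map_comp o_def
            cong: image_mset_cong)
    qed
    have "image_mset snd M \<in> X"
    proof -
      have "M \<noteq> {#}" using h0 M(2) by (auto simp: assemble_def fun_eq_iff)
      moreover have "(\<Sum>v\<in>#image_mset snd M. row \<rho> v) = 0" if "\<rho> < r" for \<rho>
        using upper[OF M(1)] h that unfolding M(2) by (auto simp: lattice_def)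
      moreover have "snd ` set_mset M \<subseteq> G"
        using M(1) by (auto simp: small_bricks_def G_def brick_lattice_def)
      ultimately show ?thesis by (auto simp: X_def)
    qed
    then obtain N' where N': "N' \<in> X" "size N' \<le> K0"
      "\<forall>v\<in>G. count N' v \<le> count (image_mset snd M) v" using K0 by blast
    have "N' \<subseteq># image_mset snd M" unfolding subseteq_mset_def
    proof
      fix v show "count N' v \<le> count (image_mset snd M) v"

      proof (cases "v \<in> G")
        case False
        then have "v \<notin># N'" using N'(1) by (auto simp: X_def)
        then show ?thesis by (simp add: not_in_iff)
      qed (use N'(3) in blast)
    qed
    \<comment> \<open>The way back: a submultiset of the image is the image of a submultiset
      \<open>M'\<close> of \<open>M\<close>, whose bricks still have their positions and hence the
      right parities.\<close>
    then obtain N'' where "image_mset snd M = N' + N''" by (metis mset_subset_eq_exists_conv)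
    then obtain M' M'' where M': "M = M' + M''" "N' = image_mset snd M'"
      by (metis image_mset_eq_plusD)
    let ?h = "assemble M'"
    have sub: "set_mset M' \<subseteq> small_bricks K n P" using M(1) M'(1) by auto
    have sg: "0 \<le> h q \<longrightarrow> 0 \<le> place i v q" "h q \<le> 0 \<longrightarrow> place i v q \<le> 0" if "(i, v) \<in># M" for i v q
    proof -
      have "conformal (place i v) h" using M(3) that by blast
      then show "0 \<le> h q \<longrightarrow> 0 \<le> place i v q" "h q \<le> 0 \<longrightarrow> place i v q \<le> 0"
        unfolding conformal_def by (auto dest!: spec[of _ q])
    qed
    \<comment> \<open>In each coordinate all pieces have the sign of \<open>h\<close>, so they
      cannot cancel. This yields conformality and, further below, that \<open>?h\<close> is
      nonzero.\<close>
    have signs: "(0 \<le> h q \<longrightarrow> 0 \<le> assemble M1 q) \<and> (h q \<le> 0 \<longrightarrow> assemble M1 q \<le> 0)"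
      if "set_mset M1 \<subseteq> set_mset M" for M1 q
      using that sg unfolding assemble_def by (induction M1) fastforce+
    have hq: "h q = ?h q + assemble M'' q" for q using M(2) M'(1) assemble_add by metis
    have conf: "conformal ?h h" unfolding conformal_def
    proof
      fix q show "0 \<le> ?h q \<and> ?h q \<le> h q \<or> h q \<le> ?h q \<and> ?h q \<le> 0"
        using signs[of M' q] signs[of M'' q] hq[of q] M'(1) by (cases "0 \<le> h q") auto
    qed
    have l1_place: "(\<Sum>q<n * T. \<bar>place i v q\<bar>) = int (l1 T v)" if "i < n" for i v
    proof -
      have "(\<Sum>q<n * T. \<bar>place i v q\<bar>) = (\<Sum>m<n. \<Sum>j<T. \<bar>place i v (m * T + j)\<bar>)"
        by (rule sum_bricks)
      also have "\<dots> = (\<Sum>m<n. if m = i then \<Sum>j<T. \<bar>v j\<bar> else 0)"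
        by (rule sum.cong[OF refl]) (auto simp: place_def)
      finally show ?thesis using that by (simp add: sum.delta l1_def)
    qed
    have "int (l1 (n * T) ?h) = (\<Sum>q<n * T. \<bar>?h q\<bar>)" by (simp add: l1_def)
    also have "\<dots> \<le> (\<Sum>q<n * T. \<Sum>x\<in>#M'. \<bar>place (fst x) (snd x) q\<bar>)"
      unfolding assemble_def case_prod_beta' by (intro sum_mono, induction M') (auto intro: order_trans[OF abs_triangle_ineq])
    also have "\<dots> = (\<Sum>x\<in>#M'. \<Sum>q<n * T. \<bar>place (fst x) (snd x) q\<bar>)"
      by (rule sum_sum_mset)
    also have "\<dots> = (\<Sum>x\<in>#M'. int (l1 T (snd x)))"
      using sub by (intro arg_cong[of _ _ sum_mset] image_mset_cong)
        (auto simp: small_bricks_def intro!: l1_place)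
    also have "\<dots> \<le> (\<Sum>x\<in>#M'. int K)"
      using sub by (intro sum_mset_mono) (auto simp: small_bricks_def)
    also have "\<dots> = int (size M' * K)" by simp
    finally have "l1 (n * T) ?h \<le> size M' * K" by linarith
    \<comment> \<open>At most \<open>K0\<close> bricks, each of norm at most
      \<open>K\<close>.\<close>
    also have "\<dots> \<le> K0 * K" using N'(2) M'(2) by (intro mult_right_mono) auto
    finally have bound: "l1 (n * T) ?h \<le> K0 * K" .
    have "?h \<noteq> (\<lambda>_. 0)"
    proof
      assume z: "?h = (\<lambda>_. 0)"
      obtain x where x: "x \<in># M'" using N'(1) M'(2) by (auto simp: X_def)
      obtain i v where iv: "x = (i, v)" by (cases x)
      have "(i, v) \<in> small_bricks K n P" using x iv sub by auto
      then obtain j where j: "v j \<noteq> 0" and vT: "\<forall>j\<ge>T. v j = 0"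
        by (auto simp: small_bricks_def brick_lattice_def fun_eq_iff)
      then have "j < T" by (meson not_le)
      then have nz: "place i v (i * T + j) \<noteq> 0" using j by (simp add: place_def)
      obtain M3 where M3: "M' = add_mset x M3" using x by (metis insert_DiffM)
      have "?h (i * T + j) = place i v (i * T + j) + assemble M3 (i * T + j)"
        using M3 iv by (simp add: assemble_def)
      moreover have "set_mset M3 \<subseteq> set_mset M" "(i, v) \<in># M" using M3 M'(1) iv by auto
      ultimately show False
        using nz z signs[of M3 "i * T + j"] sg[of i v "i * T + j"] by (cases "0 \<le> h (i * T + j)") auto
    qed
    moreover have "?h \<in> lattice n P"
    proof -
      have "?h q = 0" if "q \<ge> n * T" for q
      proof -
        have "h q = 0" using h that by (auto simp: lattice_def low_lattice_def)
        then show ?thesis using conf[unfolded conformal_def, rule_format, of q] by auto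
      qed
      moreover have "even (?h q)" if "q \<in> P" for q
      proof -
        have "even (place i v q)" if "(i, v) \<in># M'" for i v
        proof (cases "q div T = i")
          case True
          then have "i * T + q mod T \<in> P" using \<open>q \<in> P\<close> by auto
          then show ?thesis using sub that by (auto simp: place_def small_bricks_def brick_lattice_def)
        qed (simp add: place_def)
        then show ?thesis unfolding assemble_def by (induction M') auto
      qed
      moreover have "row \<rho> (brick ?h i) = 0" if "\<rho> \<in> {r..<R}" for i \<rho>
      proof -
        have "row \<rho> (brick (place (fst x) (snd x)) i) = 0" if "x \<in># M'" for x
          using sub that \<open>\<rho> \<in> _\<close> by (auto simp: brick_place small_bricks_def brick_lattice_def)
        then show ?thesis unfolding brick_assemble row_sum_mset by (induction M') auto
      qed
      moreover have "(\<Sum>i<n. row \<rho> (brick ?h i)) = 0" if "\<rho> < r" for \<rho>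
        using upper[OF sub] N'(1) M'(2) that by (simp add: X_def)
      ultimately show ?thesis by (auto simp: lattice_def low_lattice_def)
    qed
    ultimately show "\<exists>h'\<in>lattice n P. h' \<noteq> (\<lambda>_. 0) \<and> conformal h' h \<and> l1 (n * T) h' \<le> K0 * K"
      using conf bound by blast
  qed
qed

section \<open>Optimality with respect to a lattice and its refinement\<close>

definition lattice_optimal ::
  "nat \<Rightarrow> nat set \<Rightarrow> (nat \<Rightarrow> int) \<Rightarrow> (nat \<Rightarrow> int) \<Rightarrow> (nat \<Rightarrow> int \<Rightarrow> int) \<Rightarrow> int \<Rightarrow> (nat \<Rightarrow> int) \<Rightarrow> bool"
where
  "lattice_optimal n P lo up cost lam x \<longleftrightarrow> in_box (n * T) lo up x \<and>
     (\<forall>h\<in>lattice n P. in_box (n * T) lo up (move x lam h) \<longrightarrow>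
        obj (n * T) cost x \<le> obj (n * T) cost (move x lam h))"

lemma in_box_conformal:
  assumes "conformal g h" "in_box N lo up x" "in_box N lo up (move x lam h)"
  shows "in_box N lo up (move x lam g)"
  unfolding in_box_def
proof (intro allI impI)
  fix q assume "q < N"
  then have b: "lo q \<le> x q" "x q \<le> up q" "lo q \<le> x q + lam * h q" "x q + lam * h q \<le> up q"
    using assms(2,3) by (auto simp: in_box_def)
  have "0 \<le> lam * g q \<and> lam * g q \<le> lam * h q \<or> lam * h q \<le> lam * g q \<and> lam * g q \<le> 0"
    using assms(1)[unfolded conformal_def, rule_format, of q]
    by (cases "0 \<le> lam") (auto simp: mult_left_mono mult_left_mono_neg mult_nonneg_nonpos
      mult_nonpos_nonneg mult_nonpos_nonpos)
  then show "lo q \<le> move x lam g q \<and> move x lam g q \<le> up q" using b by auto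
qed

text \<open>Coordinatewise this is \<open>discretely_convex\<close> with the increments
  \<open>lam * g q\<close> and \<open>lam * (h q - g q)\<close>, which agree in sign because
  \<open>g\<close> is conformal to \<open>h\<close>.\<close>

lemma obj_conformal:
  assumes conv: "\<forall>q<N. discretely_convex (lo q) (up q) (cost q)"
    and g: "conformal g h" and box: "in_box N lo up x" "in_box N lo up (move x lam h)"
  shows "obj N cost (move x lam g) + obj N cost (move x lam (\<lambda>q. h q - g q)) \<le>
    obj N cost x + obj N cost (move x lam h)"
  unfolding obj_def sum.distrib[symmetric]
proof (rule sum_mono)
  fix q assume "q \<in> {..<N}"
  then have q: "q < N" by simp
  have e: "x q + lam * h q = x q + lam * g q + lam * (h q - g q)" by (simp add: algebra_simps)
  have "0 \<le> g q * (h q - g q)"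
    using g[unfolded conformal_def, rule_format, of q] by (auto simp: zero_le_mult_iff)
  then have "0 \<le> (lam * lam) * (g q * (h q - g q))" by (simp add: zero_le_mult_iff)
  then have "0 \<le> (lam * g q) * (lam * (h q - g q))" by (simp add: ac_simps)
  moreover have "lo q \<le> x q" "x q \<le> up q" "lo q \<le> x q + lam * h q" "x q + lam * h q \<le> up q"
    using box q by (auto simp: in_box_def)
  ultimately show "cost q (x q + lam * g q) + cost q (x q + lam * (h q - g q)) \<le>
      cost q (x q) + cost q (x q + lam * h q)"
    using conv[rule_format, OF q, unfolded discretely_convex_def, rule_format,
      of "x q" "lam * g q" "lam * (h q - g q)"] unfolding e by simp
qed

lemma lattice_weaken: "(\<forall>q\<in>P - P'. even (h q)) \<Longrightarrow> h \<in> lattice n P' \<Longrightarrow> h \<in> lattice n P"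
  unfolding lattice_def low_lattice_def by blast

text \<open>Split \<open>h\<close> into a small conformal \<open>h'\<close> and the rest. If
  \<open>h' k\<close> is even, then \<open>h'\<close> cannot improve \<open>x\<close>, so by
  \<open>obj_conformal\<close> the rest is no worse than \<open>h\<close>, and induction on the norm
  applies. If the rest is even at \<open>k\<close>, the same argument makes \<open>h'\<close> the
  wanted step. If both are odd, \<open>h k\<close> is even and the zero step does.\<close>

lemma small_improvement:
  assumes K: "\<And>h. h \<in> lattice n P' \<Longrightarrow> h \<noteq> (\<lambda>_. 0) \<Longrightarrow>
      \<exists>h'\<in>lattice n P'. h' \<noteq> (\<lambda>_. 0) \<and> conformal h' h \<and> l1 (n * T) h' \<le> K"
    and conv: "\<forall>q<n * T. discretely_convex (lo q) (up q) (cost q)"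
    and opt: "lattice_optimal n P lo up cost lam x"
    and P: "P - P' \<subseteq> {k}"
    and "h \<in> lattice n P'" "in_box (n * T) lo up (move x lam h)"
  shows "\<exists>g\<in>lattice n P'. l1 (n * T) g \<le> K \<and> in_box (n * T) lo up (move x lam g) \<and>
      obj (n * T) cost (move x lam g) \<le> obj (n * T) cost (move x lam h)"
  using assms(5,6)
proof (induction "l1 (n * T) h" arbitrary: h rule: less_induct)
  case less
  let ?B = "in_box (n * T) lo up" and ?f = "\<lambda>g. obj (n * T) cost (move x lam g)"
  have B: "?B x" using opt by (simp add: lattice_optimal_def)
  have x0: "move x lam (\<lambda>_. 0) = x" by simp
  have mono: "?f (\<lambda>_. 0) \<le> ?f g" if "g \<in> lattice n P'" "even (g k)" "?B (move x lam g)" for g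
  proof -
    have "g \<in> lattice n P" using lattice_weaken[of P P' g n] that P by auto
    then show ?thesis using opt that unfolding lattice_optimal_def x0 by blast
  qed
  have zero: ?case if "?f (\<lambda>_. 0) \<le> ?f h"
    using that B by (intro bexI[of _ "\<lambda>_. 0"]) (auto simp: l1_def lattice_zero)
  show ?case
  proof (cases "h = (\<lambda>_. 0)")
    case True
    then show ?thesis using zero by blast
  next
    case False
    obtain h' where h': "h' \<in> lattice n P'" "h' \<noteq> (\<lambda>_. 0)" "conformal h' h" "l1 (n * T) h' \<le> K"
      using K[OF less.prems(1) False] by blast
    let ?h = "\<lambda>q. h q - h' q"
    have hl: "?h \<in> lattice n P'" using lattice_diff h'(1) less.prems(1) by blast
    have B': "?B (move x lam h')" "?B (move x lam ?h)"
      using in_box_conformal B less.prems(2) h'(3) conformal_minus[OF h'(3)] by blast+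
    have sub: "?f h' + ?f ?h \<le> ?f (\<lambda>_. 0) + ?f h"
      using obj_conformal[OF conv h'(3) B less.prems(2)] by simp
    have "l1 (n * T) h' \<noteq> 0" using h'(1,2) l1_eq_0_iff by (auto simp: lattice_def low_lattice_def)
    then have smaller: "l1 (n * T) ?h < l1 (n * T) h" using l1_diff[OF h'(3), of "n * T"] by simp
    consider "even (h' k)" | "even (?h k)" | "even (h k)" by fastforce
    then show ?thesis
    proof cases
      case 1
      then have "?f ?h \<le> ?f h" using mono[OF h'(1) _ B'(1)] sub by linarith
      then show ?thesis using less.hyps[OF smaller hl B'(2)] by fastforce
    next
      case 2
      then have "?f h' \<le> ?f h" using mono[OF hl _ B'(2)] sub by linarith
      then show ?thesis using h' B'(1) by blast
    next
      case 3
      then show ?thesis using mono[OF less.prems(1) _ less.prems(2)] zero by blast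
    qed
  qed
qed

text \<open>A step along \<open>h\<close> from the new point is a step along \<open>g + h\<close>
  from \<open>x\<close>, and some step of norm at most \<open>K\<close> is no worse than that. The
  chosen \<open>g\<close> competes with all such steps but may itself be longer, which allows the
  search to run over a larger set.\<close>

lemma refine_step:
  assumes K: "\<And>h. h \<in> lattice n P' \<Longrightarrow> h \<noteq> (\<lambda>_. 0) \<Longrightarrow>
      \<exists>h'\<in>lattice n P'. h' \<noteq> (\<lambda>_. 0) \<and> conformal h' h \<and> l1 (n * T) h' \<le> K"
    and conv: "\<forall>q<n * T. discretely_convex (lo q) (up q) (cost q)"
    and opt: "lattice_optimal n P lo up cost lam x"
    and P: "P - P' \<subseteq> {k}"
    and g: "g \<in> lattice n P'" "in_box (n * T) lo up (move x lam g)"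
    and best: "\<And>g'. g' \<in> lattice n P' \<Longrightarrow> l1 (n * T) g' \<le> K \<Longrightarrow>
      in_box (n * T) lo up (move x lam g') \<Longrightarrow>
      obj (n * T) cost (move x lam g) \<le> obj (n * T) cost (move x lam g')"
  shows "lattice_optimal n P' lo up cost lam (move x lam g)"
  unfolding lattice_optimal_def
proof (intro conjI ballI impI)
  fix h assume h: "h \<in> lattice n P'" "in_box (n * T) lo up (move (move x lam g) lam h)"
  have e: "move (move x lam g) lam h = move x lam (\<lambda>q. g q + h q)"
    by (simp add: algebra_simps)
  have "(\<lambda>q. g q + h q) \<in> lattice n P'" using lattice_add g(1) h(1) by blast
  from small_improvement[OF K conv opt P this] h(2)[unfolded e] best
  show "obj (n * T) cost (move x lam g) \<le> obj (n * T) cost (move (move x lam g) lam h)"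
    unfolding e by (meson order.trans)
qed (rule g(2))

text \<open>A kernel vector that is even everywhere is twice a kernel vector, so the two notions
  compare the same points.\<close>

lemma lattice_optimal_halve:
  assumes "lattice_optimal n {} lo up cost (2 * lam) x"
  shows "lattice_optimal n {..<n * T} lo up cost lam x"
proof -
  have "obj (n * T) cost x \<le> obj (n * T) cost (move x lam h)"
    if h: "h \<in> lattice n {..<n * T}" "in_box (n * T) lo up (move x lam h)" for h
  proof -
    define g where "g = (\<lambda>q. h q div 2)"
    have ev: "even (h q)" for q
      using h(1) by (cases "q < n * T") (auto simp: lattice_def low_lattice_def)
    then have hg: "h q = 2 * g q" for q by (simp add: g_def)
    have "row \<rho> (brick h i) = 2 * row \<rho> (brick g i)" for \<rho> i
      unfolding row_def brick_def sum_distrib_left by (rule sum.cong) (auto simp: hg)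
    then have "g \<in> lattice n {}"
      using h(1) by (auto simp: lattice_def low_lattice_def hg sum_distrib_left[symmetric])
    moreover have "move x lam h = move x (2 * lam) g" by (simp add: hg ac_simps)
    ultimately show ?thesis using assms h(2) by (auto simp: lattice_optimal_def)
  qed
  then show ?thesis using assms by (auto simp: lattice_optimal_def)
qed

lemma lattice_optimal_coarse:
  assumes box: "in_box (n * T) lo up x" and lam: "\<And>q. q < n * T \<Longrightarrow> up q - lo q < lam" "0 < lam"
  shows "lattice_optimal n {..<n * T} lo up cost lam x"
proof -
  have "move x lam h = x" if h: "h \<in> lattice n P" "in_box (n * T) lo up (move x lam h)" for h P
  proof
    fix q
    show "move x lam h q = x q"
    proof (cases "q < n * T")
      case True
      then have "lo q \<le> x q" "x q \<le> up q" "lo q \<le> x q + lam * h q" "x q + lam * h q \<le> up q"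
        using h(2) box by (auto simp: in_box_def)
      then have "\<bar>lam * h q\<bar> < lam"
        using lam(1)[OF True] unfolding abs_less_iff by linarith
      then have "lam * \<bar>h q\<bar> < lam * 1" using lam(2) by (simp add: abs_mult)
      then have "\<bar>h q\<bar> < 1" using lam(2) mult_less_cancel_left_pos by blast
      then have "h q = 0" by simp
      then show ?thesis by simp
    qed (use h(1) in \<open>auto simp: lattice_def low_lattice_def\<close>)
  qed
  then show ?thesis using box unfolding lattice_optimal_def
    by (intro conjI ballI impI) (assumption, metis order.refl)
qed

end

section \<open>Loop-free programs and timed Hoare triples\<close>

primrec loop_free :: "com \<Rightarrow> bool" where
  "loop_free Skip = True"
| "loop_free (Assign X e e') = True"
| "loop_free (Seq c c') = (loop_free c \<and> loop_free c')"
| "loop_free (Cond B c c') = (loop_free c \<and> loop_free c')"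
| "loop_free (While B c) = False"

text \<open>Total, so that the effect of straight-line code is found by simplification. The value on
  loops is a placeholder; \<open>exec_den\<close> speaks of loop-free programs.\<close>

primrec den :: "com \<Rightarrow> store \<Rightarrow> store" where
  "den Skip \<sigma> = \<sigma>"
| "den (Assign X e e') \<sigma> = \<sigma>(X := (\<sigma> X)(aval e \<sigma> := aval e' \<sigma>))"
| "den (Seq c c') \<sigma> = den c' (den c \<sigma>)"
| "den (Cond B c c') \<sigma> = (if bval B \<sigma> then den c \<sigma> else den c' \<sigma>)"
| "den (While B c) \<sigma> = \<sigma>"

primrec max_cost :: "com \<Rightarrow> nat" where
  "max_cost Skip = 0"
| "max_cost (Assign X e e') = acost e + acost e'"
| "max_cost (Seq c c') = max_cost c + max_cost c'"
| "max_cost (Cond B c c') = bcost B + max (max_cost c) (max_cost c')"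
| "max_cost (While B c) = 0"

lemma exec_den: "loop_free c \<Longrightarrow> \<exists>\<tau>\<le>max_cost c. exec c \<sigma> \<tau> (den c \<sigma>)"
proof (induction c arbitrary: \<sigma>)
  case (Seq c c')
  then obtain \<tau> \<tau>' where "\<tau> \<le> max_cost c" "exec c \<sigma> \<tau> (den c \<sigma>)"
    "\<tau>' \<le> max_cost c'" "exec c' (den c \<sigma>) \<tau>' (den c' (den c \<sigma>))" by fastforce
  then show ?case by (intro exI[of _ "\<tau> + \<tau>'"]) (auto intro: exec_Seq)
next
  case (Cond B c c')
  then obtain \<tau> \<tau>' where \<tau>: "\<tau> \<le> max_cost c" "exec c \<sigma> \<tau> (den c \<sigma>)"
    "\<tau>' \<le> max_cost c'" "exec c' \<sigma> \<tau>' (den c' \<sigma>)" by fastforce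
  show ?case
  proof (cases "bval B \<sigma>")
    case True
    then have "exec (Cond B c c') \<sigma> (bcost B + \<tau>) (den (Cond B c c') \<sigma>)"
      using \<tau>(2) by (simp add: exec_CondTrue)
    then show ?thesis using \<tau>(1) by (intro exI[of _ "bcost B + \<tau>"]) simp
  next
    case False
    then have "exec (Cond B c c') \<sigma> (bcost B + \<tau>') (den (Cond B c c') \<sigma>)"
      using \<tau>(4) by (simp add: exec_CondFalse)
    then show ?thesis using \<tau>(3) by (intro exI[of _ "bcost B + \<tau>'"]) simp
  qed
qed (auto intro: exec_Skip exec_Assign)

text \<open>Total correctness with a time bound. One terminating run is enough, because execution is
  deterministic.\<close>

definition triple :: "(store \<Rightarrow> bool) \<Rightarrow> com \<Rightarrow> nat \<Rightarrow> (store \<Rightarrow> bool) \<Rightarrow> bool" where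
  "triple P c t Q \<longleftrightarrow> (\<forall>\<sigma>. P \<sigma> \<longrightarrow> (\<exists>\<tau> \<sigma>'. exec c \<sigma> \<tau> \<sigma>' \<and> \<tau> \<le> t \<and> Q \<sigma>'))"

lemma triple_den:
  "loop_free c \<Longrightarrow> (\<And>\<sigma>. P \<sigma> \<Longrightarrow> Q (den c \<sigma>)) \<Longrightarrow> max_cost c \<le> t \<Longrightarrow> triple P c t Q"
  unfolding triple_def using exec_den by (meson order.trans)

lemma triple_conseq:
  "triple P c t Q \<Longrightarrow> (\<And>\<sigma>. P' \<sigma> \<Longrightarrow> P \<sigma>) \<Longrightarrow> (\<And>\<sigma>. Q \<sigma> \<Longrightarrow> Q' \<sigma>) \<Longrightarrow> t \<le> t' \<Longrightarrow> triple P' c t' Q'"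
  unfolding triple_def by (meson order.trans)

lemma triple_Seq: "triple P c t Q \<Longrightarrow> triple Q c' t' R \<Longrightarrow> triple P (Seq c c') (t + t') R"
  unfolding triple_def by (meson exec_Seq add_mono)

lemma triple_CondTrue:
  "triple P c t Q \<Longrightarrow> (\<And>\<sigma>. P \<sigma> \<Longrightarrow> bval B \<sigma>) \<Longrightarrow> triple P (Cond B c c') (bcost B + t) Q"
  unfolding triple_def by (meson exec_CondTrue add_left_mono)

lemma triple_CondFalse:
  "triple P c' t Q \<Longrightarrow> (\<And>\<sigma>. P \<sigma> \<Longrightarrow> \<not> bval B \<sigma>) \<Longrightarrow> triple P (Cond B c c') (bcost B + t) Q"
  unfolding triple_def by (meson exec_CondFalse add_left_mono)

text \<open>The invariant is indexed by the number of passes still to come. The final, failing test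
  is charged like a whole pass, hence \<open>Suc k\<close>.\<close>

lemma triple_While:
  assumes step: "\<And>m. m < k \<Longrightarrow> triple (I (Suc m)) c t (I m)"
    and "\<And>m \<sigma>. m < k \<Longrightarrow> I (Suc m) \<sigma> \<Longrightarrow> bval B \<sigma>" and "\<And>\<sigma>. I 0 \<sigma> \<Longrightarrow> \<not> bval B \<sigma>"
  shows "triple (I k) (While B c) (Suc k * (bcost B + t)) (I 0)"
  using assms
proof (induction k)
  case 0
  then show ?case unfolding triple_def by (fastforce intro: exec_WhileFalse)
next
  case (Suc k)
  show ?case unfolding triple_def
  proof (intro allI impI)
    fix \<sigma> assume I: "I (Suc k) \<sigma>"
    then obtain \<tau> \<sigma>' where 1: "exec c \<sigma> \<tau> \<sigma>'" "\<tau> \<le> t" "I k \<sigma>'"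
      using Suc.prems(1)[of k] unfolding triple_def by blast
    have "triple (I k) (While B c) (Suc k * (bcost B + t)) (I 0)"
      by (rule Suc.IH) (rule Suc.prems(1), simp, erule Suc.prems(2)[rotated], simp, erule Suc.prems(3))
    then obtain \<tau>' \<sigma>'' where 2: "exec (While B c) \<sigma>' \<tau>' \<sigma>''" "\<tau>' \<le> Suc k * (bcost B + t)" "I 0 \<sigma>''"
      using 1(3) unfolding triple_def by blast
    have "exec (While B c) \<sigma> (bcost B + \<tau> + \<tau>') \<sigma>''"
      using exec_WhileTrue[OF _ 1(1) 2(1)] Suc.prems(2)[of k] I by blast
    moreover have "bcost B + \<tau> + \<tau>' \<le> Suc (Suc k) * (bcost B + t)" using 1(2) 2(2) by simp
    ultimately show "\<exists>\<tau> \<sigma>'. exec (While B c) \<sigma> \<tau> \<sigma>' \<and> \<tau> \<le> Suc (Suc k) * (bcost B + t) \<and> I 0 \<sigma>'"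
      using 2(3) by blast
  qed
qed

abbreviation cell :: "string \<Rightarrow> aexp" where "cell X \<equiv> Read X (Const 0)"

abbreviation put :: "string \<Rightarrow> aexp \<Rightarrow> com" where "put X e \<equiv> Assign X (Const 0) e"

definition for_loop :: "string \<Rightarrow> aexp \<Rightarrow> com \<Rightarrow> com" where
  "for_loop v e c = Seq (put v (Const 0))
     (While (Less (cell v) e) (Seq c (put v (Add (cell v) (Const 1)))))"

text \<open>The limit \<open>e\<close> is evaluated anew before each pass, so the invariant has to
  determine its value; \<open>indep\<close> lets the loop overwrite its counter. The 2 pays for the
  comparison and the increment.\<close>

lemma triple_for:
  fixes k :: nat
  assumes step: "\<And>m. m < k \<Longrightarrow>
      triple (\<lambda>\<sigma>. I m \<sigma> \<and> \<sigma> v 0 = int m) c t (\<lambda>\<sigma>. I (Suc m) \<sigma> \<and> \<sigma> v 0 = int m)"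
    and bound: "\<And>m \<sigma>. m \<le> k \<Longrightarrow> I m \<sigma> \<Longrightarrow> aval e \<sigma> = int k"
    and indep: "\<And>m \<sigma> f. I m \<sigma> \<Longrightarrow> I m (\<sigma>(v := f))"
  shows "triple (I 0) (for_loop v e c) (Suc k * (acost e + t + 2)) (I k)"
proof -
  let ?J = "\<lambda>m \<sigma>. m \<le> k \<and> I (k - m) \<sigma> \<and> \<sigma> v 0 = int (k - m)"
  have w: "triple (?J k) (While (Less (cell v) e) (Seq c (put v (Add (cell v) (Const 1)))))
      (Suc k * (bcost (Less (cell v) e) + (t + 1))) (?J 0)"
  proof (rule triple_While)
    fix m assume m: "m < k"
    then have e: "Suc (k - Suc m) = k - m" by simp
    have "triple (\<lambda>\<sigma>. I (k - m) \<sigma> \<and> \<sigma> v 0 = int (k - Suc m)) (put v (Add (cell v) (Const 1))) 1 (?J m)"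
      using m by (intro triple_den) (auto intro: indep)
    moreover have "triple (?J (Suc m)) c t (\<lambda>\<sigma>. I (k - m) \<sigma> \<and> \<sigma> v 0 = int (k - Suc m))"
      by (rule triple_conseq[OF step[of "k - Suc m", unfolded e]]) (use m in auto)
    ultimately show "triple (?J (Suc m)) (Seq c (put v (Add (cell v) (Const 1)))) (t + 1) (?J m)"
      using triple_Seq by blast
  qed (auto dest: bound[rotated])
  have "triple (I 0) (put v (Const 0)) 0 (?J k)"
    by (intro triple_den) (auto intro: indep)
  from triple_Seq[OF this w] show ?thesis
    unfolding for_loop_def by (rule triple_conseq) auto
qed

primrec seqs :: "com list \<Rightarrow> com" where
  "seqs [] = Skip"
| "seqs (c # cs) = Seq c (seqs cs)"

lemma loop_free_seqs: "loop_free (seqs cs) \<longleftrightarrow> (\<forall>c\<in>set cs. loop_free c)"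
  by (induction cs) auto

lemma den_seqs_append: "den (seqs (cs @ cs')) \<sigma> = den (seqs cs') (den (seqs cs) \<sigma>)"
  by (induction cs arbitrary: \<sigma>) auto

lemma den_seqs_inv:
  assumes "\<And>ys x zs \<sigma>. xs = ys @ x # zs \<Longrightarrow> I ys \<sigma> \<Longrightarrow> I (ys @ [x]) (den (f x) \<sigma>)" and "I [] \<sigma>"
  shows "I xs (den (seqs (map f xs)) \<sigma>)"
proof -
  have "\<exists>zs. xs = ys @ zs \<Longrightarrow> I ys (den (seqs (map f ys)) \<sigma>)" for ys
  proof (induction ys rule: rev_induct)
    case (snoc x ys)
    then show ?case using assms(1) by (fastforce simp: den_seqs_append)
  qed (simp add: assms(2))
  then show ?thesis by simp
qed

lemma den_seqs_upt_inv:
  assumes "\<And>j \<sigma>. j < T \<Longrightarrow> I j \<sigma> \<Longrightarrow> I (Suc j) (den (f j) \<sigma>)" and "I 0 \<sigma>"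
  shows "I T (den (seqs (map f [0..<T])) \<sigma>)"
proof -
  have "I (length [0..<T]) (den (seqs (map f [0..<T])) \<sigma>)"
  proof (rule den_seqs_inv[where I = "\<lambda>ys. I (length ys)"])
    fix ys j zs \<sigma> assume e: "[0..<T] = ys @ j # zs" and "I (length ys) \<sigma>"
    have "j = length ys" "length ys < T"
      using arg_cong[OF e, of "\<lambda>xs. xs ! length ys"] arg_cong[OF e, of length]
      by (auto simp del: upt_Suc)
    then show "I (length (ys @ [j])) (den (f j) \<sigma>)" using assms(1) \<open>I (length ys) \<sigma>\<close> by simp
  qed (simp add: assms(2))
  then show ?thesis by simp
qed

text \<open>Only the loop over bricks is a loop at run time. The \<open>T\<close> columns are
  unrolled, so the code \<open>f j\<close> may contain constants that depend on \<open>j\<close>,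
  such as matrix entries.\<close>

definition flat_loop :: "nat \<Rightarrow> (nat \<Rightarrow> com) \<Rightarrow> com" where
  "flat_loop T f = for_loop ''i'' (cell ''n'') (seqs (map f [0..<T]))"

definition flat_cost :: "nat \<Rightarrow> (nat \<Rightarrow> com) \<Rightarrow> nat" where
  "flat_cost T f = max_cost (seqs (map f [0..<T])) + 2"

lemma triple_flat_loop:
  fixes n :: nat
  assumes step: "\<And>i j \<sigma>. i < n \<Longrightarrow> j < T \<Longrightarrow> \<sigma> ''i'' 0 = int i \<Longrightarrow> \<sigma> ''n'' 0 = int n \<Longrightarrow>
      I (i * T + j) \<sigma> \<Longrightarrow> I (Suc (i * T + j)) (den (f j) \<sigma>) \<and>
        den (f j) \<sigma> ''i'' 0 = int i \<and> den (f j) \<sigma> ''n'' 0 = int n"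
    and lf: "\<And>j. j < T \<Longrightarrow> loop_free (f j)"
    and indep: "\<And>q \<sigma> g. I q \<sigma> \<Longrightarrow> I q (\<sigma>(''i'' := g))"
  shows "triple (\<lambda>\<sigma>. I 0 \<sigma> \<and> \<sigma> ''n'' 0 = int n) (flat_loop T f) (Suc n * flat_cost T f)
    (\<lambda>\<sigma>. I (n * T) \<sigma> \<and> \<sigma> ''n'' 0 = int n)"
proof -
  let ?c = "seqs (map f [0..<T])"
  have "triple (\<lambda>\<sigma>. I (0 * T) \<sigma> \<and> \<sigma> ''n'' 0 = int n) (for_loop ''i'' (cell ''n'') ?c)
      (Suc n * (acost (cell ''n'') + max_cost ?c + 2)) (\<lambda>\<sigma>. I (n * T) \<sigma> \<and> \<sigma> ''n'' 0 = int n)"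
  proof (rule triple_for[where I = "\<lambda>i \<sigma>. I (i * T) \<sigma> \<and> \<sigma> ''n'' 0 = int n"])
    fix i assume i: "i < n"
    show "triple (\<lambda>\<sigma>. (I (i * T) \<sigma> \<and> \<sigma> ''n'' 0 = int n) \<and> \<sigma> ''i'' 0 = int i) ?c (max_cost ?c)
      (\<lambda>\<sigma>. (I (Suc i * T) \<sigma> \<and> \<sigma> ''n'' 0 = int n) \<and> \<sigma> ''i'' 0 = int i)"
    proof (rule triple_den)
      fix \<sigma> assume a: "(I (i * T) \<sigma> \<and> \<sigma> ''n'' 0 = int n) \<and> \<sigma> ''i'' 0 = int i"
      have "I (i * T + T) (den ?c \<sigma>) \<and> den ?c \<sigma> ''n'' 0 = int n \<and> den ?c \<sigma> ''i'' 0 = int i"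
        using a i step by (intro den_seqs_upt_inv[where
          I = "\<lambda>j \<sigma>. I (i * T + j) \<sigma> \<and> \<sigma> ''n'' 0 = int n \<and> \<sigma> ''i'' 0 = int i"]) auto
      then show "(I (Suc i * T) (den ?c \<sigma>) \<and> den ?c \<sigma> ''n'' 0 = int n) \<and> den ?c \<sigma> ''i'' 0 = int i"
        by (simp add: add.commute)
    qed (use lf in \<open>auto simp: loop_free_seqs\<close>)
  qed (auto intro: indep)
  then show ?thesis by (simp add: flat_loop_def flat_cost_def)
qed

primrec writes :: "com \<Rightarrow> string set" where
  "writes Skip = {}"
| "writes (Assign X e e') = {X}"
| "writes (Seq c c') = writes c \<union> writes c'"
| "writes (Cond B c c') = writes c \<union> writes c'"
| "writes (While B c) = writes c"

lemma exec_writes: "exec c \<sigma> \<tau> \<sigma>' \<Longrightarrow> X \<notin> writes c \<Longrightarrow> \<sigma>' X = \<sigma> X"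
  by (induction rule: exec.induct) auto

lemma den_writes: "X \<notin> writes c \<Longrightarrow> den c \<sigma> X = \<sigma> X"
  by (induction c arbitrary: \<sigma>) auto

lemma writes_seqs: "writes (seqs cs) = (\<Union>c\<in>set cs. writes c)"
  by (induction cs) auto

lemma triple_frame:
  assumes "triple P c t Q" and "\<And>\<sigma> \<sigma>'. R \<sigma> \<Longrightarrow> (\<And>X. X \<notin> writes c \<Longrightarrow> \<sigma>' X = \<sigma> X) \<Longrightarrow> R \<sigma>'"
  shows "triple (\<lambda>\<sigma>. P \<sigma> \<and> R \<sigma>) c t (\<lambda>\<sigma>. Q \<sigma> \<and> R \<sigma>)"
  unfolding triple_def
proof (intro allI impI)
  fix \<sigma> assume a: "P \<sigma> \<and> R \<sigma>"
  then obtain \<tau> \<sigma>' where 1: "exec c \<sigma> \<tau> \<sigma>'" "\<tau> \<le> t" "Q \<sigma>'"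
    using assms(1) unfolding triple_def by blast
  then have "R \<sigma>'" using assms(2) exec_writes a by blast
  with 1 show "\<exists>\<tau> \<sigma>'. exec c \<sigma> \<tau> \<sigma>' \<and> \<tau> \<le> t \<and> Q \<sigma>' \<and> R \<sigma>'" by blast
qed

section \<open>The refinement step by dynamic programming\<close>

text \<open>A flag replaces an infinite value: if \<open>e = 0\<close>, then \<open>v\<close> and
  \<open>p\<close> are unconstrained, so a table is emptied by clearing its flags only.\<close>

definition is_best :: "(int \<times> int) set \<Rightarrow> int \<Rightarrow> int \<Rightarrow> int \<Rightarrow> bool" where
  "is_best C e v p \<longleftrightarrow> (if e = 0 then C = {} else (v, p) \<in> C \<and> (\<forall>(v', p')\<in>C. v \<le> v'))"

text \<open>Any injective numbering of states serves, as indices occur in the program only as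
  constants, which are free of charge.\<close>

definition idx :: "int list \<Rightarrow> int" where
  "idx st = int (to_nat st)"

lemma idx_eq_iff [simp]: "idx st = idx st' \<longleftrightarrow> st = st'"
  by (simp add: idx_def)

text \<open>
  The state of the dynamic program at coordinate \<open>q\<close> is the vector of partial row sums.  For each
  state the arrays \<open>E\<close>, \<open>V\<close>, \<open>P\<close> hold a reachability flag, the least cost of a path, and such a path
  encoded as an integer in base \<open>2 * K + 1\<close>; \<open>F\<close>, \<open>W\<close>, \<open>Q\<close> are their counterparts for the next
  coordinate.  The current point, its bounds and the step length are in \<open>X\<close>, \<open>L\<close>, \<open>U\<close> and \<open>h\<close>.
\<close>

locale dp_program = nfold_lattice T r R E
  for T r R :: nat and E :: "nat \<Rightarrow> nat \<Rightarrow> int" +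
  fixes K :: nat and Emax :: int and ev :: "nat \<Rightarrow> com"
  assumes loop_free_ev: "loop_free (ev j)"
    and writes_ev: "writes (ev j) \<subseteq> {''v''}"
    and K_bound: "h \<in> lattice n P \<Longrightarrow> h \<noteq> (\<lambda>_. 0) \<Longrightarrow>
      \<exists>h'\<in>lattice n P. h' \<noteq> (\<lambda>_. 0) \<and> conformal h' h \<and> l1 (n * T) h' \<le> K"
    and E_bound: "\<rho> < R \<Longrightarrow> j < T \<Longrightarrow> \<bar>E \<rho> j\<bar> \<le> Emax"
    and Emax_nonneg: "0 \<le> Emax"
    and r_le_R: "r \<le> R"
begin

text \<open>Bounds every partial row sum of a vector of norm at most \<open>K\<close>, independently
  of the number of bricks.\<close>

definition B :: int where
  "B = Emax * int K"

definition states :: "int list list" where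
  "states = List.n_lists R [- B..B]"

lemma states_iff: "st \<in> set states \<longleftrightarrow> length st = R \<and> (\<forall>y\<in>set st. - B \<le> y \<and> y \<le> B)"
  by (auto simp: states_def set_n_lists)

definition tr :: "nat \<Rightarrow> int \<Rightarrow> int list \<Rightarrow> int list" where
  "tr j d st = map (\<lambda>\<rho>. st ! \<rho> + E \<rho> j * d) [0..<R]"

text \<open>Lower row sums have to be back at 0 after the last column of a brick,
  \<open>Suc j = T\<close>. Upper row sums run on through all bricks and are tested once, when the
  answer is read at \<open>zero_state\<close>.\<close>

definition valid :: "nat \<Rightarrow> int list \<Rightarrow> bool" where
  "valid j st \<longleftrightarrow> st \<in> set states \<and> (Suc j = T \<longrightarrow> (\<forall>\<rho>\<in>{r..<R}. st ! \<rho> = 0))"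

definition moves :: "int list" where
  "moves = [- int K..int K]"

definition base :: int where
  "base = 2 * int K + 1"

definition coord :: "nat \<Rightarrow> aexp" where
  "coord j = Add (Mul (cell ''i'') (Const (int T))) (Const (int j))"

lemma aval_coord: "\<sigma> ''i'' 0 = int i \<Longrightarrow> aval (coord j) \<sigma> = int (i * T + j)"
  by (simp add: coord_def)

text \<open>Validity of the target is decided when the program text is built, since
  \<open>j\<close>, \<open>d\<close> and \<open>st\<close> are fixed there. Reachability and the
  comparison of costs remain for run time.\<close>

definition relax :: "nat \<Rightarrow> int \<Rightarrow> int list \<Rightarrow> com" where
  "relax j d st = (let s = Const (idx st); s' = Const (idx (tr j d st));
       val = Add (Read ''V'' s) (cell ''v'') in
     if valid j (tr j d st) then
       Cond (And (Not (Equal (Read ''E'' s) (Const 0)))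
           (Not (And (Not (Equal (Read ''F'' s') (Const 0))) (Not (Less val (Read ''W'' s'))))))
         (Seq (Assign ''F'' s' (Const 1))
           (Seq (Assign ''W'' s' val)
             (Assign ''Q'' s' (Add (Mul (Read ''P'' s) (Const base)) (Const (d + int K))))))
         Skip
     else Skip)"

text \<open>Odd moves are allowed up to and including coordinate \<open>k\<close>: the step is
  sought among vectors even on \<open>{Suc k..<n * T}\<close>. Costs are evaluated only after the
  test of the bounds, since \<open>ev\<close> is trusted only inside the box.\<close>

definition try_move :: "nat \<Rightarrow> int \<Rightarrow> com" where
  "try_move j d = Seq (put ''y'' (Add (Read ''X'' (coord j)) (Mul (cell ''h'') (Const d))))
     (Cond (And (And (Not (Less (cell ''y'') (Read ''L'' (coord j))))
                     (Not (Less (Read ''U'' (coord j)) (cell ''y''))))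
                (if even d then Equal (Const 0) (Const 0) else Not (Less (cell ''k'') (coord j))))
       (Seq (ev j) (seqs (map (relax j d) states)))
       Skip)"

definition copy_state :: "int list \<Rightarrow> com" where
  "copy_state st = (let s = Const (idx st) in
     Seq (Assign ''E'' s (Read ''F'' s)) (Seq (Assign ''V'' s (Read ''W'' s)) (Assign ''P'' s (Read ''Q'' s))))"

definition clear_state :: "string \<Rightarrow> int list \<Rightarrow> com" where
  "clear_state X st = Assign X (Const (idx st)) (Const 0)"

definition layer :: "nat \<Rightarrow> com" where
  "layer j = Seq (seqs (map (clear_state ''F'') states))
     (Seq (seqs (map (try_move j) moves)) (seqs (map copy_state states)))"

definition zero_state :: "int list" where
  "zero_state = replicate R 0"

definition start :: com where
  "start = Seq (seqs (map (clear_state ''E'') states))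
     (Seq (Assign ''E'' (Const (idx zero_state)) (Const 1))
       (Seq (Assign ''V'' (Const (idx zero_state)) (Const 0))
         (Assign ''P'' (Const (idx zero_state)) (Const 0))))"

text \<open>The last move is the least significant digit, so coordinates are treated from
  \<open>n * T - 1\<close> downwards; the remainder is formed from the quotient.\<close>

definition decode :: "nat \<Rightarrow> com" where
  "decode j = (let q = Sub (Sub (Mul (cell ''n'') (Const (int T))) (Const 1)) (coord j) in
     Seq (put ''v'' (Sub (cell ''y'') (Mul (Const base) (Div (cell ''y'') (Const base)))))
       (Seq (Assign ''X'' q (Add (Read ''X'' q) (Mul (cell ''h'') (Sub (cell ''v'') (Const (int K))))))
         (put ''y'' (Div (cell ''y'') (Const base)))))"

definition refine :: com where
  "refine = Seq start (Seq (flat_loop T layer)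
     (Seq (put ''y'' (Read ''P'' (Const (idx zero_state)))) (flat_loop T decode)))"

text \<open>With a path stored as one integer, \<open>relax\<close> extends it by a constant number
  of operations, whatever its length.\<close>

definition enc :: "int list \<Rightarrow> int" where
  "enc ds = foldl (\<lambda>a d. a * base + (d + int K)) 0 ds"

lemma enc_simps [simp]: "enc [] = 0" "enc (ds @ [d]) = enc ds * base + (d + int K)"
  by (simp_all add: enc_def)

lemma loop_free_relax: "loop_free (relax j d st)"
  by (simp add: relax_def Let_def)

lemma loop_free_layer: "loop_free (layer j)"
  by (auto simp: layer_def loop_free_seqs try_move_def loop_free_ev loop_free_relax
      clear_state_def copy_state_def Let_def)

lemma loop_free_start: "loop_free start"
  by (auto simp: start_def loop_free_seqs clear_state_def)

lemma loop_free_decode: "loop_free (decode j)"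
  by (simp add: decode_def Let_def)

lemma writes_relax: "writes (relax j d st) \<subseteq> {''F'', ''W'', ''Q''}"
  by (simp add: relax_def Let_def)

lemma writes_layer: "writes (layer j) \<subseteq> {''E'', ''V'', ''P'', ''F'', ''W'', ''Q'', ''y'', ''v''}"
  by (auto simp: layer_def writes_seqs try_move_def clear_state_def copy_state_def Let_def
      dest!: subsetD[OF writes_relax] subsetD[OF writes_ev])

lemma writes_start: "writes start \<subseteq> {''E'', ''V'', ''P''}"
  by (auto simp: start_def writes_seqs clear_state_def)

lemma writes_decode: "writes (decode j) \<subseteq> {''X'', ''y'', ''v''}"
  by (auto simp: decode_def Let_def)

definition refine_cost :: nat where
  "refine_cost = max_cost start + flat_cost T layer + flat_cost T decode"

lemma writes_refine: "writes refine \<subseteq> {''E'', ''V'', ''P'', ''F'', ''W'', ''Q'', ''y'', ''v'', ''X'', ''i''}"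
  using writes_layer writes_start writes_decode
  by (fastforce simp: refine_def flat_loop_def for_loop_def writes_seqs)

end

text \<open>Here the data of one input are fixed, whereas \<open>dp_program\<close> holds all that
  the program text may depend on. \<open>good\<close> abstracts the arrays that hold the input and
  the bounds; by \<open>good_indep\<close> it survives changes to the work arrays.\<close>

locale dp_instance = dp_program T r R E K Emax ev
  for T r R :: nat and E :: "nat \<Rightarrow> nat \<Rightarrow> int" and K :: nat and Emax :: int and ev :: "nat \<Rightarrow> com" +
  fixes n :: nat and lo up x0 :: "nat \<Rightarrow> int" and cost :: "nat \<Rightarrow> int \<Rightarrow> int"
    and good :: "store \<Rightarrow> bool"
  assumes conv: "q < n * T \<Longrightarrow> discretely_convex (lo q) (up q) (cost q)"
    and ev_correct: "i < n \<Longrightarrow> j < T \<Longrightarrow> \<sigma> ''i'' 0 = int i \<Longrightarrow> good \<sigma> \<Longrightarrow>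
      lo (i * T + j) \<le> \<sigma> ''y'' 0 \<Longrightarrow> \<sigma> ''y'' 0 \<le> up (i * T + j) \<Longrightarrow>
      den (ev j) \<sigma> ''v'' 0 = cost (i * T + j) (\<sigma> ''y'' 0)"
    and good_indep: "good \<sigma> \<Longrightarrow> (\<And>Y. Y \<notin> {''E'', ''V'', ''P'', ''F'', ''W'', ''Q'', ''y'', ''v'', ''X'', ''i'', ''k'', ''h''} \<Longrightarrow>
      \<sigma>' Y = \<sigma> Y) \<Longrightarrow> good \<sigma>'"
    and good_box: "good \<sigma> \<Longrightarrow> q < n * T \<Longrightarrow> \<sigma> ''L'' (int q) = lo q \<and> \<sigma> ''U'' (int q) = up q"
begin

definition admissible :: "(nat \<Rightarrow> int) \<Rightarrow> int \<Rightarrow> nat \<Rightarrow> nat \<Rightarrow> int \<Rightarrow> bool" where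
  "admissible x lam k q d \<longleftrightarrow> d \<in> set moves \<and> lo q \<le> x q + lam * d \<and> x q + lam * d \<le> up q \<and>
     (odd d \<longrightarrow> q \<le> k)"

primrec paths :: "(nat \<Rightarrow> int) \<Rightarrow> int \<Rightarrow> nat \<Rightarrow> nat \<Rightarrow> (int list \<times> int list \<times> int) set" where
  "paths x lam k 0 = {([], zero_state, 0)}"
| "paths x lam k (Suc q) = {(ds @ [d], tr (q mod T) d st, c + cost q (x q + lam * d)) | ds st c d.
     (ds, st, c) \<in> paths x lam k q \<and> admissible x lam k q d \<and> valid (q mod T) (tr (q mod T) d st)}"

definition entries :: "(nat \<Rightarrow> int) \<Rightarrow> int \<Rightarrow> nat \<Rightarrow> nat \<Rightarrow> int list \<Rightarrow> (int \<times> int) set" where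
  "entries x lam k q st = {(c, enc ds) | ds c. (ds, st, c) \<in> paths x lam k q}"

definition table_ok :: "(nat \<Rightarrow> int) \<Rightarrow> int \<Rightarrow> nat \<Rightarrow> nat \<Rightarrow> store \<Rightarrow> bool" where
  "table_ok x lam k q \<sigma> \<longleftrightarrow> (\<forall>st\<in>set states. is_best (entries x lam k q st)
     (\<sigma> ''E'' (idx st)) (\<sigma> ''V'' (idx st)) (\<sigma> ''P'' (idx st)))"

text \<open>\<open>D\<close> collects the pairs of move and state treated so far, and
  \<open>\<sigma>\<close> is the store at the start of the layer. Each reachable state contributes
  only its recorded best path.\<close>

definition cands :: "(nat \<Rightarrow> int) \<Rightarrow> int \<Rightarrow> nat \<Rightarrow> nat \<Rightarrow> store \<Rightarrow> (int \<times> int list) set \<Rightarrow> int list \<Rightarrow>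
    (int \<times> int) set" where
  "cands x lam k q \<sigma> D st' = {(\<sigma> ''V'' (idx st) + cost q (x q + lam * d), \<sigma> ''P'' (idx st) * base + (d + int K)) | d st.
     (d, st) \<in> D \<and> \<sigma> ''E'' (idx st) \<noteq> 0 \<and> admissible x lam k q d \<and> tr (q mod T) d st = st' \<and>
     valid (q mod T) st'}"

lemma cands_insert:
  "cands x lam k q \<sigma> (insert (d, st) D) st' =
    (if \<sigma> ''E'' (idx st) \<noteq> 0 \<and> admissible x lam k q d \<and> tr (q mod T) d st = st' \<and> valid (q mod T) st'
     then {(\<sigma> ''V'' (idx st) + cost q (x q + lam * d), \<sigma> ''P'' (idx st) * base + (d + int K))} else {}) \<union>
    cands x lam k q \<sigma> D st'"
  by (auto simp: cands_def)

definition new_ok ::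
  "(nat \<Rightarrow> int) \<Rightarrow> int \<Rightarrow> nat \<Rightarrow> nat \<Rightarrow> store \<Rightarrow> (int \<times> int list) set \<Rightarrow> store \<Rightarrow> bool"
where
  "new_ok x lam k q \<sigma>0 D \<sigma> \<longleftrightarrow> (\<forall>Y. Y \<notin> {''F'', ''W'', ''Q'', ''y'', ''v''} \<longrightarrow> \<sigma> Y = \<sigma>0 Y) \<and>
     (\<forall>st\<in>set states. is_best (cands x lam k q \<sigma>0 D st)
       (\<sigma> ''F'' (idx st)) (\<sigma> ''W'' (idx st)) (\<sigma> ''Q'' (idx st)))"

lemma den_relax:
  assumes N: "new_ok x lam k q \<sigma>0 D \<sigma>" and v: "\<sigma> ''v'' 0 = cost q (x q + lam * d)"
    and a: "admissible x lam k q d" and j: "j = q mod T"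
  shows "new_ok x lam k q \<sigma>0 (insert (d, st) D) (den (relax j d st) \<sigma>) \<and>
    den (relax j d st) \<sigma> ''v'' 0 = cost q (x q + lam * d)"
proof
  show "den (relax j d st) \<sigma> ''v'' 0 = cost q (x q + lam * d)"
    using v writes_relax[of j d st] den_writes[of "''v''" "relax j d st" \<sigma>] by fastforce
  have old: "\<sigma> ''V'' = \<sigma>0 ''V''" "\<sigma> ''E'' = \<sigma>0 ''E''" "\<sigma> ''P'' = \<sigma>0 ''P''"
    using N by (auto simp: new_ok_def)
  have "is_best (cands x lam k q \<sigma>0 (insert (d, st) D) st') (den (relax j d st) \<sigma> ''F'' (idx st'))
      (den (relax j d st) \<sigma> ''W'' (idx st')) (den (relax j d st) \<sigma> ''Q'' (idx st'))"
    if "st' \<in> set states" for st'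
  proof -
    note b = N[unfolded new_ok_def, THEN conjunct2, rule_format, OF that]
    show ?thesis
    proof (cases "valid j (tr j d st) \<and> \<sigma>0 ''E'' (idx st) \<noteq> 0 \<and> tr j d st = st'")
      case True
      then have c: "cands x lam k q \<sigma>0 (insert (d, st) D) st' =
        insert (\<sigma> ''V'' (idx st) + \<sigma> ''v'' 0, \<sigma> ''P'' (idx st) * base + (d + int K)) (cands x lam k q \<sigma>0 D st')"
        using a v j by (auto simp: cands_insert old)
      show ?thesis unfolding c using True b
        by (auto simp: relax_def Let_def is_best_def old split: if_splits)
    next
      case False
      then have c: "cands x lam k q \<sigma>0 (insert (d, st) D) st' = cands x lam k q \<sigma>0 D st'"
        using j by (auto simp: cands_insert)
      show ?thesis unfolding c using False b
        by (auto simp: relax_def Let_def old)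
    qed
  qed
  moreover have "den (relax j d st) \<sigma> Y = \<sigma>0 Y" if "Y \<notin> {''F'', ''W'', ''Q'', ''y'', ''v''}" for Y
    using N that writes_relax[of j d st] by (subst den_writes) (auto simp: new_ok_def)
  ultimately show "new_ok x lam k q \<sigma>0 (insert (d, st) D) (den (relax j d st) \<sigma>)"
    by (simp add: new_ok_def)
qed

lemma den_try_move:
  assumes N: "new_ok x lam k q \<sigma>0 D \<sigma>" and q: "q = i * T + j" "i < n" "j < T" and d: "d \<in> set moves"
    and \<sigma>0: "\<sigma>0 ''i'' 0 = int i" "good \<sigma>0" "\<sigma>0 ''h'' 0 = lam" "\<sigma>0 ''k'' 0 = int k" "\<sigma>0 ''X'' (int q) = x q"
  shows "new_ok x lam k q \<sigma>0 (D \<union> {d} \<times> set states) (den (try_move j d) \<sigma>)"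
proof -
  have qN: "q < n * T" using brick_index[OF q(2,3)] q(1) by simp
  have c: "aval (coord j) s = int q" if "s ''i'' 0 = int i" for s
    using that by (simp add: coord_def q(1))
  have \<sigma>: "\<sigma> ''i'' 0 = int i" "\<sigma> ''h'' 0 = lam" "\<sigma> ''k'' 0 = int k" "\<sigma> ''X'' (int q) = x q"
    using N \<sigma>0 by (auto simp: new_ok_def)
  have "good \<sigma>" using N \<sigma>0(2) by (elim good_indep) (auto simp: new_ok_def)
  then have LU: "\<sigma> ''L'' (int q) = lo q" "\<sigma> ''U'' (int q) = up q" using good_box qN by auto
  define \<sigma>1 where "\<sigma>1 = \<sigma>(''y'' := (\<sigma> ''y'')(0 := x q + lam * d))"
  have \<sigma>1: "den (put ''y'' (Add (Read ''X'' (coord j)) (Mul (cell ''h'') (Const d)))) \<sigma> = \<sigma>1"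
    using c \<sigma> by (simp add: \<sigma>1_def)
  have N1: "new_ok x lam k q \<sigma>0 D \<sigma>1" using N by (auto simp: new_ok_def \<sigma>1_def)
  have i1: "good \<sigma>1" using \<open>good \<sigma>\<close> by (elim good_indep) (auto simp: \<sigma>1_def)
  have test: "bval (And (And (Not (Less (cell ''y'') (Read ''L'' (coord j))))
                     (Not (Less (Read ''U'' (coord j)) (cell ''y''))))
      (if even d then Equal (Const 0) (Const 0) else Not (Less (cell ''k'') (coord j)))) \<sigma>1
      \<longleftrightarrow> admissible x lam k q d"
    using c[of \<sigma>1] \<sigma> LU d by (auto simp: \<sigma>1_def admissible_def)
  show ?thesis
  proof (cases "admissible x lam k q d")
    case True
    let ?\<sigma> = "den (ev j) \<sigma>1"
    have "?\<sigma> ''v'' 0 = cost q (\<sigma>1 ''y'' 0)"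
      using ev_correct[OF q(2,3), of \<sigma>1, folded q(1)] True i1 \<sigma>
      by (simp add: \<sigma>1_def admissible_def)
    then have v: "?\<sigma> ''v'' 0 = cost q (x q + lam * d)" by (simp add: \<sigma>1_def)
    have "?\<sigma> Y = \<sigma>1 Y" if "Y \<noteq> ''v''" for Y
      using den_writes[of Y "ev j"] writes_ev[of j] that by blast
    then have "new_ok x lam k q \<sigma>0 D ?\<sigma>" using N1 by (auto simp: new_ok_def)
    then have "new_ok x lam k q \<sigma>0 (D \<union> {d} \<times> set states) (den (seqs (map (relax j d) states)) ?\<sigma>) \<and>
      den (seqs (map (relax j d) states)) ?\<sigma> ''v'' 0 = cost q (x q + lam * d)"
    proof (intro den_seqs_inv[where f = "relax j d" and
        I = "\<lambda>ys \<sigma>. new_ok x lam k q \<sigma>0 (D \<union> {d} \<times> set ys) \<sigma> \<and> \<sigma> ''v'' 0 = cost q (x q + lam * d)"])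
      fix ys st zs \<sigma>' assume a: "new_ok x lam k q \<sigma>0 (D \<union> {d} \<times> set ys) \<sigma>' \<and> \<sigma>' ''v'' 0 = cost q (x q + lam * d)"
      have e: "D \<union> {d} \<times> set (ys @ [st]) = insert (d, st) (D \<union> {d} \<times> set ys)" by auto
      have "j = q mod T" using q by simp
      then show "new_ok x lam k q \<sigma>0 (D \<union> {d} \<times> set (ys @ [st])) (den (relax j d st) \<sigma>') \<and>
        den (relax j d st) \<sigma>' ''v'' 0 = cost q (x q + lam * d)"
        unfolding e using den_relax[OF conjunct1[OF a] conjunct2[OF a] True] by blast
    qed (use v \<open>new_ok x lam k q \<sigma>0 D ?\<sigma>\<close> in auto)
    moreover have "den (try_move j d) \<sigma> = den (seqs (map (relax j d) states)) ?\<sigma>"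
      unfolding try_move_def den.simps(3) \<sigma>1 den.simps(4) test using True by simp
    ultimately show ?thesis by simp
  next
    case False
    then have "den (try_move j d) \<sigma> = \<sigma>1"
      unfolding try_move_def den.simps(3) \<sigma>1 den.simps(4) test by simp
    moreover have "cands x lam k q \<sigma>0 (D \<union> {d} \<times> set states) = cands x lam k q \<sigma>0 D"
      using False by (auto simp: cands_def fun_eq_iff)
    ultimately show ?thesis using N1 by (simp add: new_ok_def)
  qed
qed

lemma den_clear: "den (seqs (map (clear_state X) sts)) \<sigma> =
    \<sigma>(X := (\<lambda>a. if a \<in> idx ` set sts then 0 else \<sigma> X a))"
  by (induction sts rule: rev_induct) (auto simp: den_seqs_append clear_state_def fun_eq_iff)

lemma den_copy: "den (seqs (map copy_state sts)) \<sigma> =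
    \<sigma>(''E'' := (\<lambda>a. if a \<in> idx ` set sts then \<sigma> ''F'' a else \<sigma> ''E'' a),
      ''V'' := (\<lambda>a. if a \<in> idx ` set sts then \<sigma> ''W'' a else \<sigma> ''V'' a),
      ''P'' := (\<lambda>a. if a \<in> idx ` set sts then \<sigma> ''Q'' a else \<sigma> ''P'' a))"
  by (induction sts rule: rev_induct) (auto simp: den_seqs_append copy_state_def Let_def fun_eq_iff)

text \<open>Bellman's principle: cost and validity of an extension depend on a path only through its
  state. So every candidate is a genuine path, and every path is matched or beaten by an extension
  of the best path to its penultimate state.\<close>

lemma entries_Suc:
  assumes tab: "table_ok x lam k q \<sigma>"
    and sub: "\<And>ds st c. (ds, st, c) \<in> paths x lam k q \<Longrightarrow> st \<in> set states"
    and best: "is_best (cands x lam k q \<sigma> (set moves \<times> set states) st') e v p"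
  shows "is_best (entries x lam k (Suc q) st') e v p"
proof -
  let ?C = "cands x lam k q \<sigma> (set moves \<times> set states) st'"
  have tab': "is_best (entries x lam k q st) (\<sigma> ''E'' (idx st)) (\<sigma> ''V'' (idx st)) (\<sigma> ''P'' (idx st))"
    if "st \<in> set states" for st using tab that by (auto simp: table_ok_def)
  have 1: "?C \<subseteq> entries x lam k (Suc q) st'"
  proof safe
    fix a b assume "(a, b) \<in> ?C"
    then obtain d st where d: "st \<in> set states" "\<sigma> ''E'' (idx st) \<noteq> 0" "admissible x lam k q d"
      "tr (q mod T) d st = st'" "valid (q mod T) st'"
      "a = \<sigma> ''V'' (idx st) + cost q (x q + lam * d)" "b = \<sigma> ''P'' (idx st) * base + (d + int K)"
      by (auto simp: cands_def)
    then have "(\<sigma> ''V'' (idx st), \<sigma> ''P'' (idx st)) \<in> entries x lam k q st"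
      using tab'[OF d(1)] by (auto simp: is_best_def)
    then obtain ds where "(ds, st, \<sigma> ''V'' (idx st)) \<in> paths x lam k q" "\<sigma> ''P'' (idx st) = enc ds"
      by (auto simp: entries_def)
    then have "(ds @ [d], st', a) \<in> paths x lam k (Suc q)" "b = enc (ds @ [d])" using d by auto
    then show "(a, b) \<in> entries x lam k (Suc q) st'" unfolding entries_def by blast
  qed
  have 2: "\<exists>(a', b')\<in>?C. a' \<le> a" if "(a, b) \<in> entries x lam k (Suc q) st'" for a b
  proof -
    from that obtain ds st c d where d: "(ds, st, c) \<in> paths x lam k q" "admissible x lam k q d"
      "valid (q mod T) (tr (q mod T) d st)" "st' = tr (q mod T) d st" "a = c + cost q (x q + lam * d)"
      by (auto simp: entries_def)
    have st: "st \<in> set states" using sub d(1) by blast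
    have "(c, enc ds) \<in> entries x lam k q st" using d(1) by (auto simp: entries_def)
    then have e: "\<sigma> ''E'' (idx st) \<noteq> 0" "\<sigma> ''V'' (idx st) \<le> c"
      using tab'[OF st] by (auto simp: is_best_def split: if_splits)
    have dm: "d \<in> set moves" using d(2) by (simp add: admissible_def)
    have "(\<sigma> ''V'' (idx st) + cost q (x q + lam * d), \<sigma> ''P'' (idx st) * base + (d + int K)) \<in> ?C"
      unfolding cands_def using d st e dm by blast
    then show ?thesis using e(2) d(5) by (intro bexI) auto
  qed
  show ?thesis
  proof (cases "e = 0")
    case True
    then have "?C = {}" using best by (simp add: is_best_def)
    then have "entries x lam k (Suc q) st' = {}" using 2 by fast
    then show ?thesis using True by (simp add: is_best_def)
  next
    case False
    then have "(v, p) \<in> ?C" "\<forall>(a, b)\<in>?C. v \<le> a" using best by (auto simp: is_best_def)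
    moreover have "v \<le> a" if "(a, b) \<in> entries x lam k (Suc q) st'" for a b
      using 2[OF that] calculation(2) by fastforce
    ultimately show ?thesis using False 1 unfolding is_best_def by auto
  qed
qed

lemma zero_state_mem: "zero_state \<in> set states"
  using Emax_nonneg by (auto simp: states_iff zero_state_def B_def)

lemma paths_states: "(ds, st, c) \<in> paths x lam k q \<Longrightarrow> st \<in> set states"
  by (cases q) (auto simp: zero_state_mem valid_def)

lemma den_layer:
  assumes tab: "table_ok x lam k q \<sigma>" and q: "q = i * T + j" "i < n" "j < T"
    and \<sigma>: "\<sigma> ''i'' 0 = int i" "good \<sigma>" "\<sigma> ''h'' 0 = lam" "\<sigma> ''k'' 0 = int k" "\<sigma> ''X'' (int q) = x q"
  shows "table_ok x lam k (Suc q) (den (layer j) \<sigma>)"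
proof -
  let ?\<sigma>1 = "den (seqs (map (clear_state ''F'') states)) \<sigma>"
  let ?\<sigma>2 = "den (seqs (map (try_move j) moves)) ?\<sigma>1"
  have "new_ok x lam k q \<sigma> (set moves \<times> set states) ?\<sigma>2"
  proof (intro den_seqs_inv[where I = "\<lambda>ys. new_ok x lam k q \<sigma> (set ys \<times> set states)"])
    fix ys d zs \<sigma>' assume m: "moves = ys @ d # zs" and N: "new_ok x lam k q \<sigma> (set ys \<times> set states) \<sigma>'"
    have "d \<in> set moves" by (simp add: m)
    moreover have "set (ys @ [d]) \<times> set states = (set ys \<times> set states) \<union> {d} \<times> set states" by auto
    ultimately show "new_ok x lam k q \<sigma> (set (ys @ [d]) \<times> set states) (den (try_move j d) \<sigma>')"
      using den_try_move[OF N q] \<sigma> by simp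
  qed (auto simp: new_ok_def den_clear cands_def is_best_def)
  then have "is_best (entries x lam k (Suc q) st) (?\<sigma>2 ''F'' (idx st)) (?\<sigma>2 ''W'' (idx st)) (?\<sigma>2 ''Q'' (idx st))"
    if "st \<in> set states" for st
    using that by (intro entries_Suc[OF tab]) (auto simp: new_ok_def paths_states)
  then show ?thesis by (auto simp: table_ok_def layer_def den_copy)
qed

section \<open>Paths of the dynamic program and lattice vectors\<close>

definition partial :: "nat \<Rightarrow> (nat \<Rightarrow> int) \<Rightarrow> nat \<Rightarrow> int" where
  "partial q h \<rho> = (\<Sum>q'<q. E \<rho> (q' mod T) * h q')"

lemma partial_Suc: "partial (Suc q) h \<rho> = partial q h \<rho> + E \<rho> (q mod T) * h q"
  by (simp add: partial_def)

lemma partial_row: "partial (m * T) h \<rho> = (\<Sum>i<m. row \<rho> (brick h i))"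
  unfolding partial_def sum_bricks row_def by (intro sum.cong refl) (simp add: brick_def)

lemma row_brick_partial: "row \<rho> (brick h i) = partial (Suc i * T) h \<rho> - partial (i * T) h \<rho>"
  unfolding partial_row by simp

text \<open>The row sum over one brick is the difference of the running sums at its two ends. Lower
  equations thus say that running sums vanish at all brick ends, upper ones that they vanish at the
  last.\<close>

lemma in_lattice_iff:
  assumes "\<forall>q\<ge>n * T. h q = 0"
  shows "h \<in> lattice n P \<longleftrightarrow> (\<forall>q\<in>P. even (h q)) \<and> (\<forall>i\<le>n. \<forall>\<rho>\<in>{r..<R}. partial (i * T) h \<rho> = 0) \<and>
    (\<forall>\<rho><r. partial (n * T) h \<rho> = 0)"
proof -
  have "(\<forall>i\<le>n. partial (i * T) h \<rho> = 0) \<longleftrightarrow> (\<forall>i<n. row \<rho> (brick h i) = 0)" for \<rho>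
  proof
    assume "\<forall>i\<le>n. partial (i * T) h \<rho> = 0"
    then show "\<forall>i<n. row \<rho> (brick h i) = 0"
      by (auto simp del: mult_Suc simp: row_brick_partial dest: spec[of _ "Suc _"])
  qed (simp add: partial_row)
  then have "(\<forall>i\<le>n. \<forall>\<rho>\<in>{r..<R}. partial (i * T) h \<rho> = 0) \<longleftrightarrow> (\<forall>i<n. \<forall>\<rho>\<in>{r..<R}. row \<rho> (brick h i) = 0)"
    by blast
  then show ?thesis using assms by (simp add: lattice_def low_lattice_def partial_row[symmetric])
qed

definition tuple :: "(nat \<Rightarrow> int) \<Rightarrow> int \<Rightarrow> (nat \<Rightarrow> int) \<Rightarrow> nat \<Rightarrow> int list \<times> int list \<times> int" where
  "tuple x lam h q = (map h [0..<q], map (partial q h) [0..<R], (\<Sum>q'<q. cost q' (x q' + lam * h q')))"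

lemma tr_partial: "tr (q mod T) (h q) (map (partial q h) [0..<R]) = map (partial (Suc q) h) [0..<R]"
  by (auto simp: tr_def partial_Suc)

lemma tuple_in_paths:
  assumes "\<forall>q'<q. admissible x lam k q' (h q') \<and> valid (q' mod T) (map (partial (Suc q') h) [0..<R])"
  shows "tuple x lam h q \<in> paths x lam k q"
  using assms
proof (induction q)
  case 0
  show ?case by (simp add: tuple_def zero_state_def partial_def[abs_def] map_replicate_const)
next
  case (Suc q)
  then have "tuple x lam h q \<in> paths x lam k q" by simp
  then show ?case using Suc.prems[rule_format, of q] tr_partial[of q h] unfolding tuple_def
    by (auto intro!: exI)
qed

lemma in_paths_tuple:
  assumes "(ds, st, c) \<in> paths x lam k q"
  shows "\<exists>h. (ds, st, c) = tuple x lam h q \<and> (\<forall>q'\<ge>q. h q' = 0) \<and>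
    (\<forall>q'<q. admissible x lam k q' (h q') \<and> valid (q' mod T) (map (partial (Suc q') h) [0..<R]))"
  using assms
proof (induction q arbitrary: ds st c)
  case 0
  then show ?case
    by (intro exI[of _ "\<lambda>_. 0"]) (simp add: tuple_def zero_state_def partial_def[abs_def] map_replicate_const)
next
  case (Suc q)
  then obtain ds0 st0 c0 d where p: "(ds0, st0, c0) \<in> paths x lam k q" "admissible x lam k q d"
    "valid (q mod T) (tr (q mod T) d st0)" "ds = ds0 @ [d]" "st = tr (q mod T) d st0"
    "c = c0 + cost q (x q + lam * d)" by auto
  then obtain h where h: "(ds0, st0, c0) = tuple x lam h q"
    "\<forall>q'<q. admissible x lam k q' (h q') \<and> valid (q' mod T) (map (partial (Suc q') h) [0..<R])"
    "\<forall>q'\<ge>q. h q' = 0"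
    using Suc.IH by blast
  let ?h = "h(q := d)"
  have pe: "partial q' ?h \<rho> = partial q' h \<rho>" if "q' \<le> q" for q' \<rho>
    unfolding partial_def using that by (intro sum.cong) auto
  have st0: "st0 = map (partial q ?h) [0..<R]" using h(1) by (simp add: tuple_def pe)
  have st: "st = map (partial (Suc q) ?h) [0..<R]"
    using tr_partial[of q ?h] unfolding p(5) st0 by simp
  then have "(ds, st, c) = tuple x lam ?h (Suc q)"
    using h(1) p(4,6) by (simp add: tuple_def)
  moreover have "\<forall>q'<Suc q. admissible x lam k q' (?h q') \<and> valid (q' mod T) (map (partial (Suc q') ?h) [0..<R])"
    using h(2) p(2,3,5) st by (auto simp: less_Suc_eq pe cong: map_cong)
  moreover have "\<forall>q'\<ge>Suc q. ?h q' = 0" using h(3) by auto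
  ultimately show ?case by blast
qed

lemma Suc_mod_eq_T: "Suc (q mod T) = T \<longleftrightarrow> Suc q mod T = 0"
  by (simp add: mod_Suc)

text \<open>Soundness of the search. Such a path may have norm above \<open>K\<close>;
  \<open>refine_step\<close> asks only for a lattice step inside the box.\<close>

lemma path_lattice:
  assumes "(ds, zero_state, c) \<in> paths x lam k (n * T)"
  shows "\<exists>h\<in>lattice n {Suc k..<n * T}. ds = map h [0..<n * T] \<and> in_box (n * T) lo up (move x lam h) \<and>
    c = obj (n * T) cost (move x lam h)"
proof -
  obtain h where h: "(ds, zero_state, c) = tuple x lam h (n * T)" "\<forall>q'\<ge>n * T. h q' = 0"
    "\<forall>q'<n * T. admissible x lam k q' (h q') \<and> valid (q' mod T) (map (partial (Suc q') h) [0..<R])"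
    using in_paths_tuple[OF assms] by blast
  have low: "partial (i * T) h \<rho> = 0" if i: "i \<le> n" and \<rho>: "\<rho> \<in> {r..<R}" for i \<rho>
  proof (cases i)
    case (Suc i')
    \<comment> \<open>\<open>q\<close> is the last coordinate of brick \<open>i'\<close>, the place
      where \<open>valid\<close> demands that the lower sums be zero.\<close>
    obtain q where q: "Suc q = i * T" using T_pos Suc by (metis add_gr_0 gr0_conv_Suc mult_Suc)
    then have "Suc q mod T = 0" by simp
    then have "Suc (q mod T) = T" by (simp only: Suc_mod_eq_T)
    moreover have "i * T \<le> n * T" using i by simp
    then have "q < n * T" using q by linarith
    ultimately have "\<forall>\<rho>\<in>{r..<R}. map (partial (Suc q) h) [0..<R] ! \<rho> = 0"
      using h(3) by (auto simp: valid_def simp del: upt_Suc)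
    then show ?thesis using \<rho> q by (auto dest!: bspec[OF _ \<rho>])
  qed (simp add: partial_def)
  have st: "map (partial (n * T) h) [0..<R] = zero_state" using h(1) by (simp add: tuple_def)
  have up0: "partial (n * T) h \<rho> = 0" if "\<rho> < R" for \<rho>
    using arg_cong[OF st, of "\<lambda>xs. xs ! \<rho>"] that by (simp add: zero_state_def)
  have "h \<in> lattice n {Suc k..<n * T}"
    unfolding in_lattice_iff[OF h(2)] using low up0 r_le_R h(3) by (force simp: admissible_def)
  moreover have "in_box (n * T) lo up (move x lam h)"
    using h(3) by (auto simp: in_box_def admissible_def)
  ultimately show ?thesis using h(1) by (auto simp: tuple_def obj_def)
qed

text \<open>Completeness for short vectors: the entries of a prefix have total absolute value at
  most \<open>K\<close>, so a running sum never leaves the range of \<open>states\<close>, however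
  many bricks there are.\<close>

lemma lattice_path:
  assumes h: "h \<in> lattice n {Suc k..<n * T}" and l1: "l1 (n * T) h \<le> K"
    and box: "in_box (n * T) lo up (move x lam h)"
  shows "(map h [0..<n * T], zero_state, obj (n * T) cost (move x lam h)) \<in> paths x lam k (n * T)"
proof -
  have supp: "\<forall>q\<ge>n * T. h q = 0" using h by (simp add: lattice_def low_lattice_def)
  note hl = h[unfolded in_lattice_iff[OF supp]]
  have habs: "(\<Sum>q'<q. \<bar>h q'\<bar>) \<le> int K" if "q \<le> n * T" for q
  proof -
    have "(\<Sum>q'<q. \<bar>h q'\<bar>) \<le> (\<Sum>q'<n * T. \<bar>h q'\<bar>)"
      using that by (intro sum_mono2) auto
    also have "\<dots> = int (l1 (n * T) h)" by (simp add: l1_def)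
    finally show ?thesis using l1 by linarith
  qed
  have hq: "\<bar>h q\<bar> \<le> int K" if "q < n * T" for q
  proof -
    have "\<bar>h q\<bar> \<le> (\<Sum>q'<n * T. \<bar>h q'\<bar>)" using that by (intro member_le_sum) auto
    then show ?thesis using habs[of "n * T"] by linarith
  qed
  have bound: "\<bar>partial q h \<rho>\<bar> \<le> B" if "q \<le> n * T" "\<rho> < R" for q \<rho>
  proof -
    have "\<bar>partial q h \<rho>\<bar> \<le> (\<Sum>q'<q. \<bar>E \<rho> (q' mod T) * h q'\<bar>)"
      unfolding partial_def by (rule sum_abs)
    also have "\<dots> \<le> (\<Sum>q'<q. Emax * \<bar>h q'\<bar>)"
      unfolding abs_mult using E_bound[OF that(2)] T_pos by (intro sum_mono mult_right_mono) auto
    also have "\<dots> = Emax * (\<Sum>q'<q. \<bar>h q'\<bar>)" by (simp add: sum_distrib_left)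
    also have "\<dots> \<le> B" unfolding B_def using habs[OF that(1)] Emax_nonneg by (rule mult_left_mono)
    finally show ?thesis .
  qed
  have "admissible x lam k q (h q) \<and> valid (q mod T) (map (partial (Suc q) h) [0..<R])"
    if q: "q < n * T" for q
  proof
    have "odd (h q) \<longrightarrow> q \<le> k" using hl q by (metis atLeastLessThan_iff not_less_eq_eq)
    then show "admissible x lam k q (h q)"
      using hq[OF q] box q by (auto simp: admissible_def moves_def in_box_def)
    have "partial (Suc q) h \<rho> = 0" if T: "Suc (q mod T) = T" and \<rho>: "\<rho> \<in> {r..<R}" for \<rho>
    proof -
      have "Suc q mod T = 0" using T by (simp only: Suc_mod_eq_T)
      then obtain i where i: "Suc q = i * T" by (metis mod_0_imp_dvd dvd_def mult.commute)
      then have "i * T \<le> n * T" using q by linarith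
      then have "i \<le> n" using T_pos mult_le_cancel2 by blast
      then show ?thesis using hl \<rho> i by simp
    qed
    then show "valid (q mod T) (map (partial (Suc q) h) [0..<R])"
      using bound[of "Suc q"] q by (auto simp: valid_def states_iff abs_le_iff minus_le_iff)
  qed
  then have "tuple x lam h (n * T) \<in> paths x lam k (n * T)" by (intro tuple_in_paths) auto
  moreover have "map (partial (n * T) h) [0..<R] = zero_state"
  proof -
    have "partial (n * T) h \<rho> = 0" if "\<rho> < R" for \<rho>
      using hl that by (cases "\<rho> < r") auto
    then show ?thesis by (auto simp: zero_state_def list_eq_iff_nth_eq)
  qed
  ultimately show ?thesis by (simp add: tuple_def obj_def)
qed

lemma den_start: "table_ok x lam k 0 (den start \<sigma>)"
  unfolding table_ok_def start_def den.simps den_clear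
  by (auto simp: is_best_def entries_def zero_state_mem)

section \<open>Decoding the best path and moving along it\<close>

lemma enc_take:
  assumes "m < length ds" "ds ! m \<in> set moves"
  shows "enc (take (Suc m) ds) div base = enc (take m ds)"
    and "enc (take (Suc m) ds) - base * (enc (take (Suc m) ds) div base) - int K = ds ! m"
proof -
  have e: "enc (take (Suc m) ds) = enc (take m ds) * base + (ds ! m + int K)"
    using assms(1) by (simp add: take_Suc_conv_app_nth)
  have "0 \<le> ds ! m + int K" "ds ! m + int K < base"
    using assms(2) by (auto simp: moves_def base_def)
  then show 1: "enc (take (Suc m) ds) div base = enc (take m ds)" unfolding e by simp
  show "enc (take (Suc m) ds) - base * (enc (take (Suc m) ds) div base) - int K = ds ! m"
    unfolding 1 unfolding e by simp
qed

text \<open>After \<open>qq\<close> rounds the last \<open>qq\<close> coordinates are updated, and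
  \<open>y\<close> encodes the moves of the others.\<close>

definition decoded :: "(nat \<Rightarrow> int) \<Rightarrow> int \<Rightarrow> int list \<Rightarrow> nat \<Rightarrow> store \<Rightarrow> bool" where
  "decoded x lam ds qq \<sigma> \<longleftrightarrow> \<sigma> ''y'' 0 = enc (take (n * T - qq) ds) \<and> \<sigma> ''h'' 0 = lam \<and>
     (\<forall>q<n * T. \<sigma> ''X'' (int q) = x q + (if n * T \<le> q + qq then lam * ds ! q else 0))"

lemma den_decode:
  assumes D: "decoded x lam ds (i * T + j) \<sigma>" and ij: "i < n" "j < T"
    and \<sigma>: "\<sigma> ''i'' 0 = int i" "\<sigma> ''n'' 0 = int n"
    and ds: "length ds = n * T" "set ds \<subseteq> set moves"
  shows "decoded x lam ds (Suc (i * T + j)) (den (decode j) \<sigma>)"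
proof -
  have qq: "i * T + j < n * T" using brick_index[OF ij] .
  define m where "m = n * T - Suc (i * T + j)"
  have m: "m < n * T" "n * T - (i * T + j) = Suc m" using qq by (auto simp: m_def)
  have q: "aval (Sub (Sub (Mul (cell ''n'') (Const (int T))) (Const 1)) (coord j)) s = int m"
    if "s ''i'' 0 = int i" "s ''n'' 0 = int n" for s
    using that qq by (simp add: coord_def m_def of_nat_diff algebra_simps)
  have y: "\<sigma> ''y'' 0 = enc (take (Suc m) ds)" using D by (simp add: decoded_def m)
  have dm: "ds ! m \<in> set moves" using ds m(1) by (metis nth_mem subsetD)
  note e = enc_take[of m ds, unfolded ds(1), OF m(1) dm]
  have d: "\<sigma> ''y'' 0 - base * (\<sigma> ''y'' 0 div base) - int K = ds ! m" "\<sigma> ''y'' 0 div base = enc (take m ds)"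
    unfolding y using e by simp_all
  define \<sigma>' where "\<sigma>' = den (decode j) \<sigma>"
  have X: "\<sigma>' ''X'' = (\<sigma> ''X'')(int m := \<sigma> ''X'' (int m) + lam * ds ! m)"
    using q[of "\<sigma>(''v'' := (\<sigma> ''v'')(0 := \<sigma> ''y'' 0 - base * (\<sigma> ''y'' 0 div base)))"] \<sigma> d D
    by (simp add: \<sigma>'_def decode_def Let_def decoded_def)
  have "\<sigma>' ''y'' 0 = enc (take m ds)" "\<sigma>' ''h'' 0 = lam"
    using d D by (simp_all add: \<sigma>'_def decode_def Let_def decoded_def)
  moreover have "\<sigma>' ''X'' (int q) = x q + (if n * T \<le> q + Suc (i * T + j) then lam * ds ! q else 0)"
    if "q < n * T" for q
  proof (cases "q = m")
    case True
    then have "\<not> n * T \<le> q + (i * T + j)" "n * T \<le> q + Suc (i * T + j)" using m_def qq by linarith+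
    then show ?thesis using D that True by (simp add: X decoded_def)
  next
    case False
    then have "n * T \<le> q + Suc (i * T + j) \<longleftrightarrow> n * T \<le> q + (i * T + j)"
      using m_def qq by linarith
    then show ?thesis using D that False by (simp add: X decoded_def)
  qed
  moreover have "n * T - Suc (i * T + j) = m" by (simp add: m_def)
  ultimately show ?thesis unfolding \<sigma>'_def[symmetric] decoded_def by simp
qed

text \<open>The equations are recorded relative to \<open>x0\<close>, as membership of the
  difference in the kernel lattice, so the invariant does not mention the right-hand side.\<close>

definition progress :: "nat set \<Rightarrow> int \<Rightarrow> store \<Rightarrow> bool" where
  "progress P lam \<sigma> \<longleftrightarrow> (\<exists>x. (\<forall>q<n * T. \<sigma> ''X'' (int q) = x q) \<and>
     lattice_optimal n P lo up cost lam x \<and> (\<lambda>q. x q - x0 q) \<in> lattice n {})"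

lemma lattice_scale: "h \<in> lattice n P \<Longrightarrow> (\<lambda>q. c * h q) \<in> lattice n {}"
proof -
  have "row \<rho> (brick (\<lambda>q. c * h q) i) = c * row \<rho> (brick h i)" for \<rho> i
    unfolding row_def brick_def sum_distrib_left by (rule sum.cong) auto
  then show "h \<in> lattice n P \<Longrightarrow> (\<lambda>q. c * h q) \<in> lattice n {}"
    by (simp add: lattice_def low_lattice_def sum_distrib_left[symmetric])
qed

definition at_point :: "(nat \<Rightarrow> int) \<Rightarrow> int \<Rightarrow> nat \<Rightarrow> store \<Rightarrow> bool" where
  "at_point x lam k \<sigma> \<longleftrightarrow> (\<forall>q<n * T. \<sigma> ''X'' (int q) = x q) \<and> good \<sigma> \<and> \<sigma> ''h'' 0 = lam \<and> \<sigma> ''k'' 0 = int k"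

lemma at_point_indep:
  assumes "at_point x lam k \<sigma>"
    and "\<And>Y. Y \<notin> {''E'', ''V'', ''P'', ''F'', ''W'', ''Q'', ''y'', ''v'', ''i''} \<Longrightarrow> \<sigma>' Y = \<sigma> Y"
  shows "at_point x lam k \<sigma>'"
proof -
  have "good \<sigma>'"
    by (rule good_indep[of \<sigma>]) (use assms in \<open>auto simp: at_point_def\<close>)
  then show ?thesis using assms by (simp add: at_point_def)
qed

definition best_path :: "(nat \<Rightarrow> int) \<Rightarrow> int \<Rightarrow> nat \<Rightarrow> int list \<Rightarrow> bool" where
  "best_path x lam k ds \<longleftrightarrow> (\<exists>c. (ds, zero_state, c) \<in> paths x lam k (n * T) \<and>
     (\<forall>ds' c'. (ds', zero_state, c') \<in> paths x lam k (n * T) \<longrightarrow> c \<le> c'))"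

text \<open>The zero step is a path because \<open>x\<close> lies in the box; so the final table has
  an entry at \<open>zero_state\<close>.\<close>

lemma table_best_path:
  assumes tab: "table_ok x lam k (n * T) \<sigma>" and box: "in_box (n * T) lo up x"
  shows "\<exists>ds. best_path x lam k ds \<and> \<sigma> ''P'' (idx zero_state) = enc ds"
proof -
  have "(map (\<lambda>_. 0) [0..<n * T], zero_state, obj (n * T) cost (move x lam (\<lambda>_. 0))) \<in> paths x lam k (n * T)"
    using box by (intro lattice_path lattice_zero) (auto simp: l1_def)
  then have "entries x lam k (n * T) zero_state \<noteq> {}" by (auto simp: entries_def)
  moreover have "is_best (entries x lam k (n * T) zero_state) (\<sigma> ''E'' (idx zero_state))
      (\<sigma> ''V'' (idx zero_state)) (\<sigma> ''P'' (idx zero_state))"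
    using tab zero_state_mem by (auto simp: table_ok_def)
  ultimately show ?thesis
    unfolding is_best_def best_path_def entries_def by (auto split: if_splits)
qed

lemma best_path_progress:
  assumes ds: "best_path x lam k ds" and opt: "lattice_optimal n {k..<n * T} lo up cost lam x"
    and x0: "(\<lambda>q. x q - x0 q) \<in> lattice n {}"
    and dec: "decoded x lam ds (n * T) \<sigma>"
  shows "progress {Suc k..<n * T} lam \<sigma>"
proof -
  obtain c where c: "(ds, zero_state, c) \<in> paths x lam k (n * T)"
    "\<And>ds' c'. (ds', zero_state, c') \<in> paths x lam k (n * T) \<Longrightarrow> c \<le> c'"
    using ds by (auto simp: best_path_def)
  obtain h where h: "h \<in> lattice n {Suc k..<n * T}" "ds = map h [0..<n * T]"
    "in_box (n * T) lo up (move x lam h)" "c = obj (n * T) cost (move x lam h)"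
    using path_lattice[OF c(1)] by blast
  have "lattice_optimal n {Suc k..<n * T} lo up cost lam (move x lam h)"
  proof (rule refine_step[OF K_bound _ opt _ h(1,3)])
    fix g assume "g \<in> lattice n {Suc k..<n * T}" "l1 (n * T) g \<le> K" "in_box (n * T) lo up (move x lam g)"
    then show "obj (n * T) cost (move x lam h) \<le> obj (n * T) cost (move x lam g)"
      using c(2) lattice_path h(4) by blast
  next
    show "{k..<n * T} - {Suc k..<n * T} \<subseteq> {k}" by auto
  qed (use conv in auto)
  moreover have "(\<lambda>q. move x lam h q - x0 q) \<in> lattice n {}"
  proof -
    have "(\<lambda>q. (x q - x0 q) + lam * h q) \<in> lattice n {}"
      using lattice_add[OF x0 lattice_scale[OF h(1)]] .
    then show ?thesis by (simp add: algebra_simps)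
  qed
  moreover have "\<forall>q<n * T. \<sigma> ''X'' (int q) = move x lam h q"
    using dec h(2) by (simp add: decoded_def)
  ultimately show ?thesis unfolding progress_def by (intro exI[of _ "move x lam h"] conjI)
qed

lemma triple_exI: "(\<And>x. triple (P x) c t Q) \<Longrightarrow> triple (\<lambda>\<sigma>. \<exists>x. P x \<sigma>) c t Q"
  unfolding triple_def by (intro allI impI, elim exE) meson

lemma in_paths_length:
  assumes "(ds, st, c) \<in> paths x lam k q"
  shows "length ds = q" "set ds \<subseteq> set moves"
proof -
  obtain h where "(ds, st, c) = tuple x lam h q" "\<forall>q'<q. admissible x lam k q' (h q')"
    using in_paths_tuple[OF assms] by blast
  then show "length ds = q" "set ds \<subseteq> set moves" by (auto simp: tuple_def admissible_def)
qed

lemma triple_refine: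
  "triple (\<lambda>\<sigma>. progress {k..<n * T} lam \<sigma> \<and> good \<sigma> \<and> \<sigma> ''h'' 0 = lam \<and> \<sigma> ''k'' 0 = int k \<and> \<sigma> ''n'' 0 = int n)
    refine (Suc n * refine_cost) (progress {Suc k..<n * T} lam)"
proof -
  let ?P = "progress {Suc k..<n * T} lam"
  let ?put = "put ''y'' (Read ''P'' (Const (idx zero_state)))"
  \<comment> \<open>The existential in \<open>progress\<close> is opened outside the triple, because
    all intermediate assertions refer to the same starting point \<open>x\<close>.\<close>
  have "triple (\<lambda>\<sigma>. at_point x lam k \<sigma> \<and> \<sigma> ''n'' 0 = int n) refine (Suc n * refine_cost) ?P"
    if opt: "lattice_optimal n {k..<n * T} lo up cost lam x"
      and x0: "(\<lambda>q. x q - x0 q) \<in> lattice n {}" for x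
  proof -
    let ?I = "\<lambda>q \<sigma>. table_ok x lam k q \<sigma> \<and> at_point x lam k \<sigma>"
    have 1: "triple (\<lambda>\<sigma>. at_point x lam k \<sigma> \<and> \<sigma> ''n'' 0 = int n) start (max_cost start)
      (\<lambda>\<sigma>. ?I 0 \<sigma> \<and> \<sigma> ''n'' 0 = int n)"
    proof (rule triple_den[OF loop_free_start])
      fix \<sigma> assume a: "at_point x lam k \<sigma> \<and> \<sigma> ''n'' 0 = int n"
      have w: "den start \<sigma> Y = \<sigma> Y" if "Y \<notin> {''E'', ''V'', ''P''}" for Y
        using writes_start that by (intro den_writes) auto
      show "?I 0 (den start \<sigma>) \<and> den start \<sigma> ''n'' 0 = int n"
      proof (intro conjI)
        show "at_point x lam k (den start \<sigma>)"
          by (rule at_point_indep[of x lam k \<sigma>]) (use a w in auto)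
      qed (use a w in \<open>auto simp: den_start\<close>)
    qed simp
    have 2: "triple (\<lambda>\<sigma>. ?I 0 \<sigma> \<and> \<sigma> ''n'' 0 = int n)
      (flat_loop T layer) (Suc n * flat_cost T layer)
      (\<lambda>\<sigma>. ?I (n * T) \<sigma> \<and> \<sigma> ''n'' 0 = int n)"
    proof (rule triple_flat_loop[where I = ?I])
      fix i j \<sigma>
      assume ij: "i < n" "j < T" and \<sigma>: "\<sigma> ''i'' 0 = int i" "\<sigma> ''n'' 0 = int n"
        and I: "?I (i * T + j) \<sigma>"
      have q: "i * T + j < n * T" using brick_index[OF ij] .
      have w: "den (layer j) \<sigma> Y = \<sigma> Y"
        if "Y \<notin> {''E'', ''V'', ''P'', ''F'', ''W'', ''Q'', ''y'', ''v''}" for Y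
        using writes_layer that by (intro den_writes) auto
      have "table_ok x lam k (Suc (i * T + j)) (den (layer j) \<sigma>)"
        using I \<sigma> q by (intro den_layer[OF _ refl ij]) (auto simp: at_point_def simp del: of_nat_add of_nat_mult)
      moreover have "at_point x lam k (den (layer j) \<sigma>)"
        by (rule at_point_indep[of x lam k \<sigma>]) (use I w in auto)
      ultimately show "?I (Suc (i * T + j)) (den (layer j) \<sigma>) \<and>
        den (layer j) \<sigma> ''i'' 0 = int i \<and> den (layer j) \<sigma> ''n'' 0 = int n"
        using w \<sigma> by simp
    next
      fix q \<sigma> and f :: "int \<Rightarrow> int" assume I: "?I q \<sigma>"
      have "at_point x lam k (\<sigma>(''i'' := f))"
        by (rule at_point_indep[of x lam k \<sigma>]) (use I in auto)
      then show "?I q (\<sigma>(''i'' := f))"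
        using I by (simp add: table_ok_def)
    qed (rule loop_free_layer)
    have 3: "triple (\<lambda>\<sigma>. ?I (n * T) \<sigma> \<and> \<sigma> ''n'' 0 = int n)
      ?put 0
      (\<lambda>\<sigma>. \<exists>ds. best_path x lam k ds \<and> decoded x lam ds 0 \<sigma> \<and> \<sigma> ''n'' 0 = int n)"
    proof (rule triple_den)
      fix \<sigma> assume a: "?I (n * T) \<sigma> \<and> \<sigma> ''n'' 0 = int n"
      then obtain ds where ds: "best_path x lam k ds" "\<sigma> ''P'' (idx zero_state) = enc ds"
        using table_best_path opt unfolding lattice_optimal_def by blast
      have "length ds = n * T" using ds(1) in_paths_length by (auto simp: best_path_def)
      then have "decoded x lam ds 0 (den ?put \<sigma>)"
        using a ds(2) by (simp add: decoded_def at_point_def)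
      then show "\<exists>ds. best_path x lam k ds \<and> decoded x lam ds 0 (den ?put \<sigma>) \<and>
          den ?put \<sigma> ''n'' 0 = int n"
        using a ds(1) by auto
    qed auto
    have 4: "triple (\<lambda>\<sigma>. \<exists>ds. best_path x lam k ds \<and> decoded x lam ds 0 \<sigma> \<and> \<sigma> ''n'' 0 = int n)
      (flat_loop T decode) (Suc n * flat_cost T decode) ?P"
    proof (rule triple_exI)
      fix ds
      show "triple (\<lambda>\<sigma>. best_path x lam k ds \<and> decoded x lam ds 0 \<sigma> \<and> \<sigma> ''n'' 0 = int n)
        (flat_loop T decode) (Suc n * flat_cost T decode) ?P"
      proof (cases "best_path x lam k ds")
        case True
        then have len: "length ds = n * T" "set ds \<subseteq> set moves"
          using in_paths_length unfolding best_path_def by blast+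
        have "triple (\<lambda>\<sigma>. decoded x lam ds 0 \<sigma> \<and> \<sigma> ''n'' 0 = int n) (flat_loop T decode) (Suc n * flat_cost T decode)
          (\<lambda>\<sigma>. decoded x lam ds (n * T) \<sigma> \<and> \<sigma> ''n'' 0 = int n)"
        proof (rule triple_flat_loop)
          fix i j \<sigma>
          assume a: "i < n" "j < T" "\<sigma> ''i'' 0 = int i" "\<sigma> ''n'' 0 = int n" "decoded x lam ds (i * T + j) \<sigma>"
          have w: "den (decode j) \<sigma> Y = \<sigma> Y" if "Y \<notin> {''X'', ''y'', ''v''}" for Y
            using writes_decode that by (intro den_writes) auto
          show "decoded x lam ds (Suc (i * T + j)) (den (decode j) \<sigma>) \<and>
            den (decode j) \<sigma> ''i'' 0 = int i \<and> den (decode j) \<sigma> ''n'' 0 = int n"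
            using den_decode[OF a(5,1,2,3,4) len] a w by simp
        qed (auto simp: decoded_def loop_free_decode)
        then show ?thesis
          by (rule triple_conseq) (use True best_path_progress[OF True opt x0] in auto)
      qed (simp add: triple_def)
    qed
    show ?thesis unfolding refine_def
      by (rule triple_conseq[OF triple_Seq[OF 1 triple_Seq[OF 2 triple_Seq[OF 3 4]]]])
        (auto simp: refine_cost_def algebra_simps)
  qed
  then have "triple (\<lambda>\<sigma>. \<exists>x. (lattice_optimal n {k..<n * T} lo up cost lam x \<and> (\<lambda>q. x q - x0 q) \<in> lattice n {}) \<and>
      at_point x lam k \<sigma> \<and> \<sigma> ''n'' 0 = int n) refine (Suc n * refine_cost) ?P"
    by (intro triple_exI) (auto simp: triple_def)
  then show ?thesis
    by (rule triple_conseq) (auto simp: progress_def at_point_def)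
qed

end

section \<open>Scaling\<close>

context dp_program
begin

text \<open>Step lengths are powers of two, from the first that is at least \<open>S\<close> down to
  1. Floor division turns 1 into 0, which ends the loop after the phase with step length 1.\<close>

definition scaling :: com where
  "scaling = Seq (put ''h'' (Const 1))
     (Seq (While (Less (cell ''h'') (cell ''S'')) (put ''h'' (Mul (Const 2) (cell ''h''))))
       (While (Less (Const 0) (cell ''h''))
         (Seq (for_loop ''k'' (Mul (cell ''n'') (Const (int T))) refine)
           (put ''h'' (Div (cell ''h'') (Const 2))))))"

definition scaling_cost :: nat where
  "scaling_cost = (T + 1) * (2 * refine_cost + 3) + 4"

lemma writes_scaling: "writes scaling \<subseteq>
    {''E'', ''V'', ''P'', ''F'', ''W'', ''Q'', ''y'', ''v'', ''X'', ''i'', ''k'', ''h''}"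
  by (auto simp: scaling_def for_loop_def dest!: subsetD[OF writes_refine])

end

context dp_instance
begin

lemma progress_cong: "progress P lam \<sigma> \<Longrightarrow> \<sigma>' ''X'' = \<sigma> ''X'' \<Longrightarrow> progress P lam \<sigma>'"
  by (simp add: progress_def)

lemma good_cong:
  assumes "good \<sigma>" and "\<And>Y. Y \<notin> writes refine \<union> {''k'', ''h''} \<Longrightarrow> \<sigma>' Y = \<sigma> Y"
  shows "good \<sigma>'"
  using assms(1)
proof (rule good_indep)
  fix Y assume Y: "Y \<notin> {''E'', ''V'', ''P'', ''F'', ''W'', ''Q'', ''y'', ''v'', ''X'', ''i'', ''k'', ''h''}"
  have "Y \<notin> writes refine"
  proof
    assume "Y \<in> writes refine"
    from subsetD[OF writes_refine this] Y show False by simp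
  qed
  then show "\<sigma>' Y = \<sigma> Y" using Y by (intro assms(2)) simp
qed

lemma triple_phase:
  "triple (\<lambda>\<sigma>. progress {..<n * T} lam \<sigma> \<and> good \<sigma> \<and> \<sigma> ''h'' 0 = lam \<and> \<sigma> ''n'' 0 = int n)
    (for_loop ''k'' (Mul (cell ''n'') (Const (int T))) refine)
    (Suc (n * T) * (Suc n * refine_cost + 3))
    (\<lambda>\<sigma>. progress {} lam \<sigma> \<and> good \<sigma> \<and> \<sigma> ''h'' 0 = lam \<and> \<sigma> ''n'' 0 = int n)"
proof -
  let ?I = "\<lambda>k \<sigma>. progress {k..<n * T} lam \<sigma> \<and> good \<sigma> \<and> \<sigma> ''h'' 0 = lam \<and> \<sigma> ''n'' 0 = int n"
  have "triple (?I 0) (for_loop ''k'' (Mul (cell ''n'') (Const (int T))) refine)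
      (Suc (n * T) * (acost (Mul (cell ''n'') (Const (int T))) + Suc n * refine_cost + 2)) (?I (n * T))"
  proof (rule triple_for)
    fix k assume "k < n * T"
    let ?C = "\<lambda>\<sigma>. good \<sigma> \<and> \<sigma> ''h'' 0 = lam \<and> \<sigma> ''k'' 0 = int k \<and> \<sigma> ''n'' 0 = int n"
    have "triple (\<lambda>\<sigma>. (progress {k..<n * T} lam \<sigma> \<and> ?C \<sigma>) \<and> ?C \<sigma>) refine (Suc n * refine_cost)
        (\<lambda>\<sigma>. progress {Suc k..<n * T} lam \<sigma> \<and> ?C \<sigma>)"
    proof (rule triple_frame[OF triple_refine])
      fix \<sigma> \<sigma>' assume a: "?C \<sigma>" and w: "\<And>Y. Y \<notin> writes refine \<Longrightarrow> \<sigma>' Y = \<sigma> Y"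
      have "good \<sigma>'" by (rule good_cong[of \<sigma>]) (use a w in auto)
      moreover have "\<sigma>' ''h'' = \<sigma> ''h''" "\<sigma>' ''k'' = \<sigma> ''k''" "\<sigma>' ''n'' = \<sigma> ''n''"
        using writes_refine by (auto intro!: w)
      ultimately show "?C \<sigma>'" using a by simp
    qed
    then show "triple (\<lambda>\<sigma>. ?I k \<sigma> \<and> \<sigma> ''k'' 0 = int k) refine (Suc n * refine_cost)
        (\<lambda>\<sigma>. ?I (Suc k) \<sigma> \<and> \<sigma> ''k'' 0 = int k)"
      by (rule triple_conseq) auto
  next
    fix k \<sigma> and f :: "int \<Rightarrow> int" assume I: "?I k \<sigma>"
    have "good (\<sigma>(''k'' := f))" by (rule good_cong[of \<sigma>]) (use I in auto)
    then show "?I k (\<sigma>(''k'' := f))" using I by (auto elim: progress_cong)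
  qed simp
  then show ?thesis by (rule triple_conseq) (auto simp: atLeast0LessThan algebra_simps)
qed

text \<open>The loop stops at the least power of two that is at least \<open>s\<close>. Since
  \<open>e\<close> merely bounds its exponent, any estimate of \<open>s\<close> yields a running
  time.\<close>

lemma triple_double:
  assumes s: "s \<le> 2 ^ e"
  shows "triple (\<lambda>\<sigma>. \<sigma> ''h'' 0 = 1 \<and> \<sigma> ''S'' 0 = s)
    (While (Less (cell ''h'') (cell ''S'')) (put ''h'' (Mul (Const 2) (cell ''h'')))) (Suc e * 2)
    (\<lambda>\<sigma>. \<exists>m\<le>e. \<sigma> ''h'' 0 = 2 ^ m \<and> s \<le> 2 ^ m)"
proof -
  define m where "m = (LEAST m. s \<le> 2 ^ m)"
  have m: "s \<le> 2 ^ m" "m \<le> e" unfolding m_def using s by (auto intro: LeastI Least_le)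
  have less: "2 ^ k < s" if "k < m" for k
    using not_less_Least[of k "\<lambda>m. s \<le> 2 ^ m"] that by (auto simp: m_def not_le)
  let ?I = "\<lambda>k \<sigma>. k \<le> m \<and> \<sigma> ''h'' 0 = 2 ^ (m - k) \<and> \<sigma> ''S'' 0 = s"
  have "triple (?I m) (While (Less (cell ''h'') (cell ''S'')) (put ''h'' (Mul (Const 2) (cell ''h''))))
      (Suc m * (bcost (Less (cell ''h'') (cell ''S'')) + 1)) (?I 0)"
  proof (rule triple_While)
    fix k assume "k < m"
    then have "m - k = Suc (m - Suc k)" by simp
    then show "triple (?I (Suc k)) (put ''h'' (Mul (Const 2) (cell ''h''))) 1 (?I k)"
      by (intro triple_den) auto
  qed (use m less in auto)
  then show ?thesis by (rule triple_conseq) (use m in auto)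
qed

lemma triple_scaling:
  assumes n: "0 < n" and box: "in_box (n * T) lo up x0"
    and s: "\<And>q. q < n * T \<Longrightarrow> up q - lo q < s" "s \<le> 2 ^ e"
  shows "triple (\<lambda>\<sigma>. (\<forall>q<n * T. \<sigma> ''X'' (int q) = x0 q) \<and> good \<sigma> \<and> \<sigma> ''S'' 0 = s \<and> \<sigma> ''n'' 0 = int n)
    scaling ((e + 2) * n ^ 2 * scaling_cost) (progress {} 1)"
proof -
  \<comment> \<open>The index counts the phases left: at \<open>Suc k\<close> the phase with step
    length \<open>2 ^ k\<close> is about to start, at 0 the one with step length 1 is over.\<close>
  define I where "I k \<sigma> \<longleftrightarrow> good \<sigma> \<and> \<sigma> ''n'' 0 = int n \<and>
    (case k of 0 \<Rightarrow> \<sigma> ''h'' 0 = 0 \<and> progress {} 1 \<sigma> | Suc k \<Rightarrow> \<sigma> ''h'' 0 = 2 ^ k \<and> progress {..<n * T} (2 ^ k) \<sigma>)"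
    for k and \<sigma> :: store
  let ?J = "\<lambda>\<sigma>. (\<forall>q<n * T. \<sigma> ''X'' (int q) = x0 q) \<and> good \<sigma> \<and> \<sigma> ''n'' 0 = int n"
  let ?M = "\<lambda>\<sigma>. \<exists>m\<le>e. \<sigma> ''h'' 0 = 2 ^ m \<and> s \<le> 2 ^ m"
  let ?dbl = "While (Less (cell ''h'') (cell ''S'')) (put ''h'' (Mul (Const 2) (cell ''h'')))"
  let ?c = "Seq (for_loop ''k'' (Mul (cell ''n'') (Const (int T))) refine)
           (put ''h'' (Div (cell ''h'') (Const 2)))"
  let ?main = "While (Less (Const 0) (cell ''h'')) ?c"
  let ?t = "Suc (n * T) * (Suc n * refine_cost + 3)"
  have main: "triple (I k) ?main (Suc k * (bcost (Less (Const 0) (cell ''h'')) + (?t + 1))) (I 0)" for k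
  proof (rule triple_While)
    fix m
    have "triple (\<lambda>\<sigma>. progress {} (2 ^ m) \<sigma> \<and> good \<sigma> \<and> \<sigma> ''h'' 0 = 2 ^ m \<and> \<sigma> ''n'' 0 = int n)
        (put ''h'' (Div (cell ''h'') (Const 2))) 1 (I m)"
    proof (rule triple_den)
      fix \<sigma> assume a: "progress {} (2 ^ m) \<sigma> \<and> good \<sigma> \<and> \<sigma> ''h'' 0 = 2 ^ m \<and> \<sigma> ''n'' 0 = int n"
      let ?\<sigma> = "den (put ''h'' (Div (cell ''h'') (Const 2))) \<sigma>"
      have "good ?\<sigma>" by (rule good_cong[of \<sigma>]) (use a in auto)
      moreover have "progress {..<n * T} (2 ^ k) ?\<sigma>" if "m = Suc k" for k
        using a that by (auto simp: progress_def intro: lattice_optimal_halve)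
      moreover have "progress {} 1 ?\<sigma>" if "m = 0" using a that by (auto elim: progress_cong)
      ultimately show "I m ?\<sigma>" using a by (auto simp: I_def split: nat.split)
    qed auto
    from triple_Seq[OF triple_phase this] show "triple (I (Suc m)) ?c (?t + 1) (I m)"
      by (rule triple_conseq) (auto simp: I_def)
  qed (auto simp: I_def)
  have mid: "triple (\<lambda>\<sigma>. ?M \<sigma> \<and> ?J \<sigma>)
      ?main (Suc (Suc e) * (?t + 2)) (progress {} 1)"
    unfolding triple_def
  proof (intro allI impI)
    fix \<sigma> assume a: "?M \<sigma> \<and> ?J \<sigma>"
    then obtain m where m: "m \<le> e" "\<sigma> ''h'' 0 = 2 ^ m" "s \<le> 2 ^ m" by blast
    have "lattice_optimal n {..<n * T} lo up cost (2 ^ m) x0"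
      using s(1) m(3) by (intro lattice_optimal_coarse[OF box]) fastforce+
    then have "progress {..<n * T} (2 ^ m) \<sigma>"
      unfolding progress_def using a by (intro exI[of _ x0]) (simp add: lattice_zero)
    then have "I (Suc m) \<sigma>" using a m by (simp add: I_def)
    then obtain \<tau> \<sigma>' where 1: "exec ?main \<sigma> \<tau> \<sigma>'"
      "\<tau> \<le> Suc (Suc m) * (?t + 2)" "I 0 \<sigma>'"
      using main[of "Suc m"] unfolding triple_def by auto
    have "Suc (Suc m) * (?t + 2) \<le> Suc (Suc e) * (?t + 2)" using m(1) by (intro mult_le_mono1) simp
    then have "\<tau> \<le> Suc (Suc e) * (?t + 2)" using 1(2) by linarith
    then show "\<exists>\<tau> \<sigma>'. exec ?main \<sigma> \<tau> \<sigma>' \<and> \<tau> \<le> Suc (Suc e) * (?t + 2) \<and> progress {} 1 \<sigma>'"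
      using 1(1,3) by (auto simp: I_def)
  qed
  have J: "?J \<sigma>'" if "?J \<sigma>" "\<And>Y. Y \<noteq> ''h'' \<Longrightarrow> \<sigma>' Y = \<sigma> Y" for \<sigma> \<sigma>'
  proof -
    have "good \<sigma>'" by (rule good_cong[of \<sigma>]) (use that in auto)
    then show ?thesis using that by simp
  qed
  have dbl: "triple (\<lambda>\<sigma>. (\<sigma> ''h'' 0 = 1 \<and> \<sigma> ''S'' 0 = s) \<and> ?J \<sigma>)
      ?dbl (Suc e * 2)
      (\<lambda>\<sigma>. ?M \<sigma> \<and> ?J \<sigma>)"
  proof (rule triple_frame[OF triple_double[OF s(2)]])
    fix \<sigma> \<sigma>' assume J0: "?J \<sigma>" and
      w: "\<And>Y. Y \<notin> writes ?dbl \<Longrightarrow> \<sigma>' Y = \<sigma> Y"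
    show "?J \<sigma>'" by (rule J[OF J0 w]) simp
  qed
  have "triple (\<lambda>\<sigma>. (\<forall>q<n * T. \<sigma> ''X'' (int q) = x0 q) \<and> good \<sigma> \<and> \<sigma> ''S'' 0 = s \<and> \<sigma> ''n'' 0 = int n)
      (put ''h'' (Const 1)) 0 (\<lambda>\<sigma>. (\<sigma> ''h'' 0 = 1 \<and> \<sigma> ''S'' 0 = s) \<and> ?J \<sigma>)"
  proof (rule triple_den)
    fix \<sigma> :: store assume a: "(\<forall>q<n * T. \<sigma> ''X'' (int q) = x0 q) \<and> good \<sigma> \<and> \<sigma> ''S'' 0 = s \<and> \<sigma> ''n'' 0 = int n"
    have "?J (den (put ''h'' (Const 1)) \<sigma>)" by (rule J[of \<sigma>]) (use a in auto)
    then show "(den (put ''h'' (Const 1)) \<sigma> ''h'' 0 = 1 \<and> den (put ''h'' (Const 1)) \<sigma> ''S'' 0 = s) \<and>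
        ?J (den (put ''h'' (Const 1)) \<sigma>)" using a by simp
  qed auto
  note all = triple_Seq[OF this triple_Seq[OF dbl mid]]
  have time: "0 + (Suc e * 2 + Suc (Suc e) * (?t + 2)) \<le> (e + 2) * n ^ 2 * scaling_cost"
  proof -
    have n2: "1 \<le> n ^ 2" using n by simp
    have "Suc (n * T) \<le> n * (T + 1)" using n by (simp add: Suc_le_eq)
    moreover have "Suc n * refine_cost + 3 \<le> n * (2 * refine_cost + 3)"
    proof -
      have "Suc n * refine_cost \<le> (2 * n) * refine_cost" using n by (intro mult_le_mono1) simp
      moreover have "3 \<le> n * 3" using n by simp
      moreover have "n * (2 * refine_cost + 3) = (2 * n) * refine_cost + n * 3" by (simp add: algebra_simps)
      ultimately show ?thesis by linarith
    qed
    ultimately have "?t \<le> (n * (T + 1)) * (n * (2 * refine_cost + 3))" by (rule mult_le_mono)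
    also have "\<dots> = n ^ 2 * ((T + 1) * (2 * refine_cost + 3))" by (simp add: power2_eq_square algebra_simps)
    finally have "?t + 4 \<le> n ^ 2 * scaling_cost"
      using n2 unfolding scaling_cost_def distrib_left by linarith
    then have "(e + 2) * (?t + 4) \<le> (e + 2) * (n ^ 2 * scaling_cost)" by (rule mult_le_mono2)
    then show ?thesis by (simp add: algebra_simps)
  qed
  show ?thesis unfolding scaling_def by (rule triple_conseq[OF all]) (use time in auto)
qed

end

section \<open>The program\<close>

text \<open>
  Every brick receives a slack variable for each of the \<open>r + s\<close> rows.  With the slacks equal to the
  residuals the point \<open>l\<close> becomes feasible, and a penalty larger than the range of \<open>f\<close> on the box
  drives the slacks to 0 whenever that is possible.
\<close>

definition ext_mat :: "nat \<Rightarrow> int mat \<Rightarrow> nat \<Rightarrow> nat \<Rightarrow> int" where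
  "ext_mat t A \<rho> j = (if j < t then A $$ (\<rho>, j) else if j = t + \<rho> then 1 else 0)"

text \<open>The summand 1 covers the entries of the slack columns. A sum in place of a maximum needs
  no exception for empty index sets.\<close>

definition entry_bound :: "nat \<Rightarrow> nat \<Rightarrow> int mat \<Rightarrow> int" where
  "entry_bound t R A = 1 + (\<Sum>\<rho><R. \<Sum>j<t. \<bar>A $$ (\<rho>, j)\<bar>)"

lemma entry_bound: "\<rho> < R \<Longrightarrow> j < t \<Longrightarrow> \<bar>A $$ (\<rho>, j)\<bar> + 1 \<le> entry_bound t R A"
proof -
  assume "\<rho> < R" "j < t"
  then have "\<bar>A $$ (\<rho>, j)\<bar> \<le> (\<Sum>j<t. \<bar>A $$ (\<rho>, j)\<bar>)" by (intro member_le_sum) auto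
  also have "\<dots> \<le> (\<Sum>\<rho><R. \<Sum>j<t. \<bar>A $$ (\<rho>, j)\<bar>)"
    using \<open>\<rho> < R\<close> by (intro member_le_sum[where f = "\<lambda>\<rho>. \<Sum>j<t. \<bar>A $$ (\<rho>, j)\<bar>"]) (auto intro: sum_nonneg)
  finally show ?thesis by (simp add: entry_bound_def)
qed

lemma entry_bound_pos: "1 \<le> entry_bound t R A"
  by (simp add: entry_bound_def sum_nonneg)

lemma mat_vec_bricks:
  fixes B :: "int mat"
  assumes "B \<in> carrier_mat m (n * t)" "y \<in> carrier_vec (n * t)" "k < m"
  shows "(B *\<^sub>v y) $ k = (\<Sum>i<n. \<Sum>j<t. B $$ (k, i * t + j) * y $ (i * t + j))"
proof -
  have "(B *\<^sub>v y) $ k = (\<Sum>q<n * t. B $$ (k, q) * y $ q)"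
    using assms by (auto simp: scalar_prod_def atLeast0LessThan intro!: sum.cong)
  then show ?thesis by (simp add: sum_bricks)
qed

lemma feasible_set_iff:
  assumes t: "0 < t" and b: "b \<in> carrier_vec (r + n * s)"
  shows "y \<in> feasible_set r s t A n b l u \<longleftrightarrow> y \<in> carrier_vec (n * t) \<and>
    (\<forall>\<rho><r. (\<Sum>i<n. \<Sum>j<t. A $$ (\<rho>, j) * y $ (i * t + j)) = b $ \<rho>) \<and>
    (\<forall>i<n. \<forall>\<rho><s. (\<Sum>j<t. A $$ (r + \<rho>, j) * y $ (i * t + j)) = b $ (r + i * s + \<rho>)) \<and>
    (\<forall>k<n * t. l $ k \<le> y $ k \<and> y $ k \<le> u $ k)"
proof (cases "y \<in> carrier_vec (n * t)")
  case y: True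
  let ?B = "nfold_product r s t A n"
  have B: "?B \<in> carrier_mat (r + n * s) (n * t)" by (simp add: nfold_product_def)
  have upper: "(?B *\<^sub>v y) $ \<rho> = (\<Sum>i<n. \<Sum>j<t. A $$ (\<rho>, j) * y $ (i * t + j))" if "\<rho> < r" for \<rho>
    unfolding mat_vec_bricks[OF B y trans_less_add1[OF that]]
    using that by (intro sum.cong refl) (simp add: nfold_product_def upper_block_def brick_index)
  have lower: "(?B *\<^sub>v y) $ (r + i * s + \<rho>) = (\<Sum>j<t. A $$ (r + \<rho>, j) * y $ (i * t + j))"
    if i: "i < n" and \<rho>: "\<rho> < s" for i \<rho>
  proof -
    have k: "r + i * s + \<rho> < r + n * s" using brick_index[OF i \<rho>] by simp
    have "(?B *\<^sub>v y) $ (r + i * s + \<rho>) =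
        (\<Sum>i'<n. \<Sum>j<t. (if i' = i then A $$ (r + \<rho>, j) else 0) * y $ (i' * t + j))"
      unfolding mat_vec_bricks[OF B y k]
      using \<rho> k by (intro sum.cong refl) (auto simp: nfold_product_def lower_block_def brick_index add.assoc)
    also have "\<dots> = (\<Sum>i'<n. if i' = i then \<Sum>j<t. A $$ (r + \<rho>, j) * y $ (i * t + j) else 0)"
      by (intro sum.cong refl) auto
    finally show ?thesis using i by simp
  qed
  have "?B *\<^sub>v y = b \<longleftrightarrow> (\<forall>k<r + n * s. (?B *\<^sub>v y) $ k = b $ k)"
    using b B by (auto simp: vec_eq_iff)
  also have "\<dots> \<longleftrightarrow> (\<forall>\<rho><r. (?B *\<^sub>v y) $ \<rho> = b $ \<rho>) \<and>
      (\<forall>i<n. \<forall>\<rho><s. (?B *\<^sub>v y) $ (r + i * s + \<rho>) = b $ (r + i * s + \<rho>))" (is "?L \<longleftrightarrow> ?R")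
  proof
    assume ?L
    then show ?R by (auto dest: brick_index[of _ n _ s])
  next
    assume R: ?R
    show ?L
    proof (intro allI impI)
      fix k assume k: "k < r + n * s"
      show "(?B *\<^sub>v y) $ k = b $ k"
      proof (cases "k < r")
        case False
        then have "k - r < n * s" using k by linarith
        then have "(k - r) div s < n" "(k - r) mod s < s"
          by (auto simp: less_mult_imp_div_less) (metis mod_less_divisor mult_0_right neq0_conv not_less0)
        moreover have "k = r + (k - r) div s * s + (k - r) mod s" using False by simp
        ultimately show ?thesis using R by metis
      qed (use R in blast)
    qed
  qed
  finally show ?thesis using y upper lower by (simp add: feasible_set_def)
qed (simp add: feasible_set_def)

text \<open>\<open>K\<close> belongs to the matrix with slack columns and is fixed before
  \<open>n\<close>. It enters the program text through \<open>moves\<close>, \<open>states\<close>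
  and \<open>base\<close>.\<close>

locale nfold_program =
  fixes p r s t :: nat and A :: "int mat" and K :: nat
  assumes t_pos: "0 < t"
    and K: "\<And>n P h. h \<in> nfold_lattice.lattice (t + (r + s)) r (r + s) (ext_mat t A) n P \<Longrightarrow> h \<noteq> (\<lambda>_. 0) \<Longrightarrow>
      \<exists>h'\<in>nfold_lattice.lattice (t + (r + s)) r (r + s) (ext_mat t A) n P.
        h' \<noteq> (\<lambda>_. 0) \<and> conformal h' h \<and> nfold_lattice.l1 (n * (t + (r + s))) h' \<le> K"
begin

abbreviation R :: nat where "R \<equiv> r + s"
abbreviation T :: nat where "T \<equiv> t + (r + s)"

definition orig :: "nat \<Rightarrow> aexp" where
  "orig j = Add (Mul (cell ''i'') (Const (int t))) (Const (int j))"

definition sub_index :: "nat \<Rightarrow> nat \<Rightarrow> nat \<Rightarrow> aexp" where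
  "sub_index width j k = Add (Mul (orig j) (Const (int width))) (Const (int k))"

text \<open>At a common end-point two pieces match, but their values agree there, so either may
  write last. The guard on \<open>m\<close> excludes the remaining cells if there are fewer than
  \<open>p\<close> pieces.\<close>

definition piece_code :: "nat \<Rightarrow> nat \<Rightarrow> com" where
  "piece_code j k = Cond (And (Less (Const (int k)) (Read ''m'' (orig j)))
      (And (Not (Less (cell ''y'') (Read ''c'' (sub_index (p + 1) j k))))
           (Not (Less (Read ''c'' (sub_index (p + 1) j (Suc k))) (cell ''y'')))))
     (put ''v'' (Add (Mul (Read ''w'' (sub_index p j k)) (cell ''y'')) (Read ''a'' (sub_index p j k))))
     Skip"

text \<open>The quadratic penalty for slacks is one convex expression that vanishes at 0 and is at
  least \<open>M\<close> at every other integer.\<close>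

definition cost_code :: "nat \<Rightarrow> com" where
  "cost_code j = (if j < t then seqs (map (piece_code j) [0..<p])
     else put ''v'' (Mul (cell ''M'') (Mul (cell ''y'') (cell ''y''))))"

sublocale dp_program T r R "ext_mat t A" K "entry_bound t R A" cost_code
proof
  show "0 < T" using t_pos by simp
  fix h n P assume "h \<in> nfold_lattice.lattice T r R (ext_mat t A) n P" "h \<noteq> (\<lambda>_. 0)"
  then show "\<exists>h'\<in>nfold_lattice.lattice T r R (ext_mat t A) n P.
      h' \<noteq> (\<lambda>_. 0) \<and> conformal h' h \<and> nfold_lattice.l1 (n * T) h' \<le> K" by (rule K)
next
  fix \<rho> j assume "\<rho> < R" "j < T"
  then show "\<bar>ext_mat t A \<rho> j\<bar> \<le> entry_bound t R A"
    using entry_bound[of \<rho> R j t A] entry_bound_pos[of t R A] by (auto simp: ext_mat_def)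
next
  show "0 \<le> entry_bound t R A" using entry_bound_pos[of t R A] by linarith
qed (auto simp: cost_code_def loop_free_seqs piece_code_def writes_seqs)

definition sum_exp :: "aexp list \<Rightarrow> aexp" where
  "sum_exp es = foldr Add es (Const 0)"

lemma aval_sum_exp: "aval (sum_exp es) \<sigma> = (\<Sum>e\<leftarrow>es. aval e \<sigma>)"
  by (induction es) (auto simp: sum_exp_def)

lemma aval_sum_exp_upt: "aval (sum_exp (map f [0..<m])) \<sigma> = (\<Sum>j<m. aval (f j) \<sigma>)"
  by (simp add: aval_sum_exp interv_sum_list_conv_sum_set_nat atLeast0LessThan o_def)

text \<open>
  For \<open>i > 0\<close> and \<open>\<rho> < r\<close> the index is negative, so that the value read is 0: the right-hand side
  of the upper block is charged to brick 0 alone.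
\<close>

definition rhs_exp :: "nat \<Rightarrow> aexp" where
  "rhs_exp \<rho> = Read ''b'' (if \<rho> < r then Sub (Const (int \<rho>)) (Mul (cell ''i'') (Const (int r)))
     else Add (Const (int \<rho>)) (Mul (cell ''i'') (Const (int s))))"

definition x0_exp :: "nat \<Rightarrow> aexp" where
  "x0_exp j = (if j < t then Read ''l'' (orig j)
     else Sub (rhs_exp (j - t)) (sum_exp (map (\<lambda>j'. Mul (Const (A $$ (j - t, j'))) (Read ''l'' (orig j'))) [0..<t])))"

text \<open>As an integer is at most its square in absolute value, the slack interval between minus
  and plus the square of the initial value contains both this value and the target 0.\<close>

definition lo_exp :: "nat \<Rightarrow> aexp" where
  "lo_exp j = (if j < t then Read ''l'' (orig j) else Sub (Const 0) (Mul (x0_exp j) (x0_exp j)))"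

definition up_exp :: "nat \<Rightarrow> aexp" where
  "up_exp j = (if j < t then Read ''u'' (orig j) else Mul (x0_exp j) (x0_exp j))"

definition sq :: "aexp \<Rightarrow> aexp" where
  "sq e = Mul e e"

text \<open>Bounds one summand of the objective on its interval:
  \<open>\<bar>w * z + a\<bar>\<close> is at most \<open>w * w + a * a + z * z\<close>, and
  \<open>z * z\<close> is at most the sum of the squared bounds. Summing over all \<open>p\<close>
  pieces spares finding the right one.\<close>

definition mag_exp :: "nat \<Rightarrow> aexp" where
  "mag_exp j = (if j < t then Add (Add (sq (Read ''l'' (orig j))) (sq (Read ''u'' (orig j))))
     (sum_exp (map (\<lambda>k. Add (sq (Read ''w'' (sub_index p j k))) (sq (Read ''a'' (sub_index p j k)))) [0..<p]))
     else Const 0)"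

text \<open>\<open>S\<close> grows to one more than the total width, \<open>M\<close> to the
  penalty. \<open>B\<close> flags an empty interval, in which case no feasible point exists and the
  scaling is skipped.\<close>

definition init_code :: "nat \<Rightarrow> com" where
  "init_code j = Seq (Assign ''X'' (coord j) (x0_exp j))
     (Seq (Assign ''L'' (coord j) (lo_exp j))
     (Seq (Assign ''U'' (coord j) (up_exp j))
     (Seq (put ''S'' (Add (cell ''S'') (Sub (up_exp j) (lo_exp j))))
     (Seq (put ''M'' (Add (cell ''M'') (Mul (Const 2) (mag_exp j))))
     (Cond (Less (up_exp j) (lo_exp j)) (put ''B'' (Const 1)) Skip)))))"

definition final_code :: "nat \<Rightarrow> com" where
  "final_code j = (if j < t then Assign ''x'' (orig j) (Read ''X'' (coord j))
     else put ''Z'' (Add (cell ''Z'') (Mul (Read ''X'' (coord j)) (Read ''X'' (coord j)))))"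

definition program :: com where
  "program = Seq (put ''S'' (Const 1)) (Seq (put ''M'' (Const 1)) (Seq (flat_loop T init_code)
     (Cond (Equal (cell ''B'') (Const 0))
       (Seq scaling (Seq (flat_loop T final_code)
         (Cond (Equal (cell ''Z'') (Const 0)) (put ''feasible'' (Const 1)) Skip)))
       Skip)))"

end

locale nfold_instance = nfold_program p r s t A K for p r s t A K +
  fixes n :: nat and b l u :: "int vec" and F :: "nat \<Rightarrow> nat \<Rightarrow> pwa"
    and g :: "nat \<Rightarrow> nat \<Rightarrow> real \<Rightarrow> real" and f :: "real vec \<Rightarrow> real"
  assumes n_pos: "0 < n"
    and b: "b \<in> carrier_vec (r + n * s)" and l: "l \<in> carrier_vec (n * t)" and u: "u \<in> carrier_vec (n * t)"
    and f_sum: "\<And>x. x \<in> carrier_vec (n * t) \<Longrightarrow> f x = (\<Sum>i<n. \<Sum>j<t. g i j (x $ (i * t + j)))"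
    and g_convex: "\<And>i j. i < n \<Longrightarrow> j < t \<Longrightarrow> convex_on UNIV (g i j)"
    and g_pieces: "\<And>i j. i < n \<Longrightarrow> j < t \<Longrightarrow>
      piecewise_affine p (l $ (i * t + j)) (u $ (i * t + j)) (g i j) (F i j)"
begin

definition rhs :: "nat \<Rightarrow> nat \<Rightarrow> int" where
  "rhs i \<rho> = (if \<rho> < r then if i = 0 then b $ \<rho> else 0 else b $ (r + i * s + (\<rho> - r)))"

definition x0 :: "nat \<Rightarrow> int" where
  "x0 q = (let i = q div T; j = q mod T in if j < t then l $ (i * t + j)
     else rhs i (j - t) - (\<Sum>j'<t. A $$ (j - t, j') * l $ (i * t + j')))"

definition lo :: "nat \<Rightarrow> int" where
  "lo q = (if q mod T < t then l $ (q div T * t + q mod T) else - (x0 q * x0 q))"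

definition up :: "nat \<Rightarrow> int" where
  "up q = (if q mod T < t then u $ (q div T * t + q mod T) else x0 q * x0 q)"

definition \<sigma>0 :: store where
  "\<sigma>0 = input_store p t n F b l u"

text \<open>Read from the input store and not from \<open>F\<close>, so that \<open>mag\<close> is
  literally what the program computes, including cells beyond the last piece.\<close>

definition slope :: "nat \<Rightarrow> nat \<Rightarrow> int" where
  "slope k' k = \<sigma>0 ''w'' (int (k' * p + k))"

definition offset :: "nat \<Rightarrow> nat \<Rightarrow> int" where
  "offset k' k = \<sigma>0 ''a'' (int (k' * p + k))"

definition mag :: "nat \<Rightarrow> int" where
  "mag q = (if q mod T < t then let o' = q div T * t + q mod T in
     l $ o' * l $ o' + u $ o' * u $ o' + (\<Sum>k<p. slope o' k * slope o' k + offset o' k * offset o' k) else 0)"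

text \<open>On the box the original cost lies between minus and plus the sum of \<open>mag\<close>,
  so its range is at most twice this sum; the 1 makes the penalty strictly larger.\<close>

definition penalty :: int where
  "penalty = 1 + (\<Sum>q<n * T. 2 * mag q)"

text \<open>The floor serves as a change of type: at integer points of the box \<open>g\<close> has
  integer values.\<close>

definition cost :: "nat \<Rightarrow> int \<Rightarrow> int" where
  "cost q z = (if q mod T < t then \<lfloor>g (q div T) (q mod T) (real_of_int z)\<rfloor> else penalty * (z * z))"

lemma mag_nonneg: "0 \<le> mag q"
  by (auto simp: mag_def Let_def intro!: add_nonneg_nonneg sum_nonneg)

lemma block_array_eq:
  "k < width \<Longrightarrow> o' < N \<Longrightarrow> block_array width N xs (int (o' * width + k)) = (if k < length (xs o') then xs o' ! k else 0)"
proof -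
  assume k: "k < width" and o': "o' < N"
  have i: "o' * width + k < N * width" using brick_index[OF o' k] .
  have m: "int (o' * width + k) mod int width = int k" using k by (simp add: of_nat_mod[symmetric])
  have "(o' * width + k) div width = o'" using k by simp
  then have d: "nat (int (o' * width + k)) div width = o'" by (simp only: nat_int)
  have "0 \<le> int (o' * width + k)" "int (o' * width + k) < int (N * width)" using i by (simp_all only: of_nat_0_le_iff of_nat_less_iff)
  then show ?thesis unfolding block_array_def m d by (simp add: array_def)
qed

lemma input_cells:
  "\<sigma>0 ''n'' 0 = int n"
  "k < n * t \<Longrightarrow> \<sigma>0 ''l'' (int k) = l $ k"
  "k < n * t \<Longrightarrow> \<sigma>0 ''u'' (int k) = u $ k"
  "\<sigma>0 ''b'' z = (if 0 \<le> z \<and> z < int (r + n * s) then b $ nat z else 0)"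
  "k' < n * t \<Longrightarrow> \<sigma>0 ''m'' (int k') = int (length (pieces (F (k' div t) (k' mod t))))"
  "k' < n * t \<Longrightarrow> k < p \<Longrightarrow> k < length (pieces (F (k' div t) (k' mod t))) \<Longrightarrow>
    slope k' k = fst (pieces (F (k' div t) (k' mod t)) ! k)"
  "k' < n * t \<Longrightarrow> k < p \<Longrightarrow> k < length (pieces (F (k' div t) (k' mod t))) \<Longrightarrow>
    offset k' k = snd (pieces (F (k' div t) (k' mod t)) ! k)"
  using b l u block_array_eq[of 0 1 k' "n * t"]
  by (simp_all add: \<sigma>0_def input_store_def Let_def array_def block_array_eq slope_def offset_def
      list_of_vec_index del: of_nat_add of_nat_mult)

lemma endpoint_cells:
  assumes "k' < n * t" "k < p + 1" "k < length (endpoints (F (k' div t) (k' mod t)))"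
  shows "\<sigma>0 ''c'' (int (k' * (p + 1) + k)) = endpoints (F (k' div t) (k' mod t)) ! k"
proof -
  have "\<sigma>0 ''c'' = block_array (p + 1) (n * t) (\<lambda>q. endpoints (F (q div t) (q mod t)))"
    by (simp add: \<sigma>0_def input_store_def Let_def)
  then show ?thesis using block_array_eq[OF assms(2,1)] assms(3) by presburger
qed

lemma other_cells_zero:
  "Y \<notin> {''n'', ''b'', ''l'', ''u'', ''m'', ''c'', ''w'', ''a''} \<Longrightarrow> \<sigma>0 Y z = 0"
  by (simp add: \<sigma>0_def input_store_def Let_def)

lemma piece_value:
  assumes "i < n" "j < t" "k < length (pieces (F i j))" "l $ (i * t + j) \<le> u $ (i * t + j)"
    "endpoints (F i j) ! k \<le> z" "z \<le> endpoints (F i j) ! Suc k"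
  shows "g i j (real_of_int z) = real_of_int (fst (pieces (F i j) ! k) * z + snd (pieces (F i j) ! k))"
proof -
  have "g i j (real_of_int z) = real_of_int (fst (pieces (F i j) ! k)) * real_of_int z + real_of_int (snd (pieces (F i j) ! k))"
    using g_pieces[OF assms(1,2)] assms(3-) unfolding piecewise_affine_def by simp
  then show ?thesis by simp
qed

text \<open>If no piece contained \<open>z\<close>, going from piece to piece would put
  \<open>z\<close> strictly beyond each end-point after the first, hence beyond the upper bound.
  Strictness starts only at index 1, since \<open>z\<close> may be the first end-point.\<close>

lemma piece_exists:
  assumes "i < n" "j < t" "l $ (i * t + j) \<le> z" "z \<le> u $ (i * t + j)"
  shows "\<exists>k<length (pieces (F i j)). endpoints (F i j) ! k \<le> z \<and> z \<le> endpoints (F i j) ! Suc k"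
proof -
  let ?e = "endpoints (F i j)" and ?m = "length (pieces (F i j))"
  have d: "?m > 0" "length ?e = Suc ?m" "hd ?e = l $ (i * t + j)" "last ?e = u $ (i * t + j)"
    using g_pieces[OF assms(1,2)] assms(3,4) unfolding piecewise_affine_def by auto
  have "?e \<noteq> []" using d(2) by auto
  then have e: "?e ! 0 \<le> z" "z \<le> ?e ! ?m"
    using d assms(3,4) by (auto simp: hd_conv_nth last_conv_nth)
  show ?thesis
  proof (rule ccontr)
    assume neg: "\<not> ?thesis"
    have "k \<le> ?m \<Longrightarrow> ?e ! k \<le> z \<and> (0 < k \<longrightarrow> ?e ! k < z)" for k
    proof (induction k)
      case (Suc k)
      then show ?case using neg by (auto simp: not_le dest!: spec[of _ k])
    qed (simp add: e)
    from this[of ?m] show False using e(2) d(1) by simp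
  qed
qed

lemma real_cost:
  assumes "i < n" "j < t" "l $ (i * t + j) \<le> z" "z \<le> u $ (i * t + j)"
  shows "real_of_int (cost (i * T + j) z) = g i j (real_of_int z)"
proof -
  obtain k where "k < length (pieces (F i j))" "endpoints (F i j) ! k \<le> z" "z \<le> endpoints (F i j) ! Suc k"
    using piece_exists[OF assms] by blast
  then show ?thesis using piece_value[OF assms(1,2), of k z] assms by (simp add: cost_def)
qed

lemma abs_le_square: "\<bar>a\<bar> \<le> a * a" for a :: int
proof (cases "a = 0")
  case False
  then have "1 * \<bar>a\<bar> \<le> \<bar>a\<bar> * \<bar>a\<bar>" by (intro mult_right_mono) auto
  then show ?thesis by simp
qed simp

lemma abs_affine_le: "\<bar>w * z + a\<bar> \<le> w * w + a * a + z * z" for w z a :: int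
proof -
  have "0 \<le> (w - z) * (w - z)" "0 \<le> (w + z) * (w + z)" "0 \<le> w * w" "0 \<le> z * z" by simp_all
  then have "\<bar>w * z\<bar> \<le> w * w + z * z" by (simp add: algebra_simps abs_le_iff)
  then show ?thesis using abs_le_square[of a] by linarith
qed

lemma square_le_ends:
  fixes l' z u' :: int
  assumes "l' \<le> z" "z \<le> u'"
  shows "z * z \<le> l' * l' + u' * u'"
proof (cases "0 \<le> z")
  case True
  then have "z * z \<le> u' * u'" using assms by (intro mult_mono) auto
  moreover have "0 \<le> l' * l'" by simp
  ultimately show ?thesis by linarith
next
  case False
  then have "(- z) * (- z) \<le> (- l') * (- l')" using assms by (intro mult_mono) auto
  moreover have "0 \<le> u' * u'" by simp
  ultimately show ?thesis by (simp only: minus_mult_minus)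
qed

lemma cost_le_mag:
  assumes "i < n" "j < t" "l $ (i * t + j) \<le> z" "z \<le> u $ (i * t + j)"
  shows "\<bar>cost (i * T + j) z\<bar> \<le> mag (i * T + j)"
proof -
  let ?o = "i * t + j"
  obtain k where k: "k < length (pieces (F i j))" "endpoints (F i j) ! k \<le> z" "z \<le> endpoints (F i j) ! Suc k"
    using piece_exists[OF assms] by blast
  have kp: "k < p" using k(1) g_pieces[OF assms(1,2)] unfolding piecewise_affine_def by linarith
  have o: "?o < n * t" "?o div t = i" "?o mod t = j" using assms(1,2) by (auto simp: brick_index)
  have "real_of_int (cost (i * T + j) z) = real_of_int (slope ?o k * z + offset ?o k)"
    using real_cost[OF assms] piece_value[OF assms(1,2) k(1) _ k(2,3)] k assms o kp input_cells(6,7)[OF o(1) kp]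
    by simp
  then have "cost (i * T + j) z = slope ?o k * z + offset ?o k" by (simp only: of_int_eq_iff)
  then have "\<bar>cost (i * T + j) z\<bar> \<le> slope ?o k * slope ?o k + offset ?o k * offset ?o k + z * z"
    using abs_affine_le by simp
  also have "slope ?o k * slope ?o k + offset ?o k * offset ?o k \<le>
      (\<Sum>k<p. slope ?o k * slope ?o k + offset ?o k * offset ?o k)"
    using kp by (intro member_le_sum[where f = "\<lambda>k. slope ?o k * slope ?o k + offset ?o k * offset ?o k"]) auto
  also have "z * z \<le> l $ ?o * l $ ?o + u $ ?o * u $ ?o" using square_le_ends assms(3,4) .
  finally show ?thesis using assms(2) by (simp add: mag_def Let_def)
qed

text \<open>For a slack the two sides differ by \<open>2 * a * b\<close> times the penalty. For an
  original variable \<open>x + b\<close> and \<open>x + a\<close> are convex combinations of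
  \<open>x\<close> and \<open>x + a + b\<close> with weights \<open>1 - m\<close>, \<open>m\<close>
  and \<open>m\<close>, \<open>1 - m\<close>, where \<open>m = b / (a + b)\<close>; adding the two
  inequalities gives the claim.\<close>

lemma discretely_convex_cost:
  assumes "q < n * T"
  shows "discretely_convex (lo q) (up q) (cost q)"
  unfolding discretely_convex_def
proof (intro allI impI)
  fix x a b :: int
  assume x: "lo q \<le> x" "x \<le> up q" "lo q \<le> x + a + b" "x + a + b \<le> up q" and ab: "0 \<le> a * b"
  show "cost q (x + a) + cost q (x + b) \<le> cost q x + cost q (x + a + b)"
  proof (cases "q mod T < t")
    case False
    have "0 \<le> penalty" using mag_nonneg by (simp add: penalty_def sum_nonneg)
    moreover have "(x + a) * (x + a) + (x + b) * (x + b) \<le> x * x + (x + a + b) * (x + a + b)"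
      using ab by (simp add: algebra_simps)
    ultimately have "penalty * ((x + a) * (x + a) + (x + b) * (x + b)) \<le> penalty * (x * x + (x + a + b) * (x + a + b))"
      by (intro mult_left_mono)
    then show ?thesis using False by (simp add: cost_def distrib_left)
  next
    case True
    define i j where "i = q div T" and "j = q mod T"
    have ij: "i < n" "j < t" "i * T + j = q"
      using assms True less_mult_imp_div_less unfolding i_def j_def by (blast, blast, simp only: div_mult_mod_eq)
    have lu: "lo q = l $ (i * t + j)" "up q = u $ (i * t + j)" using True by (auto simp: lo_def up_def i_def j_def)
    let ?g = "\<lambda>z. g i j (real_of_int z)"
    have cost: "real_of_int (cost q z) = ?g z" if "lo q \<le> z" "z \<le> up q" for z
      using real_cost[OF ij(1,2)] that unfolding lu ij(3) by blast
    have mid: "lo q \<le> x + a" "x + a \<le> up q" "lo q \<le> x + b" "x + b \<le> up q"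
      using x ab by (auto simp: zero_le_mult_iff)
    have "?g (x + a) + ?g (x + b) \<le> ?g x + ?g (x + a + b)"
    proof (cases "a + b = 0")
      case True
      then have "a = 0 \<and> b = 0" using ab by (auto simp: zero_le_mult_iff)
      then show ?thesis by simp
    next
      case False
      define m where "m = real_of_int b / real_of_int (a + b)"
      have m: "0 \<le> m" "m \<le> 1"
        using ab False by (auto simp: m_def zero_le_mult_iff field_simps divide_le_eq zero_le_divide_iff)
      note cv = convex_onD[OF g_convex[OF ij(1,2)]]
      have mab: "m * real_of_int (a + b) = real_of_int b" using False unfolding m_def by (simp del: of_int_add)
      have "(1 - m) * real_of_int x + m * real_of_int (x + a + b) = real_of_int x + m * real_of_int (a + b)"
        by (simp add: algebra_simps)
      then have "(1 - m) * real_of_int x + m * real_of_int (x + a + b) = real_of_int (x + b)"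
        unfolding mab by simp
      with cv[OF m(1,2), of x "x + a + b"] have 1: "?g (x + b) \<le> (1 - m) * ?g x + m * ?g (x + a + b)" by simp
      have "(1 - (1 - m)) * real_of_int x + (1 - m) * real_of_int (x + a + b) =
          real_of_int (x + a + b) - m * real_of_int (a + b)"
        by (simp add: algebra_simps)
      then have "(1 - (1 - m)) * real_of_int x + (1 - m) * real_of_int (x + a + b) = real_of_int (x + a)"
        unfolding mab by simp
      with cv[of "1 - m" x "x + a + b"] m have 2: "?g (x + a) \<le> m * ?g x + (1 - m) * ?g (x + a + b)" by simp
      show ?thesis using 1 2 by (simp add: algebra_simps)
    qed
    then have "real_of_int (cost q (x + a) + cost q (x + b)) \<le> real_of_int (cost q x + cost q (x + a + b))"
      using cost x mid by simp
    then show ?thesis by (simp only: of_int_le_iff)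
  qed
qed

end

section \<open>Correctness\<close>

context nfold_instance
begin

abbreviation feasible :: "int vec set" where "feasible \<equiv> feasible_set r s t A n b l u"

lemma row_ext:
  assumes "\<rho> < R"
  shows "row \<rho> (brick x i) = (\<Sum>j<t. A $$ (\<rho>, j) * x (i * T + j)) + x (i * T + (t + \<rho>))"
proof -
  have "row \<rho> (brick x i) = (\<Sum>j<t + R. ext_mat t A \<rho> j * x (i * T + j))"
    unfolding row_def by (intro sum.cong) (auto simp: brick_def)
  also have "\<dots> = (\<Sum>j<t. A $$ (\<rho>, j) * x (i * T + j)) + (\<Sum>j=t..<t + R. ext_mat t A \<rho> j * x (i * T + j))"
    unfolding lessThan_atLeast0 by (subst sum.atLeastLessThan_concat[symmetric, of 0 t]) (auto simp: ext_mat_def)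
  also have "(\<Sum>j=t..<t + R. ext_mat t A \<rho> j * x (i * T + j)) =
      (\<Sum>j=t..<t + R. if j = t + \<rho> then x (i * T + (t + \<rho>)) else 0)"
    by (intro sum.cong) (auto simp: ext_mat_def)
  finally show ?thesis using assms by simp
qed

lemma x0_orig: "j < t \<Longrightarrow> x0 (i * T + j) = l $ (i * t + j)"
  using t_pos by (simp add: x0_def Let_def)

lemma x0_slack: "\<rho> < R \<Longrightarrow> x0 (i * T + (t + \<rho>)) = rhs i \<rho> - (\<Sum>j<t. A $$ (\<rho>, j) * l $ (i * t + j))"
  using t_pos by (simp add: x0_def Let_def)

lemma row_x0: "\<rho> < R \<Longrightarrow> row \<rho> (brick x0 i) = rhs i \<rho>"
  unfolding row_ext by (simp add: x0_orig x0_slack)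

lemma sum_rhs: "\<rho> < r \<Longrightarrow> (\<Sum>i<n. rhs i \<rho>) = b $ \<rho>"
  using n_pos by (simp add: rhs_def)

definition slack_sum :: "(nat \<Rightarrow> int) \<Rightarrow> int" where
  "slack_sum x = (\<Sum>q<n * T. if q mod T < t then 0 else x q * x q)"

definition orig_cost :: "(nat \<Rightarrow> int) \<Rightarrow> int" where
  "orig_cost x = (\<Sum>q<n * T. if q mod T < t then cost q (x q) else 0)"

definition project :: "(nat \<Rightarrow> int) \<Rightarrow> int vec" where
  "project x = vec (n * t) (\<lambda>k. x (k div t * T + k mod t))"

text \<open>Beyond \<open>n * T\<close> the values are those of \<open>x0\<close>, so that the
  difference from \<open>x0\<close> has the support that \<open>lattice\<close> demands.\<close>

definition embed :: "int vec \<Rightarrow> nat \<Rightarrow> int" where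
  "embed y q = (if q < n * T then if q mod T < t then y $ (q div T * t + q mod T) else 0 else x0 q)"

lemma obj_split: "obj (n * T) cost x = orig_cost x + penalty * slack_sum x"
  unfolding obj_def orig_cost_def slack_sum_def sum_distrib_left sum.distrib[symmetric]
  by (rule sum.cong) (auto simp: cost_def)

lemma slack_sum_eq_0_iff: "slack_sum x = 0 \<longleftrightarrow> (\<forall>i<n. \<forall>\<rho><R. x (i * T + (t + \<rho>)) = 0)"
proof -
  have "slack_sum x = 0 \<longleftrightarrow> (\<forall>q<n * T. \<not> q mod T < t \<longrightarrow> x q = 0)"
    unfolding slack_sum_def by (subst sum_nonneg_eq_0_iff) auto
  also have "\<dots> \<longleftrightarrow> (\<forall>i<n. \<forall>\<rho><R. x (i * T + (t + \<rho>)) = 0)"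
  proof
    assume L: "\<forall>q<n * T. \<not> q mod T < t \<longrightarrow> x q = 0"
    show "\<forall>i<n. \<forall>\<rho><R. x (i * T + (t + \<rho>)) = 0"
    proof (intro allI impI)
      fix i \<rho> assume "i < n" "\<rho> < R"
      then have "i * T + (t + \<rho>) < n * T" by (intro brick_index) auto
      moreover have "(i * T + (t + \<rho>)) mod T = t + \<rho>" using \<open>\<rho> < R\<close> by simp
      ultimately show "x (i * T + (t + \<rho>)) = 0" using L by auto
    qed
  next
    assume Rt: "\<forall>i<n. \<forall>\<rho><R. x (i * T + (t + \<rho>)) = 0"
    show "\<forall>q<n * T. \<not> q mod T < t \<longrightarrow> x q = 0"
    proof (intro allI impI)
      fix q assume q: "q < n * T" "\<not> q mod T < t"
      define \<rho> where "\<rho> = q mod T - t"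
      have m: "q mod T = t + \<rho>" "\<rho> < R" using q(2) mod_less_divisor[of T q] t_pos unfolding \<rho>_def by linarith+
      have "q div T < n" using q(1) by (rule less_mult_imp_div_less)
      then have "x (q div T * T + (t + \<rho>)) = 0" using Rt m(2) by blast
      then show "x q = 0" unfolding m(1)[symmetric] div_mult_mod_eq .
    qed
  qed
  finally show ?thesis .
qed

lemma slack_sum_nonneg: "0 \<le> slack_sum x"
  unfolding slack_sum_def by (intro sum_nonneg) auto

lemma in_box_orig:
  assumes "in_box (n * T) lo up x" "i < n" "j < t"
  shows "l $ (i * t + j) \<le> x (i * T + j)" "x (i * T + j) \<le> u $ (i * t + j)"
proof -
  have "i * T + j < n * T" using assms(2,3) by (intro brick_index) auto
  then have "lo (i * T + j) \<le> x (i * T + j)" "x (i * T + j) \<le> up (i * T + j)"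
    using assms(1) by (auto simp: in_box_def)
  then show "l $ (i * t + j) \<le> x (i * T + j)" "x (i * T + j) \<le> u $ (i * t + j)"
    using assms(3) by (simp_all add: lo_def up_def)
qed

lemma orig_cost_bricks: "orig_cost x = (\<Sum>i<n. \<Sum>j<t. cost (i * T + j) (x (i * T + j)))"
proof -
  have "orig_cost x = (\<Sum>i<n. \<Sum>j<T. if j < t then cost (i * T + j) (x (i * T + j)) else 0)"
    unfolding orig_cost_def sum_bricks by (intro sum.cong refl) auto
  moreover have "(\<Sum>j<T. if j < t then h j else 0) = (\<Sum>j<t. h j)" for h :: "nat \<Rightarrow> int"
    by (rule sum.mono_neutral_cong_right) auto
  ultimately show ?thesis by simp
qed

lemma project_index: "i < n \<Longrightarrow> j < t \<Longrightarrow> project x $ (i * t + j) = x (i * T + j)"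
  by (simp add: project_def brick_index)

lemma orig_cost_project:
  assumes "in_box (n * T) lo up x"
  shows "real_of_int (orig_cost x) = f (map_vec real_of_int (project x))"
proof -
  have "real_of_int (orig_cost x) = (\<Sum>i<n. \<Sum>j<t. g i j (real_of_int (x (i * T + j))))"
    unfolding orig_cost_bricks of_int_sum by (intro sum.cong refl real_cost in_box_orig[OF assms]) auto
  also have "\<dots> = f (map_vec real_of_int (project x))"
    by (subst f_sum) (auto simp: project_index brick_index project_def intro!: sum.cong)
  finally show ?thesis .
qed

lemma orig_cost_bound:
  assumes "in_box (n * T) lo up x"
  shows "\<bar>orig_cost x\<bar> \<le> (\<Sum>q<n * T. mag q)"
proof -
  have "\<bar>orig_cost x\<bar> \<le> (\<Sum>i<n. \<bar>\<Sum>j<t. cost (i * T + j) (x (i * T + j))\<bar>)"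
    unfolding orig_cost_bricks by (rule sum_abs)
  also have "\<dots> \<le> (\<Sum>i<n. \<Sum>j<t. \<bar>cost (i * T + j) (x (i * T + j))\<bar>)"
    by (intro sum_mono sum_abs)
  also have "\<dots> \<le> (\<Sum>i<n. \<Sum>j<t. mag (i * T + j))"
    by (intro sum_mono cost_le_mag in_box_orig[OF assms]) auto
  also have "\<dots> \<le> (\<Sum>i<n. \<Sum>j<T. mag (i * T + j))"
    by (intro sum_mono sum_mono2) (auto simp: mag_nonneg)
  finally show ?thesis by (simp add: sum_bricks)
qed

lemma embed_orig: "i < n \<Longrightarrow> j < t \<Longrightarrow> embed y (i * T + j) = y $ (i * t + j)"
  using brick_index[of i n j T] by (simp add: embed_def)

lemma embed_slack: "i < n \<Longrightarrow> \<rho> < R \<Longrightarrow> embed y (i * T + (t + \<rho>)) = 0"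
  using brick_index[of i n "t + \<rho>" T] by (simp add: embed_def)

lemma row_embed:
  assumes "i < n" "\<rho> < R"
  shows "row \<rho> (brick (embed y) i) = (\<Sum>j<t. A $$ (\<rho>, j) * y $ (i * t + j))"
  unfolding row_ext[OF assms(2)] using assms by (simp add: embed_orig embed_slack)

lemma embed_lattice:
  assumes y: "y \<in> feasible"
  shows "(\<lambda>q. embed y q - x0 q) \<in> lattice n {}"
proof -
  note y' = y[unfolded feasible_set_iff[OF t_pos b]]
  have "(\<Sum>i<n. row \<rho> (brick (\<lambda>q. embed y q - x0 q) i)) = 0" if "\<rho> < r" for \<rho>
    unfolding brick_diff row_diff sum_subtractf using that y' by (simp add: row_embed row_x0 sum_rhs)
  moreover have "row \<rho> (brick (\<lambda>q. embed y q - x0 q) i) = 0" if "i < n" "\<rho> \<in> {r..<R}" for i \<rho>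
  proof -
    define \<rho>' where "\<rho>' = \<rho> - r"
    have \<rho>: "\<rho> = r + \<rho>'" "\<rho>' < s" using that(2) by (auto simp: \<rho>'_def)
    then show ?thesis
      unfolding brick_diff row_diff using that y' by (simp add: row_embed row_x0 rhs_def)
  qed
  moreover have "embed y q - x0 q = 0" if "q \<ge> n * T" for q using that by (simp add: embed_def)
  ultimately show ?thesis by (auto simp: lattice_def low_lattice_def)
qed

lemma embed_in_box:
  assumes y: "y \<in> feasible"
  shows "in_box (n * T) lo up (embed y)"
  unfolding in_box_def
proof (intro allI impI)
  fix q assume q: "q < n * T"
  show "lo q \<le> embed y q \<and> embed y q \<le> up q"
  proof (cases "q mod T < t")
    case True
    then have "q div T * t + q mod T < n * t"
      using less_mult_imp_div_less[OF q] brick_index by blast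
    then show ?thesis using y q True by (simp add: feasible_set_iff[OF t_pos b] lo_def up_def embed_def)
  qed (use q in \<open>simp add: lo_def up_def embed_def\<close>)
qed

lemma project_embed: "y \<in> carrier_vec (n * t) \<Longrightarrow> project (embed y) = y"
proof (rule eq_vecI)
  fix k assume y: "y \<in> carrier_vec (n * t)" and "k < dim_vec y"
  then have k: "k < n * t" by auto
  have "k div t < n" "k mod t < t" using k t_pos by (auto simp: less_mult_imp_div_less)
  then show "project (embed y) $ k = y $ k" using k by (simp add: project_def embed_orig)
qed (auto simp: project_def)

text \<open>A feasible \<open>y\<close> with zero slacks differs from \<open>x\<close> by a lattice
  vector, so the objective at \<open>x\<close> is at most the original cost of \<open>y\<close>. A
  nonzero slack would cost the penalty at least once, which exceeds any difference of original costs
  between two points of the box.\<close>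

lemma final_correct:
  assumes opt: "lattice_optimal n {} lo up cost 1 x" and x: "(\<lambda>q. x q - x0 q) \<in> lattice n {}"
  shows "slack_sum x \<noteq> 0 \<Longrightarrow> feasible = {}"
    and "slack_sum x = 0 \<Longrightarrow> is_optimal (feasible) f (project x)"
proof -
  have box: "in_box (n * T) lo up x" using opt by (simp add: lattice_optimal_def)
  have le: "obj (n * T) cost x \<le> orig_cost (embed y)" if y: "y \<in> feasible" for y
  proof -
    have "(\<lambda>q. (embed y q - x0 q) - (x q - x0 q)) \<in> lattice n {}"
      using lattice_diff[OF x embed_lattice[OF y]] .
    then have h: "(\<lambda>q. embed y q - x q) \<in> lattice n {}" by simp
    have "obj (n * T) cost x \<le> obj (n * T) cost (embed y)"
      using opt[unfolded lattice_optimal_def, THEN conjunct2, rule_format, OF h] embed_in_box[OF y] by simp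
    moreover have "slack_sum (embed y) = 0" by (simp add: slack_sum_eq_0_iff embed_slack)
    ultimately show ?thesis by (simp add: obj_split)
  qed
  show "feasible = {}" if "slack_sum x \<noteq> 0"
  proof (rule ccontr)
    assume "feasible \<noteq> {}"
    then obtain y where y: "y \<in> feasible" by blast
    have "0 < slack_sum x" using that slack_sum_nonneg[of x] by linarith
    then have "penalty * 1 \<le> penalty * slack_sum x"
      using mag_nonneg by (intro mult_left_mono) (auto simp: penalty_def sum_nonneg)
    moreover have "penalty = 1 + 2 * (\<Sum>q<n * T. mag q)" by (simp add: penalty_def sum_distrib_left)
    ultimately show False
      using le[OF y] orig_cost_bound[OF box] orig_cost_bound[OF embed_in_box[OF y]] unfolding obj_split by linarith
  qed
  show "is_optimal feasible f (project x)" if z: "slack_sum x = 0"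
  proof -
    have slack: "x (i * T + (t + \<rho>)) = 0" if "i < n" "\<rho> < R" for i \<rho>
      using z that by (simp add: slack_sum_eq_0_iff)
    have rows: "row \<rho> (brick x i) = (\<Sum>j<t. A $$ (\<rho>, j) * project x $ (i * t + j))" if "i < n" "\<rho> < R" for i \<rho>
      unfolding row_ext[OF that(2)] using that by (simp add: slack project_index)
    have "(\<Sum>j<t. A $$ (r + \<rho>, j) * project x $ (i * t + j)) = b $ (r + i * s + \<rho>)" if "i < n" "\<rho> < s" for i \<rho>
    proof -
      have "row (r + \<rho>) (brick (\<lambda>q. x q - x0 q) i) = 0"
        using x that unfolding lattice_def low_lattice_def by force
      then have "row (r + \<rho>) (brick x i) - row (r + \<rho>) (brick x0 i) = 0"
        unfolding brick_diff row_diff .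
      then show ?thesis using that by (simp add: rows row_x0 rhs_def)
    qed
    moreover have "(\<Sum>i<n. \<Sum>j<t. A $$ (\<rho>, j) * project x $ (i * t + j)) = b $ \<rho>" if "\<rho> < r" for \<rho>
    proof -
      have "(\<Sum>i<n. row \<rho> (brick (\<lambda>q. x q - x0 q) i)) = 0"
        using x that unfolding lattice_def by blast
      then have "(\<Sum>i<n. row \<rho> (brick x i)) - (\<Sum>i<n. row \<rho> (brick x0 i)) = 0"
        unfolding brick_diff row_diff sum_subtractf .
      then show ?thesis using that by (simp add: rows row_x0 sum_rhs)
    qed
    moreover have "l $ k \<le> project x $ k \<and> project x $ k \<le> u $ k" if k: "k < n * t" for k
    proof -
      have "k div t < n" "k mod t < t" using k t_pos by (auto simp: less_mult_imp_div_less)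
      from in_box_orig[OF box this] show ?thesis using k by (simp add: project_def)
    qed
    ultimately have "project x \<in> feasible"
      unfolding feasible_set_iff[OF t_pos b] by (auto simp: project_def)
    moreover have "f (map_vec real_of_int (project x)) \<le> f (map_vec real_of_int y)" if y: "y \<in> feasible" for y
    proof -
      have "real_of_int (orig_cost x) \<le> real_of_int (orig_cost (embed y))"
        using le[OF y] z by (simp add: obj_split)
      moreover have "y \<in> carrier_vec (n * t)" using y by (simp add: feasible_set_def)
      ultimately show ?thesis
        unfolding orig_cost_project[OF box] orig_cost_project[OF embed_in_box[OF y]] by (simp add: project_embed)
    qed
    ultimately show ?thesis by (simp add: is_optimal_def)
  qed
qed

end

section \<open>Execution of the program on one input\<close>

context nfold_instance
begin

definition agree :: "store \<Rightarrow> bool" where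
  "agree \<sigma> \<longleftrightarrow> (\<forall>Y\<in>{''n'', ''b'', ''l'', ''u'', ''m'', ''c'', ''w'', ''a''}. \<sigma> Y = \<sigma>0 Y)"

lemma agree_upd [simp]:
  "Y \<notin> {''n'', ''b'', ''l'', ''u'', ''m'', ''c'', ''w'', ''a''} \<Longrightarrow> agree (\<sigma>(Y := h)) \<longleftrightarrow> agree \<sigma>"
  by (auto simp: agree_def)

definition ready :: "store \<Rightarrow> bool" where
  "ready \<sigma> \<longleftrightarrow> agree \<sigma> \<and> \<sigma> ''M'' 0 = penalty \<and>
     (\<forall>q<n * T. \<sigma> ''L'' (int q) = lo q \<and> \<sigma> ''U'' (int q) = up q)"

lemma ready_cong:
  assumes "ready \<sigma>" and "\<And>Y. Y \<in> {''n'', ''b'', ''l'', ''u'', ''m'', ''c'', ''w'', ''a'', ''M'', ''L'', ''U''} \<Longrightarrow> \<sigma>' Y = \<sigma> Y"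
  shows "ready \<sigma>'"
  using assms by (simp add: ready_def agree_def)

lemma aval_orig: "\<sigma> ''i'' 0 = int i \<Longrightarrow> aval (orig j) \<sigma> = int (i * t + j)"
  by (simp add: orig_def)

lemma aval_sub_index: "\<sigma> ''i'' 0 = int i \<Longrightarrow> aval (sub_index w j k) \<sigma> = int ((i * t + j) * w + k)"
  by (simp add: sub_index_def aval_orig)

lemma orig_index:
  assumes "i < n" "j < t"
  shows "i * t + j < n * t" "(i * t + j) div t = i" "(i * t + j) mod t = j"
  using assms by (auto simp: brick_index)

lemma den_piece_code:
  assumes ij: "i < n" "j < t" and kp: "k < p" and a: "agree \<sigma>" "\<sigma> ''i'' 0 = int i"
    and z: "\<sigma> ''y'' 0 = z" "l $ (i * t + j) \<le> z" "z \<le> u $ (i * t + j)"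
  shows "den (piece_code j k) \<sigma> =
    (if k < length (pieces (F i j)) \<and> endpoints (F i j) ! k \<le> z \<and> z \<le> endpoints (F i j) ! Suc k
     then \<sigma>(''v'' := (\<sigma> ''v'')(0 := cost (i * T + j) z)) else \<sigma>)"
proof -
  note o = orig_index[OF ij]
  have cells: "\<sigma> ''m'' = \<sigma>0 ''m''" "\<sigma> ''c'' = \<sigma>0 ''c''" "\<sigma> ''w'' = \<sigma>0 ''w''" "\<sigma> ''a'' = \<sigma>0 ''a''"
    using a(1) by (auto simp: agree_def)
  have m: "aval (Read ''m'' (orig j)) \<sigma> = int (length (pieces (F i j)))"
    using input_cells(5)[OF o(1)] by (simp add: aval_orig[of \<sigma> i, OF a(2)] cells o ij del: of_nat_add of_nat_mult)
  have len: "length (endpoints (F i j)) = Suc (length (pieces (F i j)))"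
    using g_pieces[OF ij] by (simp add: piecewise_affine_def)
  have c: "aval (Read ''c'' (sub_index (p + 1) j k')) \<sigma> = endpoints (F i j) ! k'"
    if "k' \<le> length (pieces (F i j))" "k' < p + 1" for k'
    using endpoint_cells[OF o(1) that(2)] that(1) len
    by (simp add: aval_sub_index[of \<sigma> i, OF a(2)] cells o ij del: of_nat_add of_nat_mult add_Suc_right mult_Suc_right)
  show ?thesis
  proof (cases "k < length (pieces (F i j))")
    case True
    have "aval (Read ''w'' (sub_index p j k)) \<sigma> * z + aval (Read ''a'' (sub_index p j k)) \<sigma> =
        fst (pieces (F i j) ! k) * z + snd (pieces (F i j) ! k)"
      using input_cells(6,7)[OF o(1) kp] True
      by (simp add: aval_sub_index[of \<sigma> i, OF a(2)] cells o ij slope_def offset_def del: of_nat_add of_nat_mult)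
    moreover have "fst (pieces (F i j) ! k) * z + snd (pieces (F i j) ! k) = cost (i * T + j) z"
      if e: "endpoints (F i j) ! k \<le> z" "z \<le> endpoints (F i j) ! Suc k"
    proof -
      have "real_of_int (cost (i * T + j) z) = real_of_int (fst (pieces (F i j) ! k) * z + snd (pieces (F i j) ! k))"
        using real_cost[OF ij z(2,3)] piece_value[OF ij True _ e] z(2,3) by simp
      then show ?thesis by (simp only: of_int_eq_iff)
    qed
    ultimately show ?thesis
      using True m c[of k] c[of "Suc k"] kp z(1) unfolding piece_code_def by auto
  next
    case False
    then show ?thesis using m unfolding piece_code_def by simp
  qed
qed

lemma den_cost_code:
  assumes ij: "i < n" "j < T" and a: "\<sigma> ''i'' 0 = int i" "ready \<sigma>"
    and z: "lo (i * T + j) \<le> \<sigma> ''y'' 0" "\<sigma> ''y'' 0 \<le> up (i * T + j)"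
  shows "den (cost_code j) \<sigma> ''v'' 0 = cost (i * T + j) (\<sigma> ''y'' 0)"
proof (cases "j < t")
  case True
  let ?z = "\<sigma> ''y'' 0"
  have lu: "l $ (i * t + j) \<le> ?z" "?z \<le> u $ (i * t + j)"
    using z True brick_div_mod[OF ij(2)] by (simp_all add: lo_def up_def)
  define match where "match k \<longleftrightarrow> k < length (pieces (F i j)) \<and> endpoints (F i j) ! k \<le> ?z \<and>
    ?z \<le> endpoints (F i j) ! Suc k" for k
  \<comment> \<open>Nothing is claimed about \<open>v\<close> until a matching piece has been
    passed; later matches write the same value again.\<close>
  let ?I = "\<lambda>k \<sigma>'. (\<forall>Y. Y \<noteq> ''v'' \<longrightarrow> \<sigma>' Y = \<sigma> Y) \<and> ((\<exists>k'<k. match k') \<longrightarrow> \<sigma>' ''v'' 0 = cost (i * T + j) ?z)"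
  have "?I p (den (seqs (map (piece_code j) [0..<p])) \<sigma>)"
  proof (rule den_seqs_upt_inv[where I = ?I])
    fix k \<sigma>' assume k: "k < p" and I: "?I k \<sigma>'"
    then have "agree \<sigma>'" using a(2) by (auto simp: ready_def agree_def)
    moreover have "\<sigma>' ''i'' 0 = int i" "\<sigma>' ''y'' 0 = ?z" using I a(1) by auto
    ultimately have "den (piece_code j k) \<sigma>' = (if match k then \<sigma>'(''v'' := (\<sigma>' ''v'')(0 := cost (i * T + j) ?z)) else \<sigma>')"
      unfolding match_def by (intro den_piece_code[OF ij(1) True k _ _ _ lu])
    then show "?I (Suc k) (den (piece_code j k) \<sigma>')" using I by (auto simp: less_Suc_eq)
  qed simp
  moreover obtain k where "match k" using piece_exists[OF ij(1) True lu] by (auto simp: match_def)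
  moreover have "k < p" if "match k" for k
    using that g_pieces[OF ij(1) True] by (simp add: match_def piecewise_affine_def)
  ultimately show ?thesis using True by (auto simp: cost_code_def)
next
  case False
  then show ?thesis using a(2) brick_div_mod[OF ij(2), of i] by (simp add: cost_code_def cost_def ready_def)
qed

sublocale dp_instance T r R "ext_mat t A" K "entry_bound t R A" cost_code n lo up x0 cost ready
proof
  fix q assume "q < n * T"
  then show "discretely_convex (lo q) (up q) (cost q)" by (rule discretely_convex_cost)
next
  fix \<sigma> \<sigma>' :: store
  assume "ready \<sigma>" and "\<And>Y. Y \<notin> {''E'', ''V'', ''P'', ''F'', ''W'', ''Q'', ''y'', ''v'', ''X'', ''i'', ''k'', ''h''} \<Longrightarrow> \<sigma>' Y = \<sigma> Y"
  note r = this
  show "ready \<sigma>'"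
  proof (rule ready_cong[OF r(1)])
    fix Y assume "Y \<in> {''n'', ''b'', ''l'', ''u'', ''m'', ''c'', ''w'', ''a'', ''M'', ''L'', ''U''}"
    then have "Y \<notin> {''E'', ''V'', ''P'', ''F'', ''W'', ''Q'', ''y'', ''v'', ''X'', ''i'', ''k'', ''h''}"
      by (elim insertE emptyE) simp_all
    then show "\<sigma>' Y = \<sigma> Y" by (rule r(2))
  qed
next
  fix \<sigma> q assume "ready \<sigma>" "q < n * T"
  then show "\<sigma> ''L'' (int q) = lo q \<and> \<sigma> ''U'' (int q) = up q" by (simp add: ready_def)
qed (rule den_cost_code)

lemma aval_rhs_exp:
  assumes "i < n" "\<rho> < R" "agree \<sigma>" "\<sigma> ''i'' 0 = int i"
  shows "aval (rhs_exp \<rho>) \<sigma> = rhs i \<rho>"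
proof -
  have bb: "\<sigma> ''b'' = \<sigma>0 ''b''" using assms(3) by (simp add: agree_def)
  show ?thesis
  proof (cases "\<rho> < r")
    case True
    show ?thesis
    proof (cases "i = 0")
      case i: False
      have "1 * r \<le> i * r" using i by (intro mult_le_mono1) simp
      then have "\<rho> < i * r" using True by linarith
      then have "int \<rho> < int i * int r" by (simp flip: of_nat_mult)
      then have "int \<rho> - int i * int r < 0" by simp
      then show ?thesis using True i by (simp add: rhs_exp_def rhs_def assms(4) bb input_cells(4))
    next
      case i: True
      have "int \<rho> < int (r + n * s)" unfolding of_nat_less_iff using True by simp
      then show ?thesis using True i assms(4) by (simp add: rhs_exp_def rhs_def bb input_cells(4))
    qed
  next
    case False
    have "i * s + (\<rho> - r) < n * s" using assms(1,2) False by (intro brick_index) auto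
    then have "\<rho> + i * s < r + n * s" using False by linarith
    moreover have "r + i * s + (\<rho> - r) = \<rho> + i * s" using False by simp
    ultimately show ?thesis using False
      by (simp add: rhs_exp_def rhs_def assms(4) bb input_cells(4) add.commute[of \<rho>] flip: of_nat_add of_nat_mult)
  qed
qed

lemma aval_l_u:
  assumes "i < n" "j < t" "agree \<sigma>" "\<sigma> ''i'' 0 = int i"
  shows "aval (Read ''l'' (orig j)) \<sigma> = l $ (i * t + j)" "aval (Read ''u'' (orig j)) \<sigma> = u $ (i * t + j)"
proof -
  have "\<sigma> ''l'' = \<sigma>0 ''l''" "\<sigma> ''u'' = \<sigma>0 ''u''" using assms(3) by (auto simp: agree_def)
  then show "aval (Read ''l'' (orig j)) \<sigma> = l $ (i * t + j)" "aval (Read ''u'' (orig j)) \<sigma> = u $ (i * t + j)"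
    using orig_index(1)[OF assms(1,2)]
    by (simp_all add: aval_orig[of \<sigma> i, OF assms(4)] input_cells(2,3) del: of_nat_add of_nat_mult)
qed

lemma aval_exps:
  assumes ij: "i < n" "j < T" and a: "agree \<sigma>" "\<sigma> ''i'' 0 = int i"
  shows "aval (x0_exp j) \<sigma> = x0 (i * T + j)" "aval (lo_exp j) \<sigma> = lo (i * T + j)"
    "aval (up_exp j) \<sigma> = up (i * T + j)" "aval (mag_exp j) \<sigma> = mag (i * T + j)"
proof -
  note c = brick_div_mod[OF ij(2), of i]
  note lu = aval_l_u[OF ij(1) _ a]
  have cells: "\<sigma> ''w'' = \<sigma>0 ''w''" "\<sigma> ''a'' = \<sigma>0 ''a''" using a(1) by (auto simp: agree_def)
  show x: "aval (x0_exp j) \<sigma> = x0 (i * T + j)"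
  proof (cases "j < t")
    case True
    then show ?thesis using lu by (simp add: x0_exp_def x0_def Let_def c ij)
  next
    case False
    then have "aval (rhs_exp (j - t)) \<sigma> = rhs i (j - t)" using ij a by (intro aval_rhs_exp) auto
    moreover have "aval (sum_exp (map (\<lambda>j'. Mul (Const (A $$ (j - t, j'))) (Read ''l'' (orig j'))) [0..<t])) \<sigma> =
        (\<Sum>j'<t. A $$ (j - t, j') * l $ (i * t + j'))"
      unfolding aval_sum_exp_upt by (intro sum.cong) (use lu in auto)
    ultimately show ?thesis using False by (simp add: x0_exp_def x0_def Let_def c ij)
  qed
  show "aval (lo_exp j) \<sigma> = lo (i * T + j)" "aval (up_exp j) \<sigma> = up (i * T + j)"
    using lu x by (simp_all add: lo_exp_def up_exp_def lo_def up_def c ij)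
  show "aval (mag_exp j) \<sigma> = mag (i * T + j)"
    using lu by (simp add: mag_exp_def mag_def c ij sq_def Let_def aval_sum_exp_upt slope_def offset_def
        aval_sub_index[of \<sigma> i, OF a(2)] cells del: of_nat_add of_nat_mult)
qed

definition initialised :: "nat \<Rightarrow> store \<Rightarrow> bool" where
  "initialised q \<sigma> \<longleftrightarrow> agree \<sigma> \<and>
     (\<forall>q'<q. \<sigma> ''X'' (int q') = x0 q' \<and> \<sigma> ''L'' (int q') = lo q' \<and> \<sigma> ''U'' (int q') = up q') \<and>
     \<sigma> ''S'' 0 = 1 + (\<Sum>q'<q. up q' - lo q') \<and> \<sigma> ''M'' 0 = 1 + (\<Sum>q'<q. 2 * mag q') \<and>
     (\<sigma> ''B'' 0 = 0 \<longleftrightarrow> (\<forall>q'<q. lo q' \<le> up q')) \<and> \<sigma> ''Z'' 0 = 0 \<and> \<sigma> ''feasible'' 0 = 0"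

lemma den_init_code:
  assumes ij: "i < n" "j < T" and a: "\<sigma> ''i'' 0 = int i" and I: "initialised (i * T + j) \<sigma>"
  shows "initialised (Suc (i * T + j)) (den (init_code j) \<sigma>) \<and> den (init_code j) \<sigma> ''i'' 0 = int i"
proof -
  have g: "agree \<sigma>" using I by (simp add: initialised_def)
  note e = aval_exps[OF ij]
  have c: "aval (coord j) \<sigma>' = int (i * T + j)" if "\<sigma>' ''i'' 0 = int i" for \<sigma>'
    by (rule aval_coord[of \<sigma>' i, OF that])
  define q where "q = i * T + j"
  show ?thesis
    using I unfolding q_def[symmetric]
    by (auto simp: init_code_def initialised_def e c g a q_def[symmetric] less_Suc_eq)
qed

definition finalised :: "(nat \<Rightarrow> int) \<Rightarrow> nat \<Rightarrow> store \<Rightarrow> bool" where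
  "finalised x q \<sigma> \<longleftrightarrow> (\<forall>q'<n * T. \<sigma> ''X'' (int q') = x q') \<and>
     (\<forall>q'<q. q' mod T < t \<longrightarrow> \<sigma> ''x'' (int (q' div T * t + q' mod T)) = x q') \<and>
     \<sigma> ''Z'' 0 = (\<Sum>q'<q. if q' mod T < t then 0 else x q' * x q') \<and> \<sigma> ''feasible'' 0 = 0"

lemma den_final_code:
  assumes ij: "i < n" "j < T" and a: "\<sigma> ''i'' 0 = int i" and I: "finalised x (i * T + j) \<sigma>"
  shows "finalised x (Suc (i * T + j)) (den (final_code j) \<sigma>) \<and> den (final_code j) \<sigma> ''i'' 0 = int i"
proof -
  define q where "q = i * T + j"
  have q: "q < n * T" "q div T = i" "q mod T = j"
    using brick_index[OF ij] brick_div_mod[OF ij(2)] by (simp_all add: q_def)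
  have c: "aval (coord j) \<sigma> = int q" using aval_coord[of \<sigma> i, OF a] by (simp add: q_def)
  have X: "\<sigma> ''X'' (int q) = x q" using I q(1) by (simp add: finalised_def)
  show ?thesis
  proof (cases "j < t")
    case True
    \<comment> \<open>Different original coordinates go to different cells of \<open>x\<close>, so
      entries written before survive.\<close>
    have ne: "q' div T * t + q' mod T \<noteq> i * t + j" if "q' < q" "q' mod T < t" for q'
    proof
      assume e: "q' div T * t + q' mod T = i * t + j"
      have "q' div T = i" "q' mod T = j"
        using arg_cong[OF e, of "\<lambda>z. z div t"] arg_cong[OF e, of "\<lambda>z. z mod t"] that(2) True by simp_all
      then have "q' = q" using div_mult_mod_eq[of q' T] q_def by metis
      then show False using that(1) by simp
    qed
    then show ?thesis using I True X unfolding q_def[symmetric]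
      by (auto simp: final_code_def finalised_def aval_orig[of \<sigma> i, OF a] c a q less_Suc_eq simp del: of_nat_add of_nat_mult)
  next
    case False
    then show ?thesis using I X unfolding q_def[symmetric]
      by (auto simp: final_code_def finalised_def c a q less_Suc_eq)
  qed
qed

lemma triple_init:
  "triple (\<lambda>\<sigma>. initialised 0 \<sigma> \<and> \<sigma> ''n'' 0 = int n) (flat_loop T init_code) (Suc n * flat_cost T init_code)
    (\<lambda>\<sigma>. initialised (n * T) \<sigma> \<and> \<sigma> ''n'' 0 = int n)"
proof (rule triple_flat_loop)
  fix i j \<sigma>
  assume a: "i < n" "j < T" "\<sigma> ''i'' 0 = int i" "\<sigma> ''n'' 0 = int n" "initialised (i * T + j) \<sigma>"
  have "den (init_code j) \<sigma> ''n'' = \<sigma> ''n''" by (rule den_writes) (simp add: init_code_def)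
  then show "initialised (Suc (i * T + j)) (den (init_code j) \<sigma>) \<and> den (init_code j) \<sigma> ''i'' 0 = int i \<and>
      den (init_code j) \<sigma> ''n'' 0 = int n"
    using den_init_code[OF a(1,2,3,5)] a(4) by simp
next
  fix q \<sigma> and h :: "int \<Rightarrow> int" assume "initialised q \<sigma>"
  then show "initialised q (\<sigma>(''i'' := h))" by (simp add: initialised_def)
qed (simp add: init_code_def)

lemma triple_final:
  "triple (\<lambda>\<sigma>. finalised x 0 \<sigma> \<and> \<sigma> ''n'' 0 = int n) (flat_loop T final_code) (Suc n * flat_cost T final_code)
    (\<lambda>\<sigma>. finalised x (n * T) \<sigma> \<and> \<sigma> ''n'' 0 = int n)"
proof (rule triple_flat_loop)
  fix i j \<sigma>
  assume a: "i < n" "j < T" "\<sigma> ''i'' 0 = int i" "\<sigma> ''n'' 0 = int n" "finalised x (i * T + j) \<sigma>"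
  have "den (final_code j) \<sigma> ''n'' = \<sigma> ''n''" by (rule den_writes) (simp add: final_code_def)
  then show "finalised x (Suc (i * T + j)) (den (final_code j) \<sigma>) \<and> den (final_code j) \<sigma> ''i'' 0 = int i \<and>
      den (final_code j) \<sigma> ''n'' 0 = int n"
    using den_final_code[OF a(1,2,3,5)] a(4) by simp
qed (auto simp: final_code_def finalised_def)

lemma x0_in_box:
  assumes "\<forall>q<n * T. lo q \<le> up q"
  shows "in_box (n * T) lo up x0"
  unfolding in_box_def
proof (intro allI impI)
  fix q assume q: "q < n * T"
  show "lo q \<le> x0 q \<and> x0 q \<le> up q"
  proof (cases "q mod T < t")
    case True
    then have "x0 q = lo q" by (simp add: x0_def lo_def Let_def)
    then show ?thesis using assms q by simp
  next
    case False
    then show ?thesis using abs_le_square[of "x0 q"] by (simp add: lo_def up_def abs_le_iff)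
  qed
qed

lemma infeasible_if_empty_box:
  assumes "\<not> (\<forall>q<n * T. lo q \<le> up q)"
  shows "feasible = {}"
proof (rule ccontr)
  assume "feasible \<noteq> {}"
  then obtain y where "y \<in> feasible" by blast
  then have "in_box (n * T) lo up (embed y)" by (rule embed_in_box)
  then show False using assms unfolding in_box_def by (meson order.trans)
qed

text \<open>A sum in place of a maximum: it exceeds every single width if none is negative, and
  costs the exponent only a term of order \<open>L\<close>.\<close>

definition span :: int where
  "span = 1 + (\<Sum>q<n * T. up q - lo q)"

lemma span_greater:
  assumes "\<forall>q<n * T. lo q \<le> up q" "q < n * T"
  shows "up q - lo q < span"
proof -
  have "up q - lo q \<le> (\<Sum>q<n * T. up q - lo q)"
    using assms by (intro member_le_sum[where f = "\<lambda>q. up q - lo q"]) auto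
  then show ?thesis by (simp add: span_def)
qed

text \<open>\<open>progress\<close> hides its point, so the result of the read-out is assumed for
  every \<open>x\<close> that agrees with the array on the first \<open>n * T\<close> cells.\<close>

lemma progress_solves:
  assumes P: "progress {} 1 \<sigma>"
    and F: "\<And>x. (\<forall>q<n * T. \<sigma> ''X'' (int q) = x q) \<Longrightarrow> finalised x (n * T) \<sigma>'"
  shows "solves (n * t) (feasible) f
    (den (Cond (Equal (cell ''Z'') (Const 0)) (put ''feasible'' (Const 1)) Skip) \<sigma>')"
proof -
  obtain x where x: "\<forall>q<n * T. \<sigma> ''X'' (int q) = x q" "lattice_optimal n {} lo up cost 1 x"
    "(\<lambda>q. x q - x0 q) \<in> lattice n {}"
    using P by (auto simp: progress_def)
  have fin: "finalised x (n * T) \<sigma>'" using F x(1) .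
  have Z: "\<sigma>' ''Z'' 0 = slack_sum x" using fin by (simp add: finalised_def slack_sum_def)
  show ?thesis
  proof (cases "slack_sum x = 0")
    case False
    then show ?thesis using final_correct(1)[OF x(2,3)] Z fin by (simp add: solves_def finalised_def)
  next
    case True
    let ?\<sigma> = "\<sigma>'(''feasible'' := (\<sigma>' ''feasible'')(0 := 1))"
    have "output_vec (n * t) ?\<sigma> = project x"
    proof (rule eq_vecI)
      fix k assume "k < dim_vec (project x)"
      then have k: "k < n * t" by (simp add: project_def)
      define i j where "i = k div t" and "j = k mod t"
      have ij: "i < n" "j < t" "i * t + j = k" using k t_pos by (auto simp: i_def j_def less_mult_imp_div_less)
      then have jT: "j < T" by simp
      have "\<sigma>' ''x'' (int k) = x (i * T + j)"
        using fin brick_index[OF ij(1) jT] brick_div_mod[OF jT, of i] ij(2,3) unfolding finalised_def by metis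
      then show "output_vec (n * t) ?\<sigma> $ k = project x $ k" using k by (simp add: output_vec_def project_def i_def j_def)
    qed (simp add: output_vec_def project_def)
    then show ?thesis using final_correct(2)[OF x(2,3) True] True Z by (simp add: solves_def)
  qed
qed

lemma exec_program:
  assumes e: "span \<le> 2 ^ e"
  shows "\<exists>\<tau> \<sigma>. exec program \<sigma>0 \<tau> \<sigma> \<and>
    \<tau> \<le> Suc n * flat_cost T init_code + (e + 2) * n ^ 2 * scaling_cost + Suc n * flat_cost T final_code + 2 \<and>
    solves (n * t) (feasible) f \<sigma>"
proof -
  let ?solved = "solves (n * t) (feasible) f"
  let ?I = "\<lambda>\<sigma>. initialised (n * T) \<sigma> \<and> \<sigma> ''n'' 0 = int n"
  let ?Z = "\<lambda>\<sigma>. \<sigma> ''Z'' 0 = 0 \<and> \<sigma> ''feasible'' 0 = 0 \<and> \<sigma> ''n'' 0 = int n"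
  let ?X = "\<lambda>\<sigma>. (\<forall>q<n * T. \<sigma> ''X'' (int q) = x0 q) \<and> ready \<sigma> \<and> \<sigma> ''S'' 0 = span \<and> \<sigma> ''n'' 0 = int n"
  let ?last = "Cond (Equal (cell ''Z'') (Const 0)) (put ''feasible'' (Const 1)) Skip"
  let ?main = "Seq scaling (Seq (flat_loop T final_code) ?last)"
  let ?t = "(e + 2) * n ^ 2 * scaling_cost + Suc n * flat_cost T final_code + 2"
  have main: "triple ?I
    (Cond (Equal (cell ''B'') (Const 0)) ?main Skip) ?t ?solved"
  proof (cases "\<forall>q<n * T. lo q \<le> up q")
    case False
    have "triple ?I Skip 0 ?solved"
      by (intro triple_den) (auto simp: solves_def initialised_def infeasible_if_empty_box[OF False])
    then have "triple ?I
      (Cond (Equal (cell ''B'') (Const 0)) ?main Skip) (bcost (Equal (cell ''B'') (Const 0)) + 0) ?solved"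
      by (rule triple_CondFalse) (use False in \<open>auto simp: initialised_def\<close>)
    then show ?thesis by (rule triple_conseq) auto
  next
    case True
    have 1: "triple (\<lambda>\<sigma>. ?X \<sigma> \<and>
        ?Z \<sigma>) scaling ((e + 2) * n ^ 2 * scaling_cost)
        (\<lambda>\<sigma>. progress {} 1 \<sigma> \<and> ?Z \<sigma>)"
    proof (rule triple_frame[OF triple_scaling[OF n_pos x0_in_box[OF True] span_greater[OF True] e]])
      fix \<sigma> \<sigma>' assume a: "?Z \<sigma>"
        and w: "\<And>Y. Y \<notin> writes scaling \<Longrightarrow> \<sigma>' Y = \<sigma> Y"
      have "Y \<notin> writes scaling" if "Y \<in> {''Z'', ''feasible'', ''n''}" for Y
        using that by (auto dest!: subsetD[OF writes_scaling])
      then show "?Z \<sigma>'" using a w by simp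
    qed
    have 2: "triple (\<lambda>\<sigma>. progress {} 1 \<sigma> \<and> ?Z \<sigma>)
        (Seq (flat_loop T final_code) ?last) (Suc n * flat_cost T final_code + 1) ?solved"
      unfolding triple_def
    proof (intro allI impI)
      fix \<sigma> assume a: "progress {} 1 \<sigma> \<and> ?Z \<sigma>"
      obtain x where x: "\<forall>q<n * T. \<sigma> ''X'' (int q) = x q" using a by (auto simp: progress_def)
      then have "finalised x 0 \<sigma>" using a by (simp add: finalised_def)
      then obtain \<tau> \<sigma>' where 3: "exec (flat_loop T final_code) \<sigma> \<tau> \<sigma>'" "\<tau> \<le> Suc n * flat_cost T final_code"
        "finalised x (n * T) \<sigma>'"
        using triple_final[of x] a unfolding triple_def by blast
      have "finalised x' (n * T) \<sigma>'" if x': "\<forall>q<n * T. \<sigma> ''X'' (int q) = x' q" for x'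
      proof -
        have "x' q = x q" if "q < n * T" for q using x x' that by simp
        moreover have "(\<Sum>q<n * T. if q mod T < t then 0 else x' q * x' q) =
            (\<Sum>q<n * T. if q mod T < t then 0 else x q * x q)"
          using calculation by (intro sum.cong) auto
        ultimately show ?thesis using 3(3) by (simp add: finalised_def)
      qed
      then have "?solved (den ?last \<sigma>')" using progress_solves a by blast
      moreover obtain \<tau>' where "\<tau>' \<le> max_cost ?last" "exec ?last \<sigma>' \<tau>' (den ?last \<sigma>')"
        using exec_den[of ?last \<sigma>'] by auto
      ultimately show "\<exists>\<tau> \<sigma>'. exec (Seq (flat_loop T final_code) ?last) \<sigma> \<tau> \<sigma>' \<and>
          \<tau> \<le> Suc n * flat_cost T final_code + 1 \<and> ?solved \<sigma>'"
        using exec_Seq[OF 3(1)] 3(2) by (intro exI[of _ "\<tau> + \<tau>'"] exI[of _ "den ?last \<sigma>'"]) auto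
    qed
    have "triple ?I
      (Cond (Equal (cell ''B'') (Const 0)) ?main Skip)
      (bcost (Equal (cell ''B'') (Const 0)) + ((e + 2) * n ^ 2 * scaling_cost + (Suc n * flat_cost T final_code + 1))) ?solved"
    proof (rule triple_CondTrue[OF triple_conseq[OF triple_Seq[OF 1 2]]])
      fix \<sigma> assume "?I \<sigma>"
      then show "?X \<sigma> \<and>
        ?Z \<sigma>"
        by (simp add: initialised_def ready_def span_def penalty_def)
    qed (use True in \<open>auto simp: initialised_def\<close>)
    then show ?thesis by (rule triple_conseq) auto
  qed
  let ?P = "\<lambda>\<sigma>. agree \<sigma> \<and> \<sigma> ''B'' 0 = 0 \<and> \<sigma> ''Z'' 0 = 0 \<and> \<sigma> ''feasible'' 0 = 0 \<and> \<sigma> ''n'' 0 = int n"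
  have s: "triple ?P (put ''S'' (Const 1)) 0 (\<lambda>\<sigma>. ?P \<sigma> \<and> \<sigma> ''S'' 0 = 1)"
    by (intro triple_den) auto
  have m: "triple (\<lambda>\<sigma>. ?P \<sigma> \<and> \<sigma> ''S'' 0 = 1) (put ''M'' (Const 1)) 0 (\<lambda>\<sigma>. initialised 0 \<sigma> \<and> \<sigma> ''n'' 0 = int n)"
    by (intro triple_den) (auto simp: initialised_def)
  have "triple ?P program (0 + (0 + (Suc n * flat_cost T init_code + ?t))) ?solved"
    unfolding program_def by (rule triple_Seq[OF s triple_Seq[OF m triple_Seq[OF triple_init main]]])
  moreover have "?P \<sigma>0" by (simp add: agree_def other_cells_zero input_cells(1))
  ultimately show ?thesis unfolding triple_def by (auto simp: add.assoc)
qed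

end

section \<open>Running time\<close>

context nfold_instance
begin

abbreviation L :: nat where "L \<equiv> input_length t n F b l u"

lemma abs_less_binary_length: "\<bar>z\<bar> < 2 ^ binary_length z"
proof -
  have "nat \<bar>z\<bar> < 2 ^ floorlog 2 (nat \<bar>z\<bar>)" by (rule floorlog_leD[of 2]) auto
  also have "\<dots> \<le> 2 ^ binary_length z" unfolding binary_length_def by (intro power_increasing) auto
  finally have "int (nat \<bar>z\<bar>) < int (2 ^ binary_length z)" by (simp only: of_nat_less_iff)
  then show ?thesis by simp
qed

lemma abs_le_of_binary_length: "binary_length z \<le> m \<Longrightarrow> \<bar>z\<bar> \<le> 2 ^ m"
  using abs_less_binary_length[of z] power_increasing[of "binary_length z" m "2::int"] by linarith

lemma binary_length_vec_ge: "k < dim_vec v \<Longrightarrow> binary_length (v $ k) \<le> binary_length_vec v"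
  unfolding binary_length_vec_def by (intro member_le_sum) auto

lemma abs_entries_le:
  "k < n * t \<Longrightarrow> \<bar>l $ k\<bar> \<le> 2 ^ L" "k < n * t \<Longrightarrow> \<bar>u $ k\<bar> \<le> 2 ^ L" "k < r + n * s \<Longrightarrow> \<bar>b $ k\<bar> \<le> 2 ^ L"
  using binary_length_vec_ge[of k l] binary_length_vec_ge[of k u] binary_length_vec_ge[of k b] l u b
  by (auto intro!: abs_le_of_binary_length simp: input_length_def)

text \<open>Each of the \<open>n * t\<close> entries of \<open>l\<close> has at least a sign bit.
  This later bounds the factor \<open>n\<close> in \<open>span\<close> by
  \<open>2 ^ L\<close>.\<close>

lemma n_le_L: "n \<le> L"
proof -
  have "n * t * 1 \<le> (\<Sum>k<n * t. binary_length (l $ k))"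
    using sum_bounded_below[of "{..<n * t}" 1 "\<lambda>k. binary_length (l $ k)"] by (simp add: binary_length_def)
  also have "\<dots> \<le> L" using l by (simp add: input_length_def binary_length_vec_def)
  finally show ?thesis using t_pos by (metis dual_order.trans mult.right_neutral mult_le_mono2 Suc_leI One_nat_def)
qed

text \<open>From the residual of a row: the right-hand side contributes at most
  \<open>2 ^ L\<close>, and each of the \<open>t\<close> products at most
  \<open>entry_bound t R A * 2 ^ L\<close>.\<close>

definition alpha :: int where
  "alpha = 1 + int t * entry_bound t R A"

lemma alpha_pos: "1 \<le> alpha"
  using entry_bound_pos[of t R A] by (simp add: alpha_def)

lemma abs_x0_le:
  assumes "q < n * T"
  shows "\<bar>x0 q\<bar> \<le> alpha * 2 ^ L"
proof -
  define i j where "i = q div T" and "j = q mod T"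
  have ij: "i < n" "j < T" using assms t_pos by (auto simp: i_def j_def less_mult_imp_div_less)
  note a = alpha_pos
  show ?thesis
  proof (cases "j < t")
    case True
    then have "\<bar>x0 q\<bar> \<le> 2 ^ L"
      using abs_entries_le(1)[OF brick_index[OF ij(1) True]] by (simp add: x0_def Let_def i_def j_def)
    also have "\<dots> \<le> alpha * 2 ^ L" using a by (simp add: mult_le_cancel_right1)
    finally show ?thesis .
  next
    case False
    define \<rho> where "\<rho> = j - t"
    have \<rho>: "\<rho> < R" using False ij(2) by (auto simp: \<rho>_def)
    have x: "x0 q = rhs i \<rho> - (\<Sum>j'<t. A $$ (\<rho>, j') * l $ (i * t + j'))"
      using False by (simp add: x0_def Let_def i_def j_def \<rho>_def)
    have "\<bar>rhs i \<rho>\<bar> \<le> 2 ^ L"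
    proof (cases "\<rho> < r")
      case True
      then show ?thesis using abs_entries_le(3)[of \<rho>] by (simp add: rhs_def)
    next
      case False
      then have "i * s + (\<rho> - r) < n * s" using \<rho> ij(1) by (intro brick_index) auto
      then show ?thesis using False abs_entries_le(3)[of "r + i * s + (\<rho> - r)"] by (simp add: rhs_def)
    qed
    moreover have "\<bar>\<Sum>j'<t. A $$ (\<rho>, j') * l $ (i * t + j')\<bar> \<le> (\<Sum>j'<t. entry_bound t R A * 2 ^ L)"
    proof (rule order_trans[OF sum_abs], rule sum_mono)
      fix j' assume "j' \<in> {..<t}"
      then have j': "j' < t" by simp
      have "\<bar>A $$ (\<rho>, j')\<bar> \<le> entry_bound t R A" using entry_bound[OF \<rho> j', of A] by linarith
      then show "\<bar>A $$ (\<rho>, j') * l $ (i * t + j')\<bar> \<le> entry_bound t R A * 2 ^ L"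
        unfolding abs_mult using abs_entries_le(1)[OF brick_index[OF ij(1) j']] by (intro mult_mono) auto
    qed
    ultimately have "\<bar>x0 q\<bar> \<le> 2 ^ L + int t * (entry_bound t R A * 2 ^ L)"
      unfolding x by (simp add: abs_le_iff)
    then show ?thesis by (simp add: alpha_def algebra_simps)
  qed
qed

definition gamma :: int where
  "gamma = 1 + int T * (2 * alpha ^ 2)"

text \<open>The squares in the slack bounds contribute \<open>4 ^ L\<close>, and the factor
  \<open>n\<close> another \<open>2 ^ L\<close>; hence \<open>3 * L\<close>. What depends on the
  matrix alone goes into \<open>gamma\<close>, and the number of step lengths is linear in
  \<open>L\<close>.\<close>

lemma span_le: "span \<le> 2 ^ (nat gamma + 3 * L)"
proof -
  note a = alpha_pos
  then have a2: "1 \<le> alpha ^ 2" by simp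
  have diff: "up q - lo q \<le> 2 * alpha ^ 2 * 4 ^ L" if q: "q < n * T" for q
  proof (cases "q mod T < t")
    case True
    let ?k = "q div T * t + q mod T"
    have "?k < n * t" using True q less_mult_imp_div_less brick_index by blast
    then have "u $ ?k - l $ ?k \<le> 2 * 2 ^ L" using abs_entries_le(1,2)[of ?k] by linarith
    also have "\<dots> \<le> 2 * 4 ^ L" by (simp add: power_mono)
    also have "\<dots> \<le> 2 * alpha ^ 2 * 4 ^ L" using a2 by simp
    finally show ?thesis using True by (simp add: lo_def up_def)
  next
    case False
    have "x0 q * x0 q = \<bar>x0 q\<bar> * \<bar>x0 q\<bar>" by simp
    also have "\<dots> \<le> (alpha * 2 ^ L) * (alpha * 2 ^ L)" using abs_x0_le[OF q] a by (intro mult_mono) auto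
    also have "\<dots> = alpha ^ 2 * 4 ^ L" by (simp add: power2_eq_square power_mult_distrib[symmetric] ac_simps)
    finally show ?thesis using False by (simp add: lo_def up_def)
  qed
  have "span \<le> 1 + (\<Sum>q<n * T. 2 * alpha ^ 2 * 4 ^ L)"
    unfolding span_def using diff by (intro add_left_mono sum_mono) auto
  also have "\<dots> = 1 + int n * (int T * (2 * alpha ^ 2) * 4 ^ L)" by (simp add: mult.assoc)
  also have "\<dots> \<le> int n * 4 ^ L + int n * (int T * (2 * alpha ^ 2) * 4 ^ L)"
    using n_pos by (intro add_right_mono) (simp add: mult_pos_pos Suc_leI int_one_le_iff_zero_less)
  also have "\<dots> = int n * (gamma * 4 ^ L)" by (simp add: gamma_def algebra_simps)
  also have "\<dots> \<le> 2 ^ L * (2 ^ nat gamma * 4 ^ L)"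
  proof (intro mult_mono)
    have "int n < 2 ^ n" using of_nat_less_two_power .
    also have "\<dots> \<le> 2 ^ L" using n_le_L by (intro power_increasing) auto
    finally show "int n \<le> 2 ^ L" by simp
    have "0 \<le> gamma" using a2 by (simp add: gamma_def)
    then show "gamma \<le> 2 ^ nat gamma" using of_nat_less_two_power[of "nat gamma", where ?'a = int] by simp
  qed (use a2 in \<open>auto simp: gamma_def\<close>)
  also have "\<dots> = 2 ^ (nat gamma + 3 * L)"
    by (simp add: power_add power_mult power_mult_distrib[symmetric])
  finally show ?thesis .
qed

end

theorem theorem4p2:
  fixes p r s t :: nat and A :: "int mat"
  assumes "p > 0" and "t > 0" and "A \<in> carrier_mat (r + s) t"
  shows "\<exists>(prog :: com) (C :: nat).
    \<forall>(n :: nat) (b :: int vec) (l :: int vec) (u :: int vec)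
       (f :: real vec \<Rightarrow> real) (F :: nat \<Rightarrow> nat \<Rightarrow> pwa).
      n > 0 \<longrightarrow>
      b \<in> carrier_vec (r + n * s) \<longrightarrow>
      l \<in> carrier_vec (n * t) \<longrightarrow>
      u \<in> carrier_vec (n * t) \<longrightarrow>
      separable_convex_piecewise_affine p t n l u f F \<longrightarrow>
      (\<exists>\<tau> \<sigma>. exec prog (input_store p t n F b l u) \<tau> \<sigma> \<and>
             \<tau> \<le> C * (n ^ 3 * input_length t n F b l u) \<and>
             solves (n * t) (feasible_set r s t A n b l u) f \<sigma>)"
proof -
  interpret lat: nfold_lattice "t + (r + s)" r "r + s" "ext_mat t A"
    by unfold_locales (use assms(2) in simp)
  obtain K where "\<And>n P h. h \<in> lat.lattice n P \<Longrightarrow> h \<noteq> (\<lambda>_. 0) \<Longrightarrow>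
     \<exists>h'\<in>lat.lattice n P. h' \<noteq> (\<lambda>_. 0) \<and> conformal h' h \<and> lat.l1 (n * (t + (r + s))) h' \<le> K"
    using lat.small_element by blast
  then interpret prog: nfold_program p r s t A K
    by unfold_locales (use assms(2) in simp_all)
  let ?T = "t + (r + s)"
  define c where "c = 2 * flat_cost ?T prog.init_code + 2 * flat_cost ?T prog.final_code + 2"
  define \<gamma> where "\<gamma> = nat (1 + int ?T * (2 * (1 + int t * entry_bound t (r + s) A) ^ 2))"
  show ?thesis
  \<comment> \<open>\<open>c\<close> pays for initialisation and read-out, which are linear in
    \<open>n\<close>. The factor \<open>\<gamma> + 5\<close> comes from the
    \<open>\<gamma> + 3 * L + 2\<close> in the bound for the scaling, since \<open>L\<close> is at
    least 1.\<close>
  proof (rule exI[of _ prog.program], rule exI[of _ "c + (\<gamma> + 5) * prog.scaling_cost"], intro allI impI)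
    fix n :: nat and b l u :: "int vec" and f :: "real vec \<Rightarrow> real" and F :: "nat \<Rightarrow> nat \<Rightarrow> pwa"
    assume n: "n > 0" and bl: "b \<in> carrier_vec (r + n * s)" "l \<in> carrier_vec (n * t)" "u \<in> carrier_vec (n * t)"
      and sep: "separable_convex_piecewise_affine p t n l u f F"
    from sep obtain g where "\<forall>x\<in>carrier_vec (n * t). f x = (\<Sum>i<n. \<Sum>j<t. g i j (x $ (i * t + j)))"
      "\<forall>i<n. \<forall>j<t. convex_on UNIV (g i j) \<and>
           piecewise_affine p (l $ (i * t + j)) (u $ (i * t + j)) (g i j) (F i j)"
      unfolding separable_convex_piecewise_affine_def by blast
    then interpret inst: nfold_instance p r s t A K n b l u F g f
      using n bl by unfold_locales auto
    let ?L = "input_length t n F b l u"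
    have gamma: "nat inst.gamma = \<gamma>" unfolding inst.gamma_def inst.alpha_def \<gamma>_def ..
    obtain \<tau> \<sigma> where e: "exec prog.program inst.\<sigma>0 \<tau> \<sigma>"
      "\<tau> \<le> Suc n * flat_cost ?T prog.init_code + (\<gamma> + 3 * ?L + 2) * n ^ 2 * prog.scaling_cost +
        Suc n * flat_cost ?T prog.final_code + 2"
      "solves (n * t) (feasible_set r s t A n b l u) f \<sigma>"
      using inst.exec_program[OF inst.span_le] unfolding gamma by blast
    have L: "1 \<le> ?L" using inst.n_le_L n by linarith
    have nL: "n \<le> n ^ 3 * ?L" "1 \<le> n ^ 3 * ?L"
      using mult_le_mono[OF self_le_power[of n 3] L] n L by simp_all
    have "Suc n * flat_cost ?T prog.init_code + Suc n * flat_cost ?T prog.final_code + 2 \<le> c * (n ^ 3 * ?L)"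
    proof -
      have "Suc n * k \<le> (2 * k) * (n ^ 3 * ?L)" for k
      proof -
        have "Suc n * k \<le> (2 * (n ^ 3 * ?L)) * k" using nL by (intro mult_le_mono1) linarith
        then show ?thesis by (simp only: ac_simps)
      qed
      then show ?thesis using nL(2) unfolding c_def distrib_right by (intro add_mono) auto
    qed
    moreover have "(\<gamma> + 3 * ?L + 2) * n ^ 2 * prog.scaling_cost \<le> ((\<gamma> + 5) * prog.scaling_cost) * (n ^ 3 * ?L)"
    proof -
      have "\<gamma> + 3 * ?L + 2 \<le> (\<gamma> + 5) * ?L"
        using L mult_le_mono2[OF L, of \<gamma>] unfolding distrib_right by linarith
      \<comment> \<open>The bound for the scaling is quadratic in \<open>n\<close>; it is weakened
        here to the cubic one claimed.\<close>
      moreover have "n ^ 2 \<le> n ^ 3" using n by (intro power_increasing) auto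
      ultimately have "(\<gamma> + 3 * ?L + 2) * n ^ 2 * prog.scaling_cost \<le> ((\<gamma> + 5) * ?L) * n ^ 3 * prog.scaling_cost"
        by (intro mult_le_mono) auto
      then show ?thesis by (simp only: ac_simps)
    qed
    ultimately have "\<tau> \<le> (c + (\<gamma> + 5) * prog.scaling_cost) * (n ^ 3 * ?L)"
      using e(2) unfolding distrib_right by linarith
    then show "\<exists>\<tau> \<sigma>. exec prog.program (input_store p t n F b l u) \<tau> \<sigma> \<and>
             \<tau> \<le> (c + (\<gamma> + 5) * prog.scaling_cost) * (n ^ 3 * input_length t n F b l u) \<and>
             solves (n * t) (feasible_set r s t A n b l u) f \<sigma>"
      using e(1,3) unfolding inst.\<sigma>0_def by blast
  qed
qed

end
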